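(* (a) Let $k>3$ be an integer and let $m=\lfloor k/2\rfloor-1$. Let $F$ be a function on $(0,\infty)$ such that $F, F', F'',\dots,F^{(2m-1)}$ are integrals and $F(x), xF'(x), x^2F''(x),\dots,x^{2m}F^{(2m)}(x)$ belong to $L^2(0,\infty)$. Assume that, for some fixed $\tau>0$, $$F(x)=O_k\left(x^{-\frac{k}{4}-\frac12-\tau}\right)\qquad (x\to\infty).$$ Define $$G(y)=\pi\int_0^\infty F(t)\,J_{\frac{k}{2}-1}(2\pi\sqrt{yt})\,dt,$$ and assume that $$G(y)=O_k\left(y^{-\frac{k}{4}-\frac12-\tau}\right)\qquad (y\to\infty).$$ Then $$\sum_{n=1}^\infty r_k(n)n^{\frac12-\frac{k}{4}}F(n)-\frac{\pi^{k/2}}{\Gamma(k/2)}\int_0^\infty x^{\frac{k}{4}-\frac12}F(x)\,dx=\sum_{n=1}^\infty r_k(n)n^{\frac12-\frac{k}{4}}G(n)-\frac{\pi^{k/2}}{\Gamma(k/2)}\int_0^\infty x^{\frac{k}{4}-\frac12}G(x)\,dx .$$ (b) For $k=2$ and $k=3$, the same identity holds if $F$ is continuous on $[0,\infty)$, $F(x)$ and $xF'(x)$ belong to $L^2(0,\infty)$, $F(x)=O_k(x^{-\frac{k}{4}-\frac12-\tau})$ as $x\to\infty$ for some fixed $\tau>0$, and the function $G(y)=\pi\int_0^\infty F(t)J_{\frac{k}{2}-1}(2\pi\sqrt{yt})\,dt$ satisfies $G(y)=O_k(y^{-\frac{k}{4}-\frac12-\tau})$ as $y\to\infty$.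
   Context: $r_k(n)$ is the number of representations of the integer $n$ as a sum of $k$ squares of integers, where different signs and different orders of the summands give distinct representations. $J_\mu$ is the ordinary Bessel function of the first kind of order $\mu$, $J_\mu(z)=\sum_{j\ge0}\frac{(-1)^j(z/2)^{2j+\mu}}{j!\,\Gamma(j+1+\mu)}$. A function on $(0,\infty)$ is said to be "an integral" if it is an indefinite (Lebesgue) integral of its derivative, i.e. it is locally absolutely continuous on $(0,\infty)$. *)

theory Defs
  imports "HOL-Analysis.Analysis" "HOL-Library.Landau_Symbols"
begin

definition sum_squares_count :: "nat \<Rightarrow> int \<Rightarrow> nat" where
  "sum_squares_count k n = card {xs :: int list. length xs = k \<and> (\<Sum>x\<leftarrow>xs. x\<^sup>2) = n}"

text \<open>Meant for \<open>z > 0\<close>, where \<open>powr\<close> is the usual real power (\<open>0 powr 0 = 0\<close> would give the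
  wrong value of \<open>J\<^sub>0\<close> at \<open>0\<close>).\<close>
definition bessel_J :: "real \<Rightarrow> real \<Rightarrow> real" where
  "bessel_J \<mu> z =
     (\<Sum>j. (-1) ^ j * (z / 2) powr (2 * real j + \<mu>) / (fact j * Gamma (real j + 1 + \<mu>)))"

text \<open>Iterated pointwise derivative. Where a derivative does not exist, the value of
  \<open>vector_derivative\<close> is unspecified, so uses have to ensure existence separately.\<close>
definition nth_vderiv :: "nat \<Rightarrow> (real \<Rightarrow> complex) \<Rightarrow> real \<Rightarrow> complex" where
  "nth_vderiv j f = ((\<lambda>g x. vector_derivative g (at x)) ^^ j) f"

text \<open>A function on \<open>(0,\<infinity>)\<close> that is an indefinite Lebesgue integral of its (almost everywhere
  existing) derivative, equivalently a locally absolutely continuous one.\<close>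
definition is_integral :: "(real \<Rightarrow> complex) \<Rightarrow> bool" where
  "is_integral f \<longleftrightarrow>
     (AE x in lebesgue. 0 < x \<longrightarrow> f differentiable (at x)) \<and>
     (\<forall>a b. 0 < a \<and> a \<le> b \<longrightarrow>
        set_integrable lebesgue {a..b} (\<lambda>x. vector_derivative f (at x)) \<and>
        f b - f a = (LINT x:{a..b}|lebesgue. vector_derivative f (at x)))"

definition L2_half_line :: "(real \<Rightarrow> complex) \<Rightarrow> bool" where
  "L2_half_line f \<longleftrightarrow>
     set_borel_measurable lebesgue {0<..} f \<and>
     set_integrable lebesgue {0<..} (\<lambda>x. (norm (f x))\<^sup>2)"

end

theory Submission
  imports Defs "HOL-Probability.Probability" "HOL-Real_Asymp.Real_Asymp"
begin

text \<open>
  The identity is Poisson's formula \<open>\<Sum>f(x) = \<Sum>f^(\<xi>)\<close> over the lattice of integer points of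
  \<open>k\<close>-dimensional space for a radial function. With \<open>a = k/2\<close> and \<open>b = (a - 1)/2 = k/4 - 1/2\<close> put
  \<open>f(x) = |x|\<^sup>-\<^sup>2\<^sup>b F(|x|\<^sup>2)\<close>. Its Fourier transform is \<open>f^(\<xi>) = |\<xi>|\<^sup>-\<^sup>2\<^sup>b G(|\<xi>|\<^sup>2)\<close>, each value of
  \<open>|x|\<^sup>2 = n\<close> is taken \<open>r\<^sub>k(n)\<close> times, and the two terms at the origin are \<open>\<pi>\<^sup>a/\<Gamma>(a)\<close> times the
  integrals of \<open>x\<^sup>b G\<close> and of \<open>x\<^sup>b F\<close>. The function \<open>f\<close> is integrable, continuous away from the
  origin, and both \<open>f\<close> and its transform decay like \<open>|x|\<close> to a power below \<open>-k\<close>.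

  The proof stays on the half line \<open>t = |x|\<^sup>2 > 0\<close>. It rests on four facts.

  (1) Up to a null set, a function on the half line is determined by its Laplace transform at the
  multiples of a fixed number (\<open>laplace_transform_unique\<close>).

  (2) The theta function satisfies \<open>\<theta>(w) = w\<^sup>-\<^sup>1\<^sup>/\<^sup>2 \<theta>(1/w)\<close> (\<open>theta_inversion\<close>). By (1) it suffices to
  compare Laplace transforms, and that comparison is the partial fraction expansion of \<open>coth\<close>.
  Taking \<open>k\<close>-th powers gives a modular relation of weight \<open>a\<close> for the numbers \<open>r\<^sub>k(n)\<close>
  (\<open>theta_power_sums\<close>).

  (3) Averaging Poisson's formula for a Gaussian centred at \<open>y\<close> over the sphere \<open>|y|\<^sup>2 = t\<close> yields
  an identity between a sum of heat kernels and a sum of Bessel functions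
  (\<open>heat_sum_eq_bessel_sum\<close>). Again by (1) it is enough to compare Laplace transforms in \<open>t\<close>, and
  these agree by the modular relation of (2). The proof works for every nonnegative sequence with a
  modular relation of real weight \<open>a \<ge> 1\<close>, so it is carried out in a locale \<open>theta_sequence\<close>.

  (4) Integrating (3) against \<open>h(t) = t\<^sup>b F(t)\<close> gives a smoothed form of the summation formula
  (\<open>smoothed_summation\<close>). The heat kernel \<open>heat_kernel a s n\<close> is an approximate identity at \<open>n\<close> as
  \<open>s\<close> tends to infinity, and the decay of \<open>F\<close> and \<open>G\<close> allows passing to the limit term by term
  (\<open>voronoi_summation\<close>). Only the term at the origin needs care, since \<open>f\<close> may have no value
  there: by Fubini it is an integral of the transform, which converges to the integral of \<open>x\<^sup>b G\<close>.
\<close>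

section \<open>Integration over the positive half line\<close>

text \<open>
  Lebesgue measure on the positive half line, as a density on the whole line: its measurable sets
  are then all Borel sets of the line, and no function has to be restricted to be measurable.
\<close>
definition hline :: "real measure" where
  "hline = density lborel (indicator {0<..})"

lemma sets_hline [simp, measurable_cong]: "sets hline = sets borel"
  by (simp add: hline_def)

lemma space_hline [simp]: "space hline = UNIV"
  by (simp add: hline_def)

lemma AE_hline: "(AE t in hline. P t) \<longleftrightarrow> (AE t in lborel. 0 < t \<longrightarrow> P t)"
  unfolding hline_def by (subst AE_density) (auto intro!: AE_cong simp: indicator_def)

lemma AE_hline_pos: "AE t in hline. 0 < t"
  by (simp add: AE_hline)

lemma hline_density_real: "hline = density lborel (\<lambda>t. ennreal (indicator {0<..} t :: real))"
  unfolding hline_def by (intro density_cong) (auto simp: indicator_def)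

lemma integrable_hline:
  fixes f :: "real \<Rightarrow> 'a::{banach, second_countable_topology}"
  assumes [measurable]: "f \<in> borel_measurable borel"
  shows "integrable hline f \<longleftrightarrow> set_integrable lborel {0<..} f"
  unfolding hline_density_real set_integrable_def
  by (subst integrable_density) (auto simp: indicator_def)

lemma integral_hline:
  fixes f :: "real \<Rightarrow> 'a::{banach, second_countable_topology}"
  assumes [measurable]: "f \<in> borel_measurable borel"
  shows "integral\<^sup>L hline f = (LBINT t:{0<..}. f t)"
  unfolding hline_density_real set_lebesgue_integral_def
  by (subst integral_density) (auto simp: indicator_def)

interpretation hline: sigma_finite_measure hline
  unfolding hline_def
  by (subst sigma_finite_measure.sigma_finite_iff_density_finite[OF sigma_finite_lborel]) (auto simp: indicator_def)

lemma integrable_hline_tail: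
  fixes f :: "real \<Rightarrow> 'b :: {banach, second_countable_topology}"
  assumes [measurable]: "f \<in> borel_measurable borel" and \<tau>: "\<tau> > 0"
    and u: "set_integrable lborel {0<..1} u"
    and near: "\<And>t. 0 < t \<Longrightarrow> t \<le> 1 \<Longrightarrow> norm (f t) \<le> u t"
    and far: "\<And>t. 1 < t \<Longrightarrow> norm (f t) \<le> C * t powr (- 1 - \<tau>)"
  shows "integrable hline f"
proof -
  have "((\<lambda>t. t powr (- 1 - \<tau>)) has_integral - (1 powr (- 1 - \<tau> + 1)) / (- 1 - \<tau> + 1)) {1..}"
    using \<tau> by (intro has_integral_powr_to_inf) auto
  then have "(\<lambda>t. t powr (- 1 - \<tau>)) absolutely_integrable_on {1..}"
    by (intro nonnegative_absolutely_integrable_1) (auto simp: integrable_on_def)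
  then have "set_integrable lborel {1..} (\<lambda>t. t powr (- 1 - \<tau>))"
    unfolding set_integrable_def by (subst (asm) integrable_completion) auto
  then have "set_integrable lborel {1<..} (\<lambda>t. t powr (- 1 - \<tau>))"
    by (rule set_integrable_subset) auto
  then have "set_integrable lborel {1<..} (\<lambda>t. C * t powr (- 1 - \<tau>))"
    by (rule set_integrable_mult_right)
  then have 1: "set_integrable lborel {1<..} f"
    unfolding set_integrable_def
    by (rule Bochner_Integration.integrable_bound)
       (auto simp: indicator_def intro: order_trans[OF far abs_ge_self])
  have 2: "set_integrable lborel {0<..1} f"
    using u unfolding set_integrable_def
    by (rule Bochner_Integration.integrable_bound)
       (auto simp: indicator_def intro: order_trans[OF near abs_ge_self])
  have "set_integrable lborel ({0<..1} \<union> {1<..}) f"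
    by (intro set_integrable_Un 1 2) auto
  also have "{0<..(1::real)} \<union> {1<..} = {0<..}" by auto
  finally show ?thesis by (subst integrable_hline) auto
qed

lemma has_bochner_integral_suminf_nonneg:
  fixes f :: "nat \<Rightarrow> 'a \<Rightarrow> real"
  assumes int: "\<And>n. has_bochner_integral M (f n) (I n)"
    and nonneg: "AE x in M. \<forall>n. 0 \<le> f n x"
    and summ: "AE x in M. summable (\<lambda>n. f n x)"
    and I: "summable I"
  shows "has_bochner_integral M (\<lambda>x. \<Sum>n. f n x) (\<Sum>n. I n)"
proof -
  have i: "integrable M (f n)" "integral\<^sup>L M (f n) = I n" for n
    using int[of n] by (auto simp: has_bochner_integral_iff)
  have s1: "AE x in M. summable (\<lambda>n. norm (f n x))"
    using nonneg summ by eventually_elim simp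
  have "integral\<^sup>L M (\<lambda>x. norm (f n x)) = I n" for n
    unfolding i(2)[symmetric] using nonneg i(1)[of n]
    by (intro integral_cong_AE) (auto elim: eventually_mono)
  then have s2: "summable (\<lambda>n. integral\<^sup>L M (\<lambda>x. norm (f n x)))" using I by simp
  show ?thesis
    using integrable_suminf[OF i(1) s1 s2] integral_suminf[OF i(1) s1 s2]
    by (simp add: has_bochner_integral_iff i(2))
qed

lemma has_bochner_integral_suminf_dominated:
  fixes f :: "nat \<Rightarrow> 'a \<Rightarrow> 'b :: {banach, second_countable_topology}"
  assumes int: "\<And>n. has_bochner_integral M (f n) (I n)"
    and bound: "AE x in M. \<forall>n. norm (f n x) \<le> q n * g x"
    and g: "integrable M g" and q: "summable q"
  shows "has_bochner_integral M (\<lambda>x. \<Sum>n. f n x) (\<Sum>n. I n)" and "summable I"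
proof -
  have i: "integrable M (f n)" "integral\<^sup>L M (f n) = I n" for n
    using int[of n] by (auto simp: has_bochner_integral_iff)
  have s1: "AE x in M. summable (\<lambda>n. norm (f n x))"
    using bound
    by eventually_elim (rule summable_comparison_test'[OF summable_mult2[OF q]], auto)
  have s2: "summable (\<lambda>n. integral\<^sup>L M (\<lambda>x. norm (f n x)))"
  proof (rule summable_comparison_test'[OF summable_mult2[OF q, of "integral\<^sup>L M g"]])
    fix n
    have "integral\<^sup>L M (\<lambda>x. norm (f n x)) \<le> integral\<^sup>L M (\<lambda>x. q n * g x)"
      using bound g i(1) by (intro integral_mono_AE) (auto elim: eventually_mono)
    then show "norm (integral\<^sup>L M (\<lambda>x. norm (f n x))) \<le> q n * integral\<^sup>L M g"
      by simp
  qed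
  show "has_bochner_integral M (\<lambda>x. \<Sum>n. f n x) (\<Sum>n. I n)"
    using integrable_suminf[OF i(1) s1 s2] integral_suminf[OF i(1) s1 s2]
    by (simp add: has_bochner_integral_iff i(2))
  show "summable I"
    using summable_integral[OF i(1) s1 s2] by (simp add: i(2))
qed

lemma integral_norm_le_AE:
  fixes f :: "'a \<Rightarrow> 'b :: {banach, second_countable_topology}"
  assumes "integrable M f" "integrable M g" "AE x in M. norm (f x) \<le> g x"
  shows "norm (integral\<^sup>L M f) \<le> integral\<^sup>L M g"
  using assms by (intro order_trans[OF Bochner_Integration.integral_norm_bound] integral_mono_AE) auto

section \<open>Uniqueness of Laplace transforms\<close>

text \<open>
  Under \<open>t \<mapsto> exp (- b t)\<close> the positive and negative parts of \<open>g(t) exp (- b t)\<close> become finite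
  measures on the unit interval with equal moments. Power series expansion of the exponential turns
  equal moments into equal characteristic functions, so Levy's theorem identifies the two measures.
  As \<open>t\<close> can be recovered from \<open>exp (- b t)\<close>, the two parts agree almost everywhere.
\<close>
theorem laplace_transform_unique:
  fixes g :: "real \<Rightarrow> real" and b :: real
  assumes g [measurable]: "g \<in> borel_measurable borel" and b: "b > 0"
    and int: "\<And>j. j \<ge> 1 \<Longrightarrow> integrable hline (\<lambda>t. g t * exp (- (b * real j * t)))"
    and zero: "\<And>j. j \<ge> 1 \<Longrightarrow> (\<integral>t. g t * exp (- (b * real j * t)) \<partial>hline) = 0"
  shows "AE t in hline. g t = 0"
proof -
  define f where "f = (\<lambda>t. g t * exp (- (b * t)))"
  define fp fm where "fp = (\<lambda>t. max 0 (f t))" and "fm = (\<lambda>t. max 0 (- f t))"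
  have [measurable]: "f \<in> borel_measurable borel" "fp \<in> borel_measurable borel"
    "fm \<in> borel_measurable borel"
    unfolding fp_def fm_def f_def by measurable
  have f_int: "integrable hline f" using int[of 1] by (simp add: f_def)
  have fp_int: "integrable hline fp" and fm_int: "integrable hline fm"
    unfolding fp_def fm_def by (auto intro!: integrable_max f_int)
  have f_split: "f t = fp t - fm t" for t by (auto simp: fp_def fm_def max_def)
  have "(\<integral>t. f t \<partial>hline) = 0" using zero[of 1] by (simp add: f_def)
  then have mass: "(\<integral>t. fp t \<partial>hline) = (\<integral>t. fm t \<partial>hline)"
    by (simp add: f_split[abs_def] fp_int fm_int)
  define m where "m = (\<integral>t. fp t \<partial>hline)"
  have nn: "fp t \<ge> 0" "fm t \<ge> 0" for t by (auto simp: fp_def fm_def)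
  have "m \<ge> 0" unfolding m_def by (intro integral_nonneg_AE) (simp add: nn)
  have "AE t in hline. fp t = fm t"
  proof (cases "m = 0")
    case True
    have "AE t in hline. fp t = 0"
      using integral_nonneg_eq_0_iff_AE[OF fp_int] nn True by (simp add: m_def)
    moreover have "AE t in hline. fm t = 0"
      using integral_nonneg_eq_0_iff_AE[OF fm_int] nn True mass by (simp add: m_def)
    ultimately show ?thesis by eventually_elim simp
  next
    case False
    with \<open>m \<ge> 0\<close> have m: "m > 0" by simp
    define D where "D = (\<lambda>q. density hline (\<lambda>t. ennreal (q t / m)))"
    define X where "X = (\<lambda>t::real. exp (- (b * t)))"
    have [measurable]: "X \<in> borel_measurable borel" unfolding X_def by measurable
    have prob: "prob_space (D q)" if "q \<in> borel_measurable borel" "\<And>t. q t \<ge> 0"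
        "integrable hline q" "(\<integral>t. q t \<partial>hline) = m" for q
    proof
      have "emeasure (D q) (space (D q)) = (\<integral>\<^sup>+t. ennreal (q t / m) \<partial>hline)"
        unfolding D_def using that by (subst emeasure_density) auto
      also have "\<dots> = ennreal (\<integral>t. q t / m \<partial>hline)"
        using that m by (intro nn_integral_eq_integral) auto
      finally show "emeasure (D q) (space (D q)) = 1" using that m by simp
    qed
    have pp: "prob_space (D fp)" and pm: "prob_space (D fm)"
      using nn fp_int fm_int mass by (auto intro!: prob simp: m_def)
    have char_D: "char (distr (D q) borel X) u = (\<integral>t. (q t / m) *\<^sub>R iexp (u * X t) \<partial>hline)"
      if [measurable]: "q \<in> borel_measurable borel" and "\<And>t. q t \<ge> 0" for q u
    proof -
      have [measurable]: "X \<in> D q \<rightarrow>\<^sub>M borel" by (simp add: D_def)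
      show ?thesis unfolding char_def
        by (subst integral_distr, simp, simp, simp add: D_def)
          (subst integral_density, use that m in auto)
    qed
    have main: "(\<integral>t. (f t) *\<^sub>R iexp (u * X t) \<partial>hline) = 0" for u
    proof -
      \<comment> \<open>the terms of the exponential series; the integral of \<open>e j\<close> is a multiple of the \<open>(j+1)\<close>-st
        vanishing Laplace integral\<close>
      define e where "e = (\<lambda>j t. (f t) *\<^sub>R ((\<i> * complex_of_real (u * X t)) ^ j /\<^sub>R fact j))"
      have X01: "AE t in hline. 0 \<le> X t \<and> X t \<le> 1"
        using AE_hline_pos by eventually_elim (use b in \<open>auto simp: X_def\<close>)
      have e_eq: "e j t = (\<i> * complex_of_real u) ^ j / fact j
          * complex_of_real (g t * exp (- (b * real (Suc j) * t)))" for j t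
      proof -
        have "exp (- (b * t)) * exp (- (b * t)) ^ j = exp (- (b * real (Suc j) * t))"
          by (simp flip: exp_of_nat_mult exp_add add: algebra_simps)
        then show ?thesis
          unfolding e_def f_def X_def
          by (simp add: scaleR_conv_of_real power_mult_distrib field_simps flip: of_real_power of_real_mult)
      qed
      have e_int: "integrable hline (e j)" for j
        unfolding e_eq using int[of "Suc j"] by (intro integrable_mult_right integrable_of_real) auto
      have "(\<integral>t. e j t \<partial>hline) = 0" for j
        unfolding e_eq using zero[of "Suc j"]
        by (simp only: integral_mult_right_zero integral_complex_of_real) simp
      moreover have "(\<lambda>j. \<integral>t. e j t \<partial>hline) sums (\<integral>t. (\<Sum>j. e j t) \<partial>hline)"
      proof (rule sums_integral)
        show "integrable hline (e j)" for j by (rule e_int)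
        have ne: "norm (e j t) = \<bar>f t\<bar> * ((\<bar>u\<bar> * \<bar>X t\<bar>) ^ j / fact j)" for j t
          by (simp add: e_def norm_mult norm_power abs_mult divide_inverse)
        show "AE t in hline. summable (\<lambda>j. norm (e j t))"
          unfolding ne
          by (intro AE_I2 summable_mult) (use summable_exp[of "\<bar>u\<bar> * \<bar>X _\<bar>"] in \<open>simp add: divide_inverse mult.commute\<close>)
        show "summable (\<lambda>j. \<integral>t. norm (e j t) \<partial>hline)"
        proof (rule summable_comparison_test')
          show "summable (\<lambda>j. (\<integral>t. \<bar>f t\<bar> \<partial>hline) * (\<bar>u\<bar> ^ j / fact j))"
            by (intro summable_mult) (use summable_exp[of "\<bar>u\<bar>"] in \<open>simp add: divide_inverse mult.commute\<close>)
          fix j :: nat assume "j \<ge> 0"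
          have "(\<integral>t. norm (e j t) \<partial>hline) \<le> (\<integral>t. \<bar>f t\<bar> * (\<bar>u\<bar> ^ j / fact j) \<partial>hline)"
          proof (intro integral_mono_AE)
            show "integrable hline (\<lambda>t. norm (e j t))" using e_int by simp
            show "integrable hline (\<lambda>t. \<bar>f t\<bar> * (\<bar>u\<bar> ^ j / fact j))" using f_int by auto
            show "AE t in hline. norm (e j t) \<le> \<bar>f t\<bar> * (\<bar>u\<bar> ^ j / fact j)"
              using X01 unfolding ne
              by eventually_elim
                (auto intro!: mult_left_mono divide_right_mono power_mono mult_left_le)
          qed
          also have "\<dots> = (\<integral>t. \<bar>f t\<bar> \<partial>hline) * (\<bar>u\<bar> ^ j / fact j)" by simp
          finally show "norm (\<integral>t. norm (e j t) \<partial>hline) \<le> (\<integral>t. \<bar>f t\<bar> \<partial>hline) * (\<bar>u\<bar> ^ j / fact j)"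
            by simp
        qed
      qed
      moreover have "(\<Sum>j. e j t) = (f t) *\<^sub>R iexp (u * X t)" for t
      proof -
        have "(\<lambda>j. (\<i> * complex_of_real (u * X t)) ^ j /\<^sub>R fact j) sums iexp (u * X t)"
          by (rule exp_converges)
        then show ?thesis unfolding e_def by (intro sums_unique[symmetric] sums_scaleR_right)
      qed
      ultimately show ?thesis by (simp add: sums_iff)
    qed
    have "char (distr (D fp) borel X) = char (distr (D fm) borel X)"
    proof
      fix u
      have I: "integrable hline (\<lambda>t. (q t / m) *\<^sub>R iexp (u * X t))" 
        if "q \<in> borel_measurable borel" "integrable hline q" for q
        by (rule Bochner_Integration.integrable_bound[OF that(2)[THEN integrable_divide_zero, of m]])
           (use that(1) in auto)
      have "(\<integral>t. (fp t / m) *\<^sub>R iexp (u * X t) \<partial>hline) - (\<integral>t. (fm t / m) *\<^sub>R iexp (u * X t) \<partial>hline)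
         = (\<integral>t. (1/m) *\<^sub>R (f t *\<^sub>R iexp (u * X t)) \<partial>hline)"
        by (subst Bochner_Integration.integral_diff[symmetric])
           (auto intro!: I[simplified] fp_int fm_int Bochner_Integration.integral_cong simp: f_split algebra_simps diff_divide_distrib)
      also have "\<dots> = 0" by (subst integral_scaleR_right) (simp only: main scaleR_zero_right)
      finally show "char (distr (D fp) borel X) u = char (distr (D fm) borel X) u"
        by (simp add: char_D nn)
    qed
    then have eq: "distr (D fp) borel X = distr (D fm) borel X"
      by (intro Levy_uniqueness prob_space.real_distribution_distr pp pm) (auto simp: D_def)
    have pull: "distr (distr (D q) borel X) borel (\<lambda>x. - ln x / b) = D q" for q
    proof -
      have [measurable]: "X \<in> D q \<rightarrow>\<^sub>M borel" by (simp add: D_def)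
      have "(\<lambda>x. - ln x / b) \<circ> X = id" using b by (auto simp: X_def)
      then show ?thesis
        by (subst distr_distr) (auto simp: id_def D_def intro!: distr_id2)
    qed
    have "D fp = D fm" using pull[of fp] pull[of fm] eq by simp
    then have "AE t in hline. ennreal (fp t / m) = ennreal (fm t / m)"
      unfolding D_def by (intro hline.density_unique) auto
    then show ?thesis
      by eventually_elim (use m nn in \<open>auto simp: divide_right_mono\<close>)
  qed
  then show ?thesis
  proof eventually_elim
    case (elim t)
    then have "f t = 0" by (simp add: f_split)
    then show ?case by (simp add: f_def)
  qed
qed

section \<open>The hypergeometric form of the Bessel functions\<close>

text \<open>
  The confluent hypergeometric series \<open>\<^sub>0F\<^sub>1(a; x)\<close>. The functions \<open>J\<close> and \<open>I\<close> of order \<open>a - 1\<close> are a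
  constant times \<open>z\<^sup>a\<^sup>-\<^sup>1\<close> times its values at \<open>-z\<^sup>2/4\<close> and \<open>z\<^sup>2/4\<close>. Since it is entire in \<open>x\<close>, one
  function serves for both and no root has to be chosen.
\<close>
definition hyp01 :: "real \<Rightarrow> real \<Rightarrow> real" where
  "hyp01 a x = (\<Sum>j. x ^ j / (fact j * pochhammer a j))"

lemma pochhammer_ge_fact: 
  fixes a :: real assumes "a \<ge> 1" shows "pochhammer a j \<ge> fact j"
proof (induction j)
  case (Suc j)
  have "fact j * (1 + real j) \<le> pochhammer a j * (a + real j)"
    using Suc assms pochhammer_pos[of a j] by (intro mult_mono) auto
  then show ?case by (simp add: pochhammer_Suc algebra_simps)
qed simp

lemma pochhammer_ge_1:
  fixes a :: real assumes "a \<ge> 1" shows "pochhammer a j \<ge> 1"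
  using pochhammer_ge_fact[OF assms, of j] fact_ge_1[of j, where 'a=real] by linarith

lemma norm_hyp01_term_le:
  fixes a x :: real assumes "a \<ge> 1"
  shows "norm (x ^ j / (fact j * pochhammer a j)) \<le> \<bar>x\<bar> ^ j / fact j"
proof -
  have "fact j * 1 \<le> fact j * pochhammer a j"
    using pochhammer_ge_1[OF assms] by (intro mult_left_mono) auto
  then show ?thesis
    using pochhammer_ge_1[OF assms, of j] by (auto simp: abs_mult power_abs intro!: divide_left_mono)
qed

lemma summable_power_fact: "summable (\<lambda>j. (x::real) ^ j / fact j)"
  using summable_exp[of x] by (simp add: divide_inverse mult.commute)

lemma summable_hyp01:
  fixes a x :: real assumes "a \<ge> 1"
  shows "summable (\<lambda>j. x ^ j / (fact j * pochhammer a j))"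
  by (rule summable_comparison_test'[OF summable_power_fact[of "\<bar>x\<bar>"]])
     (rule norm_hyp01_term_le[OF assms])

lemma hyp01_sums:
  "a \<ge> 1 \<Longrightarrow> (\<lambda>j. x ^ j / (fact j * pochhammer a j)) sums hyp01 a x"
  unfolding hyp01_def by (intro summable_sums summable_hyp01)

lemma hyp01_0 [simp]: "hyp01 a 0 = 1"
proof -
  have "(\<lambda>j. 0 ^ j / (fact j * pochhammer a j)) sums (0 ^ 0 / (fact 0 * pochhammer a 0) :: real)"
    by (rule sums_finite[of "{0}", simplified]) auto
  then show ?thesis by (simp add: hyp01_def sums_iff)
qed

lemma has_field_derivative_hyp01:
  fixes a x :: real assumes a: "a \<ge> 1"
  shows "(hyp01 a has_field_derivative hyp01 (a + 1) x / a) (at x)"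
proof -
  define c where "c = (\<lambda>j. 1 / (fact j * pochhammer a j))"
  have "summable (\<lambda>j. c j * y ^ j)" for y :: real
    using summable_hyp01[OF a, of y] by (simp add: c_def)
  then have "DERIV (\<lambda>x. \<Sum>j. c j * x ^ j) x :> (\<Sum>j. diffs c j * x ^ j)"
    by (intro termdiffs_strong_converges_everywhere)
  also have "(\<lambda>x. \<Sum>j. c j * x ^ j) = hyp01 a" by (simp add: c_def hyp01_def fun_eq_iff)
  also have "(\<lambda>j. diffs c j * x ^ j) = (\<lambda>j. x ^ j / (fact j * pochhammer (a + 1) j) / a)"
  proof
    fix j
    have "diffs c j = 1 / (fact j * (a * pochhammer (a + 1) j))"
      unfolding diffs_def c_def pochhammer_rec fact_Suc by (simp add: divide_simps del: of_nat_Suc)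
    then show "diffs c j * x ^ j = x ^ j / (fact j * pochhammer (a + 1) j) / a"
      by (simp add: mult_ac)
  qed
  also have "(\<Sum>j. x ^ j / (fact j * pochhammer (a + 1) j) / a) = hyp01 (a + 1) x / a"
    using hyp01_sums[of "a + 1" x] a by (intro sums_unique[symmetric] sums_divide) auto
  finally show ?thesis .
qed

lemma continuous_on_hyp01: "a \<ge> 1 \<Longrightarrow> continuous_on A (hyp01 a)"
  by (meson DERIV_continuous continuous_at_imp_continuous_on has_field_derivative_hyp01)

lemma borel_measurable_hyp01 [measurable (raw)]:
  "a \<ge> 1 \<Longrightarrow> f \<in> borel_measurable M \<Longrightarrow> (\<lambda>x. hyp01 a (f x)) \<in> borel_measurable M"
  by (rule measurable_compose[OF _ borel_measurable_continuous_onI[OF continuous_on_hyp01]])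

text \<open>
  Bessel's equation \<open>x u'' + a u' = u\<close>, with the derivatives of \<open>u = hyp01 a\<close> expressed by
  \<open>has_field_derivative_hyp01\<close>.
\<close>
lemma hyp01_ode:
  fixes a x :: real assumes a: "a \<ge> 1"
  shows "x * hyp01 (a + 2) x / (a * (a + 1)) + hyp01 (a + 1) x = hyp01 a x"
proof -
  have p: "pochhammer a j > 0" for j using a by (intro pochhammer_pos) auto
  \<comment> \<open>the terms of \<open>x u''\<close> as a power series in \<open>x\<close>; the term for \<open>j = 0\<close> vanishes\<close>
  define f where "f = (\<lambda>j. real j * x ^ j / (fact j * pochhammer a (Suc j)))"
  have "(\<lambda>j. f (Suc j)) sums (x * hyp01 (a + 2) x / (a * (a + 1)))"
  proof -
    have "(\<lambda>j. x * (x ^ j / (fact j * pochhammer (a + 2) j)) / (a * (a + 1))) sums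
        (x * hyp01 (a + 2) x / (a * (a + 1)))"
      using a by (intro sums_divide sums_mult hyp01_sums) auto
    moreover have "x * (x ^ j / (fact j * pochhammer (a + 2) j)) / (a * (a + 1)) = f (Suc j)" for j
    proof -
      have "pochhammer a (Suc (Suc j)) = a * (a + 1) * pochhammer (a + 2) j"
        by (simp add: pochhammer_rec algebra_simps del: pochhammer_Suc)
      then show ?thesis unfolding f_def
        using p[of "Suc (Suc j)"] a by (simp add: divide_simps)
    qed
    ultimately show ?thesis by simp
  qed
  then have "f sums (x * hyp01 (a + 2) x / (a * (a + 1)))"
    by (subst (asm) sums_Suc_iff) (simp add: f_def)
  moreover have "(\<lambda>j. x ^ j / (fact j * pochhammer (a + 1) j)) sums hyp01 (a + 1) x"
    using a by (intro hyp01_sums) auto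
  ultimately have "(\<lambda>j. f j + x ^ j / (fact j * pochhammer (a + 1) j)) sums
      (x * hyp01 (a + 2) x / (a * (a + 1)) + hyp01 (a + 1) x)"
    by (rule sums_add)
  moreover have "f j + x ^ j / (fact j * pochhammer (a + 1) j) = x ^ j / (fact j * pochhammer a j)" for j
  proof -
    have 1: "pochhammer (a + 1) j = pochhammer a (Suc j) / a"
      using a by (simp add: pochhammer_rec)
    have "f j + x ^ j / (fact j * pochhammer (a + 1) j)
        = (real j + a) * x ^ j / (fact j * pochhammer a (Suc j))"
      unfolding f_def 1 by (simp add: add_divide_distrib algebra_simps)
    also have "\<dots> = x ^ j / (fact j * pochhammer a j)"
      using p[of j] a by (simp add: pochhammer_Suc add.commute)
    finally show ?thesis .
  qed
  ultimately show ?thesis using hyp01_sums[OF a, of x] by (simp add: sums_iff)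
qed

text \<open>
  An energy argument: \<open>u(x) = hyp01 a (- x)\<close> satisfies \<open>x u'' + a u' + u = 0\<close>, so the energy
  \<open>V = u\<^sup>2 + x u'\<^sup>2\<close> has derivative \<open>(1 - 2 a) u'\<^sup>2 \<le> 0\<close>, and \<open>u(x)\<^sup>2 \<le> V(x) \<le> V(0) = 1\<close>.
\<close>
lemma abs_hyp01_neg_le_1:
  fixes a x :: real assumes a: "a \<ge> 1" and x: "x \<ge> 0"
  shows "\<bar>hyp01 a (- x)\<bar> \<le> 1"
proof -
  define v where "v = (\<lambda>x. hyp01 (a + 1) (- x) / a)"
  define V where "V = (\<lambda>x. (hyp01 a (- x))\<^sup>2 + x * (v x)\<^sup>2)"
  have du: "((\<lambda>x. hyp01 a (- x)) has_real_derivative - v y) (at y)" for y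
    unfolding v_def
    unfolding v_def using DERIV_chain2[OF has_field_derivative_hyp01[OF a] DERIV_minus[OF DERIV_ident], of y] by simp
  have dv: "(v has_real_derivative - hyp01 (a + 2) (- y) / (a * (a + 1))) (at y)" for y
  proof -
    have "((\<lambda>x. hyp01 (a + 1) (- x)) has_real_derivative - hyp01 (a + 2) (- y) / (a + 1)) (at y)"
      using DERIV_chain2[OF has_field_derivative_hyp01 DERIV_minus[OF DERIV_ident], of "a + 1" y] a
      by (simp add: add.commute add.left_commute)
    from DERIV_cdivide[OF this, of a] show ?thesis
      unfolding v_def by (simp add: mult.commute)
  qed
  have dV: "(V has_real_derivative - ((2 * a - 1) * (v y)\<^sup>2)) (at y)" for y
  proof -
    define w where "w = hyp01 (a + 2) (- y) / (a * (a + 1))"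
    have ode: "y * w = a * v y - hyp01 a (- y)"
      using hyp01_ode[OF a, of "- y"] a unfolding w_def v_def by simp
    have "(V has_real_derivative 2 * hyp01 a (- y) * (- v y) + ((v y)\<^sup>2 + y * (2 * v y * (- w)))) (at y)"
      unfolding V_def w_def by (rule derivative_eq_intros du dv refl)+ simp
    also have "2 * hyp01 a (- y) * (- v y) + ((v y)\<^sup>2 + y * (2 * v y * (- w)))
        = - ((2 * a - 1) * (v y)\<^sup>2)"
      using ode by algebra
    finally show ?thesis .
  qed
  have "V x \<le> V 0"
    using x
  proof (rule DERIV_nonpos_imp_nonincreasing)
    fix y :: real
    show "\<exists>z. (V has_real_derivative z) (at y) \<and> z \<le> 0"
      using dV[of y] a by (intro exI conjI) auto
  qed
  also have "V 0 = 1" by (simp add: V_def)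
  finally have "(hyp01 a (- x))\<^sup>2 \<le> 1"
    using mult_nonneg_nonneg[OF x zero_le_power2[of "v x"]] unfolding V_def by linarith
  then show ?thesis by (simp add: abs_square_le_1)
qed

lemma hyp01_nonneg: "a \<ge> 1 \<Longrightarrow> x \<ge> 0 \<Longrightarrow> hyp01 a x \<ge> 0"
  unfolding hyp01_def using pochhammer_ge_1[of a]
  by (intro suminf_nonneg summable_hyp01 divide_nonneg_nonneg mult_nonneg_nonneg)
     (auto intro: order_trans[OF zero_le_one])

lemma sum_squares_le_square_sum:
  fixes f :: "nat \<Rightarrow> real" assumes "\<And>j. f j \<ge> 0"
  shows "(\<Sum>j<n. (f j)\<^sup>2) \<le> (\<Sum>j<n. f j)\<^sup>2"
proof (induction n)
  case (Suc n)
  have "0 \<le> 2 * (\<Sum>j<n. f j) * f n" using assms by (intro mult_nonneg_nonneg sum_nonneg) auto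
  then show ?case using Suc by (simp add: power2_sum mult.commute mult.left_commute)
qed simp

text \<open>
  As the Pochhammer symbol is at least \<open>j!\<close>, the series is at most \<open>\<Sum>(y\<^sup>j/j!)\<^sup>2\<close>, hence at most the
  square of the exponential series. The bound combines with the factor \<open>exp (- \<pi> s (x + t))\<close> of the
  heat kernel to a Gaussian in \<open>sqrt x - sqrt t\<close>.
\<close>
lemma hyp01_le_exp:
  fixes a y :: real assumes a: "a \<ge> 1" and y: "y \<ge> 0"
  shows "hyp01 a (y\<^sup>2) \<le> exp (2 * y)"
  unfolding hyp01_def
proof (rule suminf_le_const[OF summable_hyp01[OF a]])
  fix n
  have "(\<Sum>j<n. (y\<^sup>2) ^ j / (fact j * pochhammer a j)) \<le> (\<Sum>j<n. (y ^ j / fact j)\<^sup>2)"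
  proof (rule sum_mono)
    fix j
    have "(y\<^sup>2) ^ j / (fact j * pochhammer a j) \<le> (y\<^sup>2) ^ j / (fact j * fact j)"
      using pochhammer_ge_fact[OF a, of j] pochhammer_ge_1[OF a, of j]
      by (intro divide_left_mono mult_left_mono mult_pos_pos) auto
    then show "(y\<^sup>2) ^ j / (fact j * pochhammer a j) \<le> (y ^ j / fact j)\<^sup>2"
      by (simp add: power_divide power2_eq_square power_mult_distrib)
  qed
  also have "\<dots> \<le> (\<Sum>j<n. y ^ j / fact j)\<^sup>2"
    using y by (intro sum_squares_le_square_sum) auto
  also have "\<dots> \<le> (exp y)\<^sup>2"
  proof (rule power_mono)
    have "(\<Sum>j<n. y ^ j / fact j) \<le> (\<Sum>j. y ^ j / fact j)"
      using y by (intro sum_le_suminf summable_power_fact) auto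
    then show "(\<Sum>j<n. y ^ j / fact j) \<le> exp y"
      by (simp add: exp_def divide_inverse mult.commute)
  qed (use y in \<open>auto intro: sum_nonneg\<close>)
  also have "\<dots> = exp (2 * y)" by (simp add: exp_double)
  finally show "(\<Sum>j<n. (y\<^sup>2) ^ j / (fact j * pochhammer a j)) \<le> exp (2 * y)" .
qed

lemma gamma_integral_hline:
  fixes z q :: real assumes z: "z > 0" and q: "q > 0"
  shows "has_bochner_integral hline (\<lambda>t. t powr (z - 1) * exp (- (q * t))) (Gamma z * q powr (- z))"
proof -
  define f where "f = (\<lambda>t::real. t powr (z - 1) / exp t)"
  have [measurable]: "f \<in> borel_measurable borel" unfolding f_def by measurable
  have "(\<lambda>t. indicator {0..} t * f t) = (\<lambda>t. if t \<in> {0..} then f t else 0)"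
    by auto
  then have "((\<lambda>t. indicator {0..} t * f t) has_integral Gamma z) UNIV"
    using Gamma_integral_real[OF z] has_integral_restrict_UNIV[of "{0..}" f] by (simp add: f_def)
  then have "(\<integral>\<^sup>+ t. ennreal (indicator {0..} t * f t) \<partial>lborel) = ennreal (Gamma z)"
    by (intro nn_integral_has_integral_lborel) (auto simp: f_def)
  then have "has_bochner_integral lborel (\<lambda>t. indicator {0..} t * f t) (Gamma z)"
    using Gamma_real_pos[OF z] by (intro has_bochner_integral_nn_integral) (auto simp: f_def)
  then have 1: "has_bochner_integral lborel (\<lambda>t. indicator {0..} (0 + q * t) * f (0 + q * t)) (Gamma z /\<^sub>R \<bar>q\<bar>)"
    using q by (subst lborel_has_bochner_integral_real_affine_iff[symmetric]) auto
  have "has_bochner_integral lborel (\<lambda>t. (indicator {0..} (0 + q * t) * f (0 + q * t)) * q powr (1 - z))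
      ((Gamma z /\<^sub>R \<bar>q\<bar>) * q powr (1 - z))"
    by (intro has_bochner_integral_mult_left 1)
  also have "(Gamma z /\<^sub>R \<bar>q\<bar>) * q powr (1 - z) = Gamma z * q powr (- z)"
    using q by (simp add: divide_inverse[symmetric] powr_diff powr_minus field_simps)
  also have "has_bochner_integral lborel (\<lambda>t. (indicator {0..} (0 + q * t) * f (0 + q * t)) * q powr (1 - z))
       (Gamma z * q powr (- z)) \<longleftrightarrow>
     has_bochner_integral lborel (\<lambda>t. indicator {0<..} t *\<^sub>R (t powr (z - 1) * exp (- (q * t)))) (Gamma z * q powr (- z))"
  proof (rule has_bochner_integral_cong_AE)
    have "AE t in lborel. t \<noteq> (0::real)" by (rule AE_lborel_singleton)
    then show "AE t in lborel. (indicator {0..} (0 + q * t) * f (0 + q * t)) * q powr (1 - z)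
      = indicator {0<..} t *\<^sub>R (t powr (z - 1) * exp (- (q * t)))"
    proof eventually_elim
      case (elim t)
      have "q powr (z - 1) * q powr (1 - z) = 1" using q by (simp flip: powr_add)
      moreover have "(0 \<le> q * t) = (0 < t)" using elim q by (auto simp: zero_le_mult_iff)
      ultimately show ?case using q
        by (simp add: f_def indicator_def powr_mult exp_minus divide_inverse)
    qed
  qed auto
  finally have *: "has_bochner_integral lborel (\<lambda>t. indicator {0<..} t *\<^sub>R (t powr (z - 1) * exp (- (q * t))))
      (Gamma z * q powr (- z))" .
  have m: "(\<lambda>t. t powr (z - 1) * exp (- (q * t))) \<in> borel_measurable borel" by measurable
  show ?thesis
    using * unfolding has_bochner_integral_iff integrable_hline[OF m] integral_hline[OF m]
      set_integrable_def set_lebesgue_integral_def .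
qed

text \<open>
  Termwise integration: the moment \<open>\<Gamma>(a + j)\<close> cancels the Pochhammer symbol in the \<open>j\<close>-th term, which
  leaves the exponential series. For negative \<open>z\<close> and \<open>a = k/2\<close> this computes the Fourier
  transform of a Gaussian on \<open>k\<close>-space.
\<close>
lemma laplace_hyp01:
  fixes a q z :: real assumes a: "a \<ge> 1" and q: "q > 0"
  shows "has_bochner_integral hline (\<lambda>t. t powr (a - 1) * exp (- (q * t)) * hyp01 a (z * t))
     (Gamma a * q powr (- a) * exp (z / q))"
proof -
  define f where "f = (\<lambda>j t. t powr (a - 1) * exp (- (q * t)) * ((z * t) ^ j / (fact j * pochhammer a j)))"
  have p: "pochhammer a j > 0" for j using a by (intro pochhammer_pos) auto
  have Gz: "Gamma (a + real j) = pochhammer a j * Gamma a" for j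
    using a by (subst pochhammer_Gamma) (auto simp: Gamma_eq_zero_iff dest: nonpos_Ints_nonpos)
  have 1: "has_bochner_integral hline (\<lambda>t. y ^ j / (fact j * pochhammer a j) * (t powr (a + real j - 1) * exp (- (q * t))))
      (Gamma a * q powr (- a) * ((y / q) ^ j / fact j))" for j y
  proof -
    have "has_bochner_integral hline (\<lambda>t. y ^ j / (fact j * pochhammer a j) * (t powr (a + real j - 1) * exp (- (q * t))))
      (y ^ j / (fact j * pochhammer a j) * (Gamma (a + real j) * q powr (- (a + real j))))"
      using a q by (intro has_bochner_integral_mult_right gamma_integral_hline) auto
    also have "y ^ j / (fact j * pochhammer a j) * (Gamma (a + real j) * q powr (- (a + real j)))
       = Gamma a * q powr (- a) * ((y / q) ^ j / fact j)"
      using p[of j] q by (simp add: Gz powr_diff powr_realpow power_divide field_simps)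
    finally show ?thesis .
  qed
  have cong: "AE t in hline. t powr (a - 1) * exp (- (q * t)) * ((y * t) ^ j / (fact j * pochhammer a j))
     = y ^ j / (fact j * pochhammer a j) * (t powr (a + real j - 1) * exp (- (q * t)))" for j y
    using AE_hline_pos
  proof eventually_elim
    case (elim t)
    have "t powr (a + real j - 1) = t powr (a - 1) * t ^ j"
      using elim by (simp add: powr_add powr_diff powr_realpow)
    then show ?case by (simp add: power_mult_distrib)
  qed
  have 2: "has_bochner_integral hline (\<lambda>t. t powr (a - 1) * exp (- (q * t)) * ((y * t) ^ j / (fact j * pochhammer a j)))
      (Gamma a * q powr (- a) * ((y / q) ^ j / fact j))" for j y
    by (subst has_bochner_integral_cong_AE[OF _ _ cong]) (use 1 in auto)
  have norm_f: "AE t in hline. norm (f j t) = t powr (a - 1) * exp (- (q * t)) * ((\<bar>z\<bar> * t) ^ j / (fact j * pochhammer a j))" for j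
    using AE_hline_pos
    by eventually_elim (use p[of j] in \<open>simp add: f_def abs_mult power_abs\<close>)
  have 3: "(\<integral>t. norm (f j t) \<partial>hline) = Gamma a * q powr (- a) * ((\<bar>z\<bar> / q) ^ j / fact j)" for j
    using has_bochner_integral_integral_eq[OF 2[of "\<bar>z\<bar>" j]]
    by (subst integral_cong_AE[OF _ _ norm_f]) (auto simp: f_def)
  have int: "integrable hline (f j)" for j
    using 2[of z j] unfolding f_def by (rule has_bochner_integral_iff[THEN iffD1, THEN conjunct1])
  have s1: "AE t in hline. summable (\<lambda>j. norm (f j t))"
  proof (rule AE_I2)
    fix t
    have "summable (\<lambda>j. norm ((z * t) ^ j / (fact j * pochhammer a j)))"
      by (rule summable_comparison_test'[OF summable_power_fact[of "\<bar>z * t\<bar>"]])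
         (use norm_hyp01_term_le[OF a, of "z * t"] in \<open>simp add: abs_mult\<close>)
    then show "summable (\<lambda>j. norm (f j t))"
      unfolding f_def norm_mult by (intro summable_mult)
  qed
  have s2: "summable (\<lambda>j. \<integral>t. norm (f j t) \<partial>hline)"
    unfolding 3 by (intro summable_mult summable_power_fact)
  have sum_f: "(\<Sum>j. f j t) = t powr (a - 1) * exp (- (q * t)) * hyp01 a (z * t)" for t
    unfolding f_def using hyp01_sums[OF a] by (intro sums_unique[symmetric] sums_mult)
  have "(\<lambda>j. integral\<^sup>L hline (f j)) sums (\<integral>t. (\<Sum>j. f j t) \<partial>hline)"
    by (rule sums_integral[OF int s1 s2])
  moreover have "integral\<^sup>L hline (f j) = Gamma a * q powr (- a) * ((z / q) ^ j / fact j)" for j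
    using has_bochner_integral_integral_eq[OF 2[of z j]] by (simp add: f_def)
  moreover have "(\<lambda>j. Gamma a * q powr (- a) * ((z / q) ^ j / fact j)) sums (Gamma a * q powr (- a) * exp (z / q))"
    using exp_converges[of "z / q"] by (intro sums_mult) (simp add: divide_inverse mult.commute)
  ultimately have "(\<integral>t. (\<Sum>j. f j t) \<partial>hline) = Gamma a * q powr (- a) * exp (z / q)"
    by (simp add: sums_iff)
  then show ?thesis
    using integrable_suminf[OF int s1 s2] by (simp add: has_bochner_integral_iff sum_f)
qed

section \<open>The theta function\<close>

lemma sinh_product_formula:
  fixes x :: real assumes x: "x \<noteq> 0"
  shows "(\<lambda>n. \<Prod>k<n. 1 + x\<^sup>2 / (real (Suc k))\<^sup>2) \<longlonglongrightarrow> sinh (pi * x) / (pi * x)"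
proof -
  have "(\<lambda>n. of_real pi * (\<i> * of_real x) * (\<Prod>k=1..n. 1 - (\<i> * of_real x)^2 / of_nat k^2))
      \<longlonglongrightarrow> sin (of_real pi * (\<i> * complex_of_real x))"
    by (rule sin_product_formula_complex)
  also have "(\<lambda>n. of_real pi * (\<i> * of_real x) * (\<Prod>k=1..n. 1 - (\<i> * of_real x)^2 / of_nat k^2))
     = (\<lambda>n. \<i> * complex_of_real (pi * x * (\<Prod>k<n. 1 + x\<^sup>2 / (real (Suc k))\<^sup>2)))"
  proof
    fix n
    have "(\<Prod>k=1..n. 1 - (\<i> * of_real x)^2 / of_nat k^2)
        = (\<Prod>k<n. complex_of_real (1 + x\<^sup>2 / (real (Suc k))\<^sup>2))"
      unfolding One_nat_def atLeast1_atMost_eq_remove0[symmetric] prod.atLeast1_atMost_eq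
      by (simp add: power_mult_distrib del: of_nat_Suc)
    then show "of_real pi * (\<i> * of_real x) * (\<Prod>k=1..n. 1 - (\<i> * of_real x)^2 / of_nat k^2)
       = \<i> * complex_of_real (pi * x * (\<Prod>k<n. 1 + x\<^sup>2 / (real (Suc k))\<^sup>2))"
      by simp
  qed
  also have "sin (of_real pi * (\<i> * complex_of_real x)) = \<i> * complex_of_real (sinh (pi * x))"
  proof -
    have "sin (of_real pi * (\<i> * complex_of_real x)) = sin (\<i> * complex_of_real (pi * x))"
      by (simp add: mult_ac)
    also have "\<dots> = \<i> * sinh (complex_of_real (pi * x))"
      by (simp add: sinh_conv_sin)
    also have "sinh (complex_of_real y) = complex_of_real (sinh y)" for y
      unfolding sinh_def by (simp add: exp_of_real scaleR_conv_of_real flip: of_real_minus)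
    finally show ?thesis .
  qed
  finally have "(\<lambda>n. Im (\<i> * complex_of_real (pi * x * (\<Prod>k<n. 1 + x\<^sup>2 / (real (Suc k))\<^sup>2))))
      \<longlonglongrightarrow> Im (\<i> * complex_of_real (sinh (pi * x)))"
    by (rule tendsto_Im)
  then have "(\<lambda>n. pi * x * (\<Prod>k<n. 1 + x\<^sup>2 / (real (Suc k))\<^sup>2)) \<longlonglongrightarrow> sinh (pi * x)"
    by (simp only: Im_i_times Re_complex_of_real)
  then have "(\<lambda>n. pi * x * (\<Prod>k<n. 1 + x\<^sup>2 / (real (Suc k))\<^sup>2) / (pi * x)) \<longlonglongrightarrow> sinh (pi * x) / (pi * x)"
    using x by (intro tendsto_divide) auto
  then show ?thesis using x by simp
qed

text \<open>
  The logarithmic derivative of the product formula for \<open>sinh\<close>, which is Euler's product for the sine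
  on the imaginary axis.
\<close>
lemma coth_partial_fractions:
  fixes x :: real assumes x: "x > 0"
  shows "(\<lambda>n. 2 * x / ((real (Suc n))\<^sup>2 + x\<^sup>2)) sums (pi * cosh (pi * x) / sinh (pi * x) - 1 / x)"
proof -
  define S where "S = {0<..<x + 1}"
  define f where "f = (\<lambda>n y. ln (1 + y\<^sup>2 / (real (Suc n))\<^sup>2) :: real)"
  define f' where "f' = (\<lambda>n y. 2 * y / ((real (Suc n))\<^sup>2 + y\<^sup>2) :: real)"
  have xS: "x \<in> S" using x by (simp add: S_def)
  have pos: "1 + y\<^sup>2 / (real (Suc n))\<^sup>2 > 0" for n and y :: real
    by (rule add_pos_nonneg) auto
  have f_sums: "(\<lambda>n. f n y) sums ln (sinh (pi * y) / (pi * y))" if "y > 0" for y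
  proof -
    have "(\<lambda>n. ln (\<Prod>k<n. 1 + y\<^sup>2 / (real (Suc k))\<^sup>2)) \<longlonglongrightarrow> ln (sinh (pi * y) / (pi * y))"
      using that by (intro tendsto_ln sinh_product_formula) (auto simp: sinh_real_zero_iff)
    also have "(\<lambda>n. ln (\<Prod>k<n. 1 + y\<^sup>2 / (real (Suc k))\<^sup>2)) = (\<lambda>n. \<Sum>k<n. f k y)"
      unfolding f_def by (intro ext ln_prod less_imp_neq[OF pos, symmetric]) auto
    finally show ?thesis by (simp add: sums_def)
  qed
  have sq: "summable (\<lambda>n. 1 / (real (Suc n))\<^sup>2)"
    using inverse_squares_sums by (simp add: sums_iff add.commute)
  have unif: "uniformly_convergent_on S (\<lambda>n y. \<Sum>i<n. f' i y)"
  proof (rule Weierstrass_m_test'_ev)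
    show "\<forall>\<^sub>F n in sequentially. \<forall>y\<in>S. norm (f' n y) \<le> 2 * (x + 1) * (1 / (real (Suc n))\<^sup>2)"
    proof (intro always_eventually allI ballI)
      fix n y assume "y \<in> S"
      then have y: "0 < y" "y < x + 1" by (auto simp: S_def)
      have "2 * y / ((real (Suc n))\<^sup>2 + y\<^sup>2) \<le> 2 * (x + 1) / (real (Suc n))\<^sup>2"
        using y by (intro frac_le) auto
      then show "norm (f' n y) \<le> 2 * (x + 1) * (1 / (real (Suc n))\<^sup>2)"
        using y by (simp add: f'_def)
    qed
    show "summable (\<lambda>n. 2 * (x + 1) * (1 / (real (Suc n))\<^sup>2))"
      by (intro summable_mult sq)
  qed
  have der: "(f n has_field_derivative f' n y) (at y within S)" if "y \<in> S" for n y
  proof -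
    define D where "D = (real (Suc n))\<^sup>2"
    have D: "D > 0" by (simp add: D_def del: of_nat_Suc)
    have p: "1 + y\<^sup>2 / D > 0" using pos[of y n] by (simp add: D_def)
    have "(f n has_field_derivative (2 * y / D) / (1 + y\<^sup>2 / D)) (at y within S)"
      unfolding f_def D_def[symmetric] using p D by (auto intro!: derivative_eq_intros)
    also have "(2 * y / D) / (1 + y\<^sup>2 / D) = f' n y"
      unfolding f'_def D_def[symmetric] using D by (simp add: divide_simps)
    finally show ?thesis .
  qed
  have summ: "summable (\<lambda>n. f n x)" using f_sums[OF x] by (simp add: sums_iff)
  have "((\<lambda>y. \<Sum>n. f n y) has_field_derivative (\<Sum>n. f' n x)) (at x)"
    by (rule has_field_derivative_series'(2)[OF _ der unif xS summ])
       (auto simp: S_def x)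
  moreover have "((\<lambda>y. \<Sum>n. f n y) has_field_derivative (\<Sum>n. f' n x)) (at x) \<longleftrightarrow>
     ((\<lambda>y. ln (sinh (pi * y)) - ln (pi * y)) has_field_derivative (\<Sum>n. f' n x)) (at x)"
  proof (rule DERIV_cong_ev)
    have "eventually (\<lambda>y. y > 0) (nhds x)"
      using x by (intro eventually_nhds_in_open[of "{0<..}", simplified]) auto
    then show "\<forall>\<^sub>F y in nhds x. (\<Sum>n. f n y) = ln (sinh (pi * y)) - ln (pi * y)"
    proof eventually_elim
      case (elim y)
      then have "sinh (pi * y) > 0" by simp
      then show ?case using f_sums[OF elim] elim by (simp add: sums_iff ln_div)
    qed
  qed auto
  moreover have "((\<lambda>y. ln (sinh (pi * y)) - ln (pi * y)) has_field_derivative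
     (pi * cosh (pi * x) / sinh (pi * x) - 1 / x)) (at x)"
    using x by (auto intro!: derivative_eq_intros)
  ultimately have "(\<Sum>n. f' n x) = pi * cosh (pi * x) / sinh (pi * x) - 1 / x"
    using DERIV_unique by blast
  moreover have "summable (\<lambda>n. f' n x)"
  proof (rule summable_comparison_test'[OF summable_mult[OF sq, of "2 * x"]])
    fix n
    have "2 * x / ((real (Suc n))\<^sup>2 + x\<^sup>2) \<le> 2 * x / (real (Suc n))\<^sup>2"
      using x by (intro frac_le) auto
    then show "norm (f' n x) \<le> 2 * x * (1 / (real (Suc n))\<^sup>2)" using x by (simp add: f'_def)
  qed
  ultimately show ?thesis by (simp add: f'_def sums_iff)
qed

lemma coth_geometric:
  fixes x :: real assumes x: "x > 0"
  shows "(\<lambda>n. 2 * exp (- (2 * real (Suc n) * x))) sums (cosh x / sinh x - 1)"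
proof -
  define r where "r = exp (- (2 * x))"
  have r: "0 < r" "r < 1" using x by (auto simp: r_def)
  have "(\<lambda>n. r ^ n) sums (1 / (1 - r))" using r by (intro geometric_sums) auto
  then have "(\<lambda>n. (2 * r) * r ^ n) sums ((2 * r) * (1 / (1 - r)))" by (rule sums_mult)
  moreover have "(2 * r) * r ^ n = 2 * exp (- (2 * real (Suc n) * x))" for n
    unfolding r_def by (simp flip: exp_of_nat_mult exp_add add: algebra_simps)
  moreover have "(2 * r) * (1 / (1 - r)) = cosh x / sinh x - 1"
  proof -
    have e: "r = exp (- x) / exp x" by (simp add: r_def flip: exp_diff)
    have "exp (- x) < exp x" using x by simp
    then show ?thesis unfolding e cosh_def sinh_def by (simp add: field_simps)
  qed
  ultimately show ?thesis by simp
qed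


text \<open>
  The primitive is the distribution function of the centred normal law of variance \<open>1/(2\<pi>)\<close>.
\<close>
lemma gauss_primitive:
  obtains \<Phi> :: "real \<Rightarrow> real" where
    "\<And>x. (\<Phi> has_real_derivative exp (- (pi * x\<^sup>2))) (at x)"
    "(\<Phi> \<longlongrightarrow> 0) at_bot" "(\<Phi> \<longlongrightarrow> 1) at_top"
proof -
  define \<sigma> :: real where "\<sigma> = 1 / sqrt (2 * pi)"
  have \<sigma>: "\<sigma> > 0" by (simp add: \<sigma>_def)
  define f where "f = normal_density 0 \<sigma>"
  have f: "f x = exp (- (pi * x\<^sup>2))" for x
    by (simp add: f_def normal_density_def \<sigma>_def power_divide real_sqrt_divide)
  define M where "M = density lborel f"
  interpret prob_space M unfolding M_def f_def using \<sigma> by (rule prob_space_normal_density)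
  interpret M: real_distribution M
    by unfold_locales (auto simp: M_def)
  have cont: "continuous_on A f" for A unfolding f[abs_def] by (intro continuous_intros)
  have diff: "cdf M y - cdf M a = integral {a..y} f" if "a < y" for a y
  proof -
    have si: "set_integrable lborel {a..y} f"
      by (intro borel_integrable_atLeastAtMost' cont)
    have "cdf M y - cdf M a = measure M {a<..y}" using that by (simp add: M.cdf_diff_eq)
    also have "\<dots> = enn2real (\<integral>\<^sup>+x. ennreal (f x) * indicator {a<..y} x \<partial>lborel)"
      unfolding measure_def M_def by (subst emeasure_density) (auto simp: f_def)
    also have "(\<integral>\<^sup>+x. ennreal (f x) * indicator {a<..y} x \<partial>lborel) =
       (\<integral>\<^sup>+x. ennreal (indicator {a..y} x *\<^sub>R f x) \<partial>lborel)"
      by (intro nn_integral_cong_AE, use AE_lborel_singleton[of a] in eventually_elim)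
         (auto simp: indicator_def)
    also have "\<dots> = ennreal (LBINT x:{a..y}. f x)"
      unfolding set_lebesgue_integral_def using si
      by (intro nn_integral_eq_integral) (auto simp: set_integrable_def f)
    also have "enn2real \<dots> = (LBINT x:{a..y}. f x)"
      unfolding set_lebesgue_integral_def by (intro enn2real_ennreal integral_nonneg_AE) (auto simp: f)
    also have "\<dots> = integral {a..y} f" by (rule set_borel_integral_eq_integral(2)[OF si])
    finally show ?thesis .
  qed
  show thesis
  proof (rule that[of "cdf M"])
    fix x :: real
    have "((\<lambda>u. integral {x - 1..u} f) has_vector_derivative f x) (at x within {x - 1..x + 1})"
      by (intro integral_has_vector_derivative cont) auto
    then have "((\<lambda>u. integral {x - 1..u} f) has_real_derivative f x) (at x)"
      by (simp add: at_within_Icc_at has_real_derivative_iff_has_vector_derivative)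
    then have "((\<lambda>u. integral {x - 1..u} f + cdf M (x - 1)) has_real_derivative f x) (at x)"
      by (auto intro!: derivative_eq_intros)
    moreover have "((\<lambda>u. integral {x - 1..u} f + cdf M (x - 1)) has_real_derivative f x) (at x)
       \<longleftrightarrow> (cdf M has_real_derivative f x) (at x)"
    proof (rule DERIV_cong_ev)
      have "eventually (\<lambda>u. u \<in> {x - 1<..}) (nhds x)"
        by (intro eventually_nhds_in_open) auto
      then show "\<forall>\<^sub>F u in nhds x. integral {x - 1..u} f + cdf M (x - 1) = cdf M u"
        by eventually_elim (simp flip: diff)
    qed auto
    ultimately show "(cdf M has_real_derivative exp (- (pi * x\<^sup>2))) (at x)"
      by (simp add: f)
  qed (fact M.cdf_lim_at_bot M.cdf_lim_at_top_prob)+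
qed

text \<open>
  The integrand has an explicit primitive. With \<open>a = sqrt p\<close> and \<open>\<Phi>\<close> from \<open>gauss_primitive\<close>, both
  squares \<open>(a sqrt w \<mp> b/sqrt w)\<^sup>2\<close> equal \<open>p w + b\<^sup>2/w\<close> up to the constants \<open>\<mp> 2 a b\<close>. So the
  derivatives of the two summands of \<open>H\<close> contain the same exponential, and the parts of their inner
  derivatives that come from \<open>b/sqrt w\<close> cancel.
\<close>
lemma laplace_gauss_inverse:
  fixes b p :: real assumes b: "b > 0" and p: "p > 0"
  shows "has_bochner_integral hline (\<lambda>w. w powr (-1/2) * exp (- (pi * b\<^sup>2 / w)) * exp (- (pi * p * w)))
     (exp (- (2 * pi * b * sqrt p)) / sqrt p)"
proof -
  obtain \<Phi> where \<Phi>: "\<And>x. (\<Phi> has_real_derivative exp (- (pi * x\<^sup>2))) (at x)"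
    and bot: "(\<Phi> \<longlongrightarrow> 0) at_bot" and top: "(\<Phi> \<longlongrightarrow> 1) at_top"
    using gauss_primitive by metis
  define a where "a = sqrt p"
  have a: "a > 0" "a\<^sup>2 = p" using p by (auto simp: a_def)
  define f where "f = (\<lambda>w. w powr (-1/2) * exp (- (pi * b\<^sup>2 / w)) * exp (- (pi * p * w)))"
  define H where "H = (\<lambda>w. (exp (- (2 * pi * a * b)) * \<Phi> (a * sqrt w - b / sqrt w)
      + exp (2 * pi * a * b) * \<Phi> (a * sqrt w + b / sqrt w)) / a)"
  have fm [measurable]: "f \<in> borel_measurable borel" unfolding f_def by measurable
  have dH: "(H has_real_derivative f w) (at w)" if w: "w > 0" for w
  proof -
    define u where "u = sqrt w"
    have u: "u > 0" "w = u\<^sup>2" using w by (auto simp: u_def)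
    have d1: "((\<lambda>w. a * sqrt w - b / sqrt w) has_real_derivative (a / (2 * u) + b / (2 * u ^ 3))) (at w)"
      using w u(1) by (auto intro!: derivative_eq_intros simp: u_def[symmetric] field_simps power3_eq_cube)
    have d2: "((\<lambda>w. a * sqrt w + b / sqrt w) has_real_derivative (a / (2 * u) - b / (2 * u ^ 3))) (at w)"
      using w u(1) by (auto intro!: derivative_eq_intros simp: u_def[symmetric] field_simps power3_eq_cube)
    \<comment> \<open>the exponential common to both summands\<close>
    define E where "E = exp (- (pi * b\<^sup>2 / w)) * exp (- (pi * p * w))"
    have E1: "exp (- (2 * pi * a * b)) * exp (- (pi * (a * u - b / u)\<^sup>2)) = E"
    proof -
      have "- (2 * pi * a * b) + - (pi * (a * u - b / u)\<^sup>2) = - (pi * b\<^sup>2 / w) + - (pi * p * w)"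
        using u(1) unfolding u(2) a(2)[symmetric] by (simp add: field_simps power2_eq_square)
      then show ?thesis unfolding E_def by (simp only: exp_add[symmetric])
    qed
    have E2: "exp (2 * pi * a * b) * exp (- (pi * (a * u + b / u)\<^sup>2)) = E"
    proof -
      have "(2 * pi * a * b) + - (pi * (a * u + b / u)\<^sup>2) = - (pi * b\<^sup>2 / w) + - (pi * p * w)"
        using u(1) unfolding u(2) a(2)[symmetric] by (simp add: field_simps power2_eq_square)
      then show ?thesis unfolding E_def by (simp only: exp_add[symmetric])
    qed
    have "(H has_real_derivative
       (exp (- (2 * pi * a * b)) * (exp (- (pi * (a * u - b / u)\<^sup>2)) * (a / (2 * u) + b / (2 * u ^ 3)))
      + exp (2 * pi * a * b) * (exp (- (pi * (a * u + b / u)\<^sup>2)) * (a / (2 * u) - b / (2 * u ^ 3)))) / a) (at w)"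
      unfolding H_def u_def
      by (intro DERIV_cdivide DERIV_add DERIV_cmult DERIV_chain2[OF \<Phi>] d1[unfolded u_def] d2[unfolded u_def])
    also have "(exp (- (2 * pi * a * b)) * (exp (- (pi * (a * u - b / u)\<^sup>2)) * (a / (2 * u) + b / (2 * u ^ 3)))
      + exp (2 * pi * a * b) * (exp (- (pi * (a * u + b / u)\<^sup>2)) * (a / (2 * u) - b / (2 * u ^ 3)))) / a
      = E / u"
      unfolding mult.assoc[symmetric] E1 E2 using a(1) u(1) by (simp add: field_simps)
    also have "E / u = f w"
      unfolding E_def f_def u_def using w by (simp add: powr_minus powr_half_sqrt field_simps)
    finally show ?thesis .
  qed
  have lim0: "(H \<longlongrightarrow> exp (2 * pi * a * b) / a) (at_right 0)"
  proof -
    have "filterlim (\<lambda>w. a * sqrt w - b / sqrt w) at_bot (at_right 0)" using a b by real_asymp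
    then have 1: "((\<lambda>w. \<Phi> (a * sqrt w - b / sqrt w)) \<longlongrightarrow> 0) (at_right 0)"
      by (rule filterlim_compose[OF bot])
    have "filterlim (\<lambda>w. a * sqrt w + b / sqrt w) at_top (at_right 0)" using a b by real_asymp
    then have 2: "((\<lambda>w. \<Phi> (a * sqrt w + b / sqrt w)) \<longlongrightarrow> 1) (at_right 0)"
      by (rule filterlim_compose[OF top])
    show ?thesis unfolding H_def
      by (rule tendsto_eq_intros 1 2 refl)+ (use a in auto)
  qed
  have lim1: "(H \<longlongrightarrow> (exp (- (2 * pi * a * b)) + exp (2 * pi * a * b)) / a) at_top"
  proof -
    have "filterlim (\<lambda>w. a * sqrt w - b / sqrt w) at_top at_top" using a b by real_asymp
    then have 1: "((\<lambda>w. \<Phi> (a * sqrt w - b / sqrt w)) \<longlongrightarrow> 1) at_top"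
      by (rule filterlim_compose[OF top])
    have "filterlim (\<lambda>w. a * sqrt w + b / sqrt w) at_top at_top" using a b by real_asymp
    then have 2: "((\<lambda>w. \<Phi> (a * sqrt w + b / sqrt w)) \<longlongrightarrow> 1) at_top"
      by (rule filterlim_compose[OF top])
    show ?thesis unfolding H_def
      by (rule tendsto_eq_intros 1 2 refl)+ (use a in auto)
  qed
  have ei: "einterval 0 \<infinity> = {0<..}" by (auto simp: einterval_def)
  have 1: "set_integrable lborel (einterval 0 \<infinity>) f"
    and 2: "(LBINT x=0..\<infinity>. f x) = (exp (- (2 * pi * a * b)) + exp (2 * pi * a * b)) / a - exp (2 * pi * a * b) / a"
  proof -
    have c: "isCont f x" if "x > 0" for x
      unfolding f_def using that by (intro continuous_intros) auto
    have A: "((H \<circ> real_of_ereal) \<longlongrightarrow> exp (2 * pi * a * b) / a) (at_right 0)"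
      using lim0 by (simp add: zero_ereal_def ereal_tendsto_simps)
    have B: "((H \<circ> real_of_ereal) \<longlongrightarrow> (exp (- (2 * pi * a * b)) + exp (2 * pi * a * b)) / a) (at_left \<infinity>)"
      using lim1 by (simp add: ereal_tendsto_simps)
    have n: "AE x in lborel. 0 < ereal x \<longrightarrow> ereal x < \<infinity> \<longrightarrow> 0 \<le> f x"
      by (auto simp: f_def)
    show "set_integrable lborel (einterval 0 \<infinity>) f"
      by (rule interval_integral_FTC_nonneg(1)[OF _ _ _ n A B]) (use dH c in auto)
    show "(LBINT x=0..\<infinity>. f x) = (exp (- (2 * pi * a * b)) + exp (2 * pi * a * b)) / a - exp (2 * pi * a * b) / a"
      by (rule interval_integral_FTC_nonneg(2)[OF _ _ _ n A B]) (use dH c in auto)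
  qed
  have "(LBINT x:{0<..}. f x) = exp (- (2 * pi * a * b)) / a"
    using 2 by (simp add: interval_lebesgue_integral_def ei add_divide_distrib)
  then have "has_bochner_integral hline f (exp (- (2 * pi * a * b)) / a)"
    unfolding has_bochner_integral_iff integrable_hline[OF fm] integral_hline[OF fm]
    using 1 by (simp add: ei)
  then show ?thesis by (simp add: f_def a_def mult_ac)
qed

text \<open>
  The sum of \<open>exp (- \<pi> n\<^sup>2 w)\<close> over all integers \<open>n\<close>, with the terms of \<open>n\<close> and \<open>-n\<close> combined.
\<close>
definition theta_real :: "real \<Rightarrow> real" where
  "theta_real w = 1 + (\<Sum>n. 2 * exp (- (pi * (real (Suc n))\<^sup>2 * w)))"

lemma theta_term_le:
  assumes "w \<ge> d" "d > 0"
  shows "exp (- (pi * (real (Suc n))\<^sup>2 * w)) \<le> exp (- (pi * d)) ^ n"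
proof -
  have "real n * d \<le> (real (Suc n))\<^sup>2 * w"
    using assms by (intro mult_mono) (auto simp: power2_eq_square algebra_simps)
  then have "pi * (real n * d) \<le> pi * ((real (Suc n))\<^sup>2 * w)" by (intro mult_left_mono) auto
  then have "exp (- (pi * (real (Suc n))\<^sup>2 * w)) \<le> exp (real n * - (pi * d))"
    by (simp add: mult_ac)
  then show ?thesis by (simp only: exp_of_nat_mult)
qed

lemma summable_theta: "w > 0 \<Longrightarrow> summable (\<lambda>n. exp (- (pi * (real (Suc n))\<^sup>2 * w)))"
  by (rule summable_comparison_test'[OF summable_geometric[of "exp (- (pi * w))"]])
     (use theta_term_le[of w w] in auto)

lemma continuous_on_theta: "continuous_on {0<..} theta_real"
proof -
  have "isCont theta_real w" if w: "w > 0" for w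
  proof -
    define d where "d = w / 2"
    have d: "d > 0" using w by (simp add: d_def)
    have "continuous_on {d<..} (\<lambda>w. \<Sum>n. exp (- (pi * (real (Suc n))\<^sup>2 * w)))"
    proof (rule uniform_limit_theorem)
      show "uniform_limit {d<..} (\<lambda>N w. \<Sum>n<N. exp (- (pi * (real (Suc n))\<^sup>2 * w)))
          (\<lambda>w. \<Sum>n. exp (- (pi * (real (Suc n))\<^sup>2 * w))) sequentially"
        by (rule Weierstrass_m_test[OF _ summable_geometric[of "exp (- (pi * d))"]])
           (use theta_term_le[of d] d in auto)
    qed (auto intro!: always_eventually continuous_intros)
    then have "continuous_on {d<..} theta_real"
      unfolding theta_real_def
      by (subst continuous_on_cong[OF refl, where g = "\<lambda>w. 1 + 2 * (\<Sum>n. exp (- (pi * (real (Suc n))\<^sup>2 * w)))"])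
         (use d in \<open>auto simp del: of_nat_Suc intro!: continuous_intros suminf_mult summable_theta\<close>)
    then show ?thesis
      using w by (auto simp: continuous_on_eq_continuous_at d_def)
  qed
  then show ?thesis by (auto intro: continuous_at_imp_continuous_on)
qed

lemma laplace_theta:
  fixes p :: real assumes p: "p > 0"
  shows "has_bochner_integral hline (\<lambda>w. theta_real w * exp (- (pi * p * w)))
     (cosh (pi * sqrt p) / sinh (pi * sqrt p) / sqrt p)"
proof -
  have G: "has_bochner_integral hline (\<lambda>w. exp (- (q * w))) (1 / q)" if "q > 0" for q :: real
  proof -
    have "has_bochner_integral hline (\<lambda>t. t powr (1 - 1) * exp (- (q * t))) (Gamma 1 * q powr (- 1))"
      by (rule gamma_integral_hline) (use that in auto)
    moreover have "AE t in hline. t powr (1 - 1) * exp (- (q * t)) = exp (- (q * t))"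
      using AE_hline_pos by eventually_elim simp
    ultimately show ?thesis
      using that by (subst (asm) has_bochner_integral_cong_AE) (auto simp: powr_minus divide_inverse)
  qed
  define f where "f = (\<lambda>n w. 2 * exp (- (pi * (p + (real (Suc n))\<^sup>2) * w)))"
  define I where "I = (\<lambda>n. 2 * (1 / (pi * (p + (real (Suc n))\<^sup>2))))"
  have pf: "(\<lambda>n. 2 * sqrt p / ((real (Suc n))\<^sup>2 + (sqrt p)\<^sup>2)) sums
      (pi * cosh (pi * sqrt p) / sinh (pi * sqrt p) - 1 / sqrt p)"
    using p by (intro coth_partial_fractions) auto
  have I_eq: "I n = (2 * sqrt p / ((real (Suc n))\<^sup>2 + (sqrt p)\<^sup>2)) / (pi * sqrt p)" for n
    unfolding I_def using p by (simp add: add.commute)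
  have I: "I sums ((pi * cosh (pi * sqrt p) / sinh (pi * sqrt p) - 1 / sqrt p) / (pi * sqrt p))"
    unfolding I_eq by (intro sums_divide pf)
  have "has_bochner_integral hline (\<lambda>w. \<Sum>n. f n w) (\<Sum>n. I n)"
  proof (rule has_bochner_integral_suminf_nonneg)
    show "has_bochner_integral hline (f n) (I n)" for n
      unfolding f_def I_def using p
      by (intro has_bochner_integral_mult_right G mult_pos_pos) (auto intro: add_pos_nonneg)
    show "AE x in hline. \<forall>n. 0 \<le> f n x" by (auto simp: f_def)
    show "AE x in hline. summable (\<lambda>n. f n x)"
      using AE_hline_pos
    proof eventually_elim
      case (elim w)
      have "summable (\<lambda>n. 2 * exp (- (pi * p * w)) * exp (- (pi * (real (Suc n))\<^sup>2 * w)))"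
        by (intro summable_mult summable_theta elim)
      then show ?case by (simp add: f_def exp_add[symmetric] algebra_simps mult_exp_exp)
    qed
    show "summable I" using I by (simp add: sums_iff)
  qed
  then have "has_bochner_integral hline (\<lambda>w. exp (- (pi * p * w)) + (\<Sum>n. f n w)) (1 / (pi * p) + (\<Sum>n. I n))"
    using p by (intro has_bochner_integral_add G) auto
  also have "1 / (pi * p) + (\<Sum>n. I n) = cosh (pi * sqrt p) / sinh (pi * sqrt p) / sqrt p"
  proof -
    have "p = sqrt p * sqrt p" using p by simp
    then show ?thesis using I p by (simp add: sums_iff diff_divide_distrib)
  qed
  also have "has_bochner_integral hline (\<lambda>w. exp (- (pi * p * w)) + (\<Sum>n. f n w))
      (cosh (pi * sqrt p) / sinh (pi * sqrt p) / sqrt p) \<longleftrightarrow> ?thesis"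
  proof (rule has_bochner_integral_cong_AE)
    show "AE w in hline. exp (- (pi * p * w)) + (\<Sum>n. f n w) = theta_real w * exp (- (pi * p * w))"
      using AE_hline_pos
    proof eventually_elim
      case (elim w)
      have "(\<Sum>n. f n w) = (\<Sum>n. 2 * exp (- (pi * (real (Suc n))\<^sup>2 * w)) * exp (- (pi * p * w)))"
        unfolding f_def by (simp add: mult_exp_exp algebra_simps)
      also have "\<dots> = (\<Sum>n. 2 * exp (- (pi * (real (Suc n))\<^sup>2 * w))) * exp (- (pi * p * w))"
        by (intro suminf_mult2[symmetric] summable_mult summable_theta elim)
      finally show ?case by (simp add: theta_real_def algebra_simps)
    qed
  qed (unfold f_def theta_real_def, measurable)
  finally show ?thesis .
qed

lemma laplace_theta_inverse:
  fixes p :: real assumes p: "p > 0"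
  shows "has_bochner_integral hline (\<lambda>w. w powr (-1/2) * theta_real (1 / w) * exp (- (pi * p * w)))
     (cosh (pi * sqrt p) / sinh (pi * sqrt p) / sqrt p)"
proof -
  define f where "f = (\<lambda>n w. 2 * (w powr (-1/2) * exp (- (pi * (real (Suc n))\<^sup>2 / w)) * exp (- (pi * p * w))))"
  define I where "I = (\<lambda>n. 2 * (exp (- (2 * pi * (real (Suc n)) * sqrt p)) / sqrt p))"
  have "(\<lambda>n. 2 * exp (- (2 * real (Suc n) * (pi * sqrt p)))) sums (cosh (pi * sqrt p) / sinh (pi * sqrt p) - 1)"
    using p by (intro coth_geometric) auto
  from sums_divide[OF this, of "sqrt p"]
  have I: "I sums ((cosh (pi * sqrt p) / sinh (pi * sqrt p) - 1) / sqrt p)"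
    unfolding I_def by (simp add: mult_ac)
  have "has_bochner_integral hline (\<lambda>w. \<Sum>n. f n w) (\<Sum>n. I n)"
  proof (rule has_bochner_integral_suminf_nonneg)
    show "has_bochner_integral hline (f n) (I n)" for n
      unfolding f_def I_def using p
      by (intro has_bochner_integral_mult_right laplace_gauss_inverse) auto
    show "AE x in hline. \<forall>n. 0 \<le> f n x" by (auto simp: f_def)
    show "AE x in hline. summable (\<lambda>n. f n x)"
      using AE_hline_pos
    proof eventually_elim
      case (elim w)
      have "summable (\<lambda>n. 2 * w powr (-1/2) * exp (- (pi * p * w)) * exp (- (pi * (real (Suc n))\<^sup>2 * (1 / w))))"
        using elim by (intro summable_mult summable_theta) auto
      then show ?case by (simp add: f_def mult_ac)
    qed
    show "summable I" using I by (simp add: sums_iff)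
  qed
  moreover have "has_bochner_integral hline (\<lambda>w. w powr (1/2 - 1) * exp (- (pi * p * w))) (1 / sqrt p)"
  proof -
    have "has_bochner_integral hline (\<lambda>w. w powr (1/2 - 1) * exp (- (pi * p * w))) (Gamma (1/2) * (pi * p) powr (- (1/2)))"
      using p by (intro gamma_integral_hline) auto
    also have "Gamma (1/2) * (pi * p) powr (- (1/2)) = 1 / sqrt p"
      using p by (simp add: Gamma_one_half_real powr_minus powr_half_sqrt real_sqrt_mult field_simps)
    finally show ?thesis .
  qed
  ultimately have "has_bochner_integral hline (\<lambda>w. w powr (1/2 - 1) * exp (- (pi * p * w)) + (\<Sum>n. f n w)) (1 / sqrt p + (\<Sum>n. I n))"
    by (intro has_bochner_integral_add)
  also have "1 / sqrt p + (\<Sum>n. I n) = cosh (pi * sqrt p) / sinh (pi * sqrt p) / sqrt p"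
    using I by (simp add: sums_iff diff_divide_distrib)
  also have "has_bochner_integral hline (\<lambda>w. w powr (1/2 - 1) * exp (- (pi * p * w)) + (\<Sum>n. f n w))
      (cosh (pi * sqrt p) / sinh (pi * sqrt p) / sqrt p) \<longleftrightarrow> ?thesis"
  proof (rule has_bochner_integral_cong_AE)
    show "AE w in hline. w powr (1/2 - 1) * exp (- (pi * p * w)) + (\<Sum>n. f n w)
        = w powr (-1/2) * theta_real (1 / w) * exp (- (pi * p * w))"
      using AE_hline_pos
    proof eventually_elim
      case (elim w)
      have "(\<Sum>n. f n w) = (\<Sum>n. (w powr (-1/2) * exp (- (pi * p * w))) * (2 * exp (- (pi * (real (Suc n))\<^sup>2 * (1 / w)))))"
        unfolding f_def by (simp add: mult_ac)
      also have "\<dots> = (w powr (-1/2) * exp (- (pi * p * w))) * (\<Sum>n. 2 * exp (- (pi * (real (Suc n))\<^sup>2 * (1 / w))))"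
        using elim by (intro suminf_mult summable_mult summable_theta) auto
      finally show ?case by (simp add: theta_real_def algebra_simps)
    qed
  qed (unfold f_def theta_real_def, measurable)
  finally show ?thesis .
qed

lemma AE_lborel_continuous_eq:
  fixes f g :: "real \<Rightarrow> real"
  assumes ae: "AE x in lborel. x \<in> S \<longrightarrow> f x = g x" and S: "open S"
    and f: "continuous_on S f" and g: "continuous_on S g" and x: "x \<in> S"
  shows "f x = g x"
proof (rule ccontr)
  assume ne: "f x \<noteq> g x"
  define U where "U = S \<inter> (\<lambda>x. f x - g x) -` (- {0})"
  have "open U" unfolding U_def
    by (intro continuous_open_preimage S continuous_on_diff f g) auto
  moreover have "x \<in> U" using x ne by (simp add: U_def)
  moreover have "negligible U"
  proof -
    have "AE x in lborel. x \<notin> U" using ae by eventually_elim (auto simp: U_def)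
    then have "emeasure lborel U = 0"
      using \<open>open U\<close> by (subst (asm) AE_iff_measurable[of U]) auto
    then show ?thesis
      using \<open>open U\<close> by (auto simp: negligible_iff_null_sets null_sets_def)
  qed
  ultimately show False using open_not_negligible by blast
qed

text \<open>
  Both sides have the Laplace transform \<open>coth (\<pi> sqrt p) / sqrt p\<close>: for the left side this is the
  partial fraction expansion of \<open>coth\<close>, for the right side its expansion as a geometric series.
  Hence they agree almost everywhere, and everywhere by continuity.
\<close>
theorem theta_inversion:
  fixes w :: real assumes w: "w > 0"
  shows "theta_real w = w powr (-1/2) * theta_real (1 / w)"
proof -
  define g where "g = (\<lambda>w. theta_real w - w powr (-1/2) * theta_real (1 / w))"
  have [measurable]: "g \<in> borel_measurable borel" unfolding g_def theta_real_def by measurable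
  have g: "has_bochner_integral hline (\<lambda>w. g w * exp (- (pi * real j * w))) 0" if "j \<ge> 1" for j
    using has_bochner_integral_diff[OF laplace_theta laplace_theta_inverse, of "real j" "real j"] that
    by (simp add: g_def algebra_simps)
  have "AE w in hline. g w = 0"
    by (rule laplace_transform_unique[of _ pi]) (use g in \<open>auto simp: has_bochner_integral_iff\<close>)
  then have "AE x in lborel. x \<in> {0<..} \<longrightarrow> theta_real x = x powr (-1/2) * theta_real (1 / x)"
    unfolding AE_hline by eventually_elim (auto simp: g_def)
  then show ?thesis
  proof (rule AE_lborel_continuous_eq)
    show "continuous_on {0<..} (\<lambda>x. x powr (-1/2) * theta_real (1 / x))"
      by (intro continuous_intros continuous_on_compose2[OF continuous_on_theta]) auto
  qed (use w continuous_on_theta in auto)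
qed

section \<open>Sums over the integer lattice\<close>

lemma has_sum_int_even:
  fixes f :: "int \<Rightarrow> real"
  assumes nn: "\<And>x. f x \<ge> 0" and even: "\<And>x. f (- x) = f x"
    and s: "(\<lambda>n. f (int (Suc n))) sums s"
  shows "(f has_sum (f 0 + 2 * s)) UNIV"
proof -
  have h: "((\<lambda>n. f (int (Suc n))) has_sum s) UNIV"
    using s nn by (intro sums_nonneg_imp_has_sum) auto
  have 1: "(f has_sum s) (range (\<lambda>n. int (Suc n)))"
    using h by (subst has_sum_reindex) (auto simp: inj_on_def o_def)
  have h': "((\<lambda>n. f (- int (Suc n))) has_sum s) UNIV" unfolding even by (rule h)
  have 2: "(f has_sum s) (range (\<lambda>n. - int (Suc n)))"
    using h' by (subst has_sum_reindex) (auto simp: inj_on_def o_def)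
  have 0: "(f has_sum f 0) {0}" by (intro has_sum_finiteI) auto
  have "(f has_sum (f 0 + s + s)) ({0} \<union> range (\<lambda>n. int (Suc n)) \<union> range (\<lambda>n. - int (Suc n)))"
    by (intro has_sum_Un_disjoint 0 1 2) auto
  also have "{0} \<union> range (\<lambda>n. int (Suc n)) \<union> range (\<lambda>n. - int (Suc n)) = UNIV"
  proof -
    have "x \<in> {0} \<union> range (\<lambda>n. int (Suc n)) \<union> range (\<lambda>n. - int (Suc n))" for x
    proof (cases x rule: int_cases3)
      case (pos n)
      then have "x = int (Suc (n - 1))" by auto
      then show ?thesis by blast
    next
      case (neg n)
      then have "x = - int (Suc (n - 1))" by auto
      then show ?thesis by blast
    qed auto
    then show ?thesis by blast
  qed
  finally show ?thesis by (simp add: algebra_simps)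
qed

lemma has_sum_prod_list:
  fixes f :: "'a \<Rightarrow> real"
  assumes nn: "\<And>x. f x \<ge> 0" and f: "(f has_sum S) UNIV"
  shows "((\<lambda>xs. prod_list (map f xs)) has_sum S ^ k) {xs. length xs = k}"
proof (induction k)
  case 0
  show ?case by (intro has_sum_finiteI) auto
next
  case (Suc k)
  let ?L = "\<lambda>k. {xs :: 'a list. length xs = k}"
  let ?g = "\<lambda>(x, xs). f x * prod_list (map f xs)"
  have pn: "prod_list (map f xs) \<ge> 0" for xs by (induction xs) (auto simp: nn)
  have 1: "((\<lambda>xs. ?g (x, xs)) has_sum f x * S ^ k) (?L k)" for x
    using has_sum_cmult_right[OF Suc.IH, of "f x"] by simp
  have 2: "((\<lambda>x. f x * S ^ k) has_sum S * S ^ k) UNIV"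
    by (intro has_sum_cmult_left f)
  have "?g summable_on (Sigma UNIV (\<lambda>_. ?L k))"
    by (rule summable_on_SigmaI[OF 1]) (use 2 nn pn in \<open>auto simp: summable_on_def\<close>)
  from has_sum_SigmaI[OF 1 2 this]
  have "(?g has_sum S ^ Suc k) (Sigma UNIV (\<lambda>_. ?L k))" by simp
  moreover have "bij_betw (\<lambda>(x, xs). x # xs) (Sigma UNIV (\<lambda>_. ?L k)) (?L (Suc k))"
    by (auto simp: bij_betw_def inj_on_def image_iff length_Suc_conv)
  ultimately show ?case
    by (subst has_sum_reindex_bij_betw[symmetric]) (auto simp: case_prod_unfold)
qed

lemma finite_sum_squares: "finite {xs :: int list. length xs = k \<and> (\<Sum>x\<leftarrow>xs. x\<^sup>2) = n}"
proof (rule finite_subset)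
  show "{xs. length xs = k \<and> (\<Sum>x\<leftarrow>xs. x\<^sup>2) = n} \<subseteq> {xs. set xs \<subseteq> {- \<bar>n\<bar>..\<bar>n\<bar>} \<and> length xs = k}"
  proof safe
    fix xs :: "int list" and x
    assume x: "x \<in> set xs" and n: "n = (\<Sum>x\<leftarrow>xs. x\<^sup>2)"
    have "x\<^sup>2 \<le> (\<Sum>x\<leftarrow>xs. x\<^sup>2)"
      using x by (intro member_le_sum_list) auto
    moreover have "\<bar>x\<bar> \<le> x\<^sup>2"
      using self_le_power[of "\<bar>x\<bar>" 2] by (cases "x = 0") auto
    ultimately show "x \<in> {- \<bar>\<Sum>x\<leftarrow>xs. x\<^sup>2\<bar>..\<bar>\<Sum>x\<leftarrow>xs. x\<^sup>2\<bar>}" by auto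
  qed
  show "finite {xs. set xs \<subseteq> {- \<bar>n\<bar>..\<bar>n\<bar>} \<and> length xs = k}"
    by (intro finite_lists_length_eq) auto
qed

text \<open>
  The lists are grouped by the value of the sum of squares. Each group is finite, so the cardinality
  in \<open>sum_squares_count\<close> is the true number of representations.
\<close>
lemma sums_sum_squares_count:
  fixes u :: "nat \<Rightarrow> real"
  assumes u: "((\<lambda>xs. u (nat (\<Sum>x\<leftarrow>xs. x\<^sup>2))) has_sum S) {xs :: int list. length xs = k}"
  shows "(\<lambda>n. real (sum_squares_count k (int n)) * u n) sums S"
proof -
  let ?N = "\<lambda>xs :: int list. nat (\<Sum>x\<leftarrow>xs. x\<^sup>2)"
  define A where "A = (\<lambda>n. {xs :: int list. length xs = k \<and> ?N xs = n})"
  have A: "A n = {xs. length xs = k \<and> (\<Sum>x\<leftarrow>xs. x\<^sup>2) = int n}" for n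
  proof -
    have "(\<Sum>x\<leftarrow>xs. x\<^sup>2) \<ge> 0" for xs :: "int list" by (intro sum_list_nonneg) auto
    then show ?thesis unfolding A_def by (auto simp: nat_eq_iff2)
  qed
  have "bij_betw snd (Sigma UNIV A) {xs :: int list. length xs = k}"
    by (auto simp: bij_betw_def inj_on_def image_iff A_def)
  from has_sum_reindex_bij_betw[OF this, of "\<lambda>xs. u (?N xs)" S] u
  have "((\<lambda>p. u (?N (snd p))) has_sum S) (Sigma UNIV A)" by simp
  then have "((\<lambda>n. real (card (A n)) * u n) has_sum S) UNIV"
  proof (rule has_sum_SigmaD)
    fix n
    have "finite (A n)" unfolding A by (rule finite_sum_squares)
    then show "((\<lambda>xs. u (?N (snd (n, xs)))) has_sum real (card (A n)) * u n) (A n)"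
      by (intro has_sum_finiteI) (auto simp: A_def)
  qed
  then show ?thesis by (intro has_sum_imp_sums) (simp add: A sum_squares_count_def)
qed

lemma sum_squares_count_0: "sum_squares_count k 0 = 1"
proof -
  have "length xs = k \<and> (\<Sum>x\<leftarrow>xs. x\<^sup>2) = 0 \<longleftrightarrow> xs = replicate k 0" for xs :: "int list"
  proof
    assume *: "length xs = k \<and> (\<Sum>x\<leftarrow>xs. x\<^sup>2) = 0"
    then have "\<forall>x\<in>set (map (\<lambda>x. x\<^sup>2) xs). x = 0"
      by (subst (asm) sum_list_nonneg_eq_0_iff) auto
    with * show "xs = replicate k 0" by (auto intro: replicate_eqI)
  qed (simp add: sum_list_replicate)
  then show ?thesis by (simp add: sum_squares_count_def)
qed

lemma theta_power_sums:
  fixes w :: real assumes w: "w > 0"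
  shows "(\<lambda>n. real (sum_squares_count k (int n)) * exp (- (pi * real n * w))) sums (theta_real w ^ k)"
proof (rule sums_sum_squares_count)
  define f where "f = (\<lambda>x::int. exp (- (pi * (real_of_int x)\<^sup>2 * w)))"
  have "(\<lambda>n. f (int (Suc n))) sums (\<Sum>n. exp (- (pi * (real (Suc n))\<^sup>2 * w)))"
    using summable_theta[OF w] unfolding f_def by (simp add: summable_sums add.commute)
  then have "(f has_sum (f 0 + 2 * (\<Sum>n. exp (- (pi * (real (Suc n))\<^sup>2 * w))))) UNIV"
    by (intro has_sum_int_even) (auto simp: f_def)
  also have "f 0 + 2 * (\<Sum>n. exp (- (pi * (real (Suc n))\<^sup>2 * w))) = theta_real w"
    unfolding theta_real_def using suminf_mult[OF summable_theta[OF w], of 2] by (simp add: f_def)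
  finally have "((\<lambda>xs. prod_list (map f xs)) has_sum theta_real w ^ k) {xs. length xs = k}"
    by (intro has_sum_prod_list) (auto simp: f_def)
  moreover have "prod_list (map f xs) = exp (- (pi * real (nat (\<Sum>x\<leftarrow>xs. x\<^sup>2)) * w))" for xs
  proof -
    have "prod_list (map f xs) = exp (- (pi * real_of_int (\<Sum>x\<leftarrow>xs. x\<^sup>2) * w))"
      by (induction xs) (auto simp: f_def algebra_simps mult_exp_exp)
    moreover have "(\<Sum>x\<leftarrow>xs. x\<^sup>2) \<ge> 0" by (intro sum_list_nonneg) auto
    ultimately show ?thesis by simp
  qed
  ultimately show "((\<lambda>xs. exp (- (pi * real (nat (\<Sum>x\<leftarrow>xs. x\<^sup>2)) * w))) has_sum theta_real w ^ k) {xs. length xs = k}"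
    by simp
qed

text \<open>
  Each factor of \<open>\<Prod>(1 + x\<^sub>i\<^sup>2)\<close> is at most \<open>1 + |x|\<^sup>2\<close>, so \<open>(1 + |x|\<^sup>2)\<^sup>-\<^sup>p\<close> is bounded by the product of
  the \<open>(1 + x\<^sub>i\<^sup>2)\<^sup>-\<^sup>q\<close> with \<open>q = p/k\<close>. The sum of these products over the lattice is the \<open>k\<close>-th power
  of a sum over the integers, which is finite because \<open>2 q > 1\<close>.
\<close>
lemma summable_sum_squares_count:
  fixes p :: real assumes k: "k > 0" and p: "p > real k / 2"
  shows "summable (\<lambda>n. real (sum_squares_count k (int n)) * (1 + real n) powr (- p))"
proof -
  define q where "q = p / real k"
  have q: "q > 1/2" using k p by (simp add: q_def field_simps)
  define f where "f = (\<lambda>x::int. (1 + (real_of_int x)\<^sup>2) powr (- q))"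
  have "summable (\<lambda>n. f (int (Suc n)))"
  proof (rule summable_comparison_test')
    show "summable (\<lambda>n. real (Suc n) powr (- (2 * q)))"
      using q by (subst summable_Suc_iff) (simp add: summable_real_powr_iff)
    fix n
    have "f (int (Suc n)) \<le> ((real (Suc n))\<^sup>2) powr (- q)"
      unfolding f_def using q by (intro powr_mono2') auto
    also have "\<dots> = (real (Suc n)) powr (- (2 * q))"
      by (simp add: powr_powr flip: powr_numeral)
    finally show "norm (f (int (Suc n))) \<le> real (Suc n) powr (- (2 * q))"
      by (simp add: f_def)
  qed
  then have "(f has_sum (f 0 + 2 * (\<Sum>n. f (int (Suc n))))) UNIV"
    by (intro has_sum_int_even summable_sums) (auto simp: f_def)
  then have s: "(\<lambda>xs. prod_list (map f xs)) summable_on {xs. length xs = k}"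
    using has_sum_prod_list[of f _ k] by (auto simp: summable_on_def f_def)
  let ?N = "\<lambda>xs :: int list. nat (\<Sum>x\<leftarrow>xs. x\<^sup>2)"
  have "(\<lambda>xs. (1 + real (?N xs)) powr (- p)) summable_on {xs. length xs = k}"
  proof (rule summable_on_comparison_test[OF s])
    fix xs :: "int list" assume "xs \<in> {xs. length xs = k}"
    then have len: "length xs = k" by simp
    define c where "c = (1 + real (?N xs)) powr (- q)"
    have le: "f x \<ge> c" if "x \<in> set xs" for x
    proof -
      have "x\<^sup>2 \<le> (\<Sum>x\<leftarrow>xs. x\<^sup>2)" using that by (intro member_le_sum_list) auto
      then have "int (?N xs) \<ge> x\<^sup>2" by linarith
      then have "real_of_int (x\<^sup>2) \<le> real (?N xs)" by linarith
      then show ?thesis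
        unfolding c_def f_def using q by (intro powr_mono2') (auto intro: add_pos_nonneg)
    qed
    have "c ^ length ys \<le> prod_list (map f ys)" if "set ys \<subseteq> set xs" for ys
      using that
    proof (induction ys)
      case (Cons y ys)
      have "c * c ^ length ys \<le> f y * prod_list (map f ys)"
        using Cons le by (intro mult_mono) (auto simp: c_def f_def)
      then show ?case by simp
    qed simp
    from this[of xs] have "c ^ k \<le> prod_list (map f xs)" by (simp add: len)
    moreover have "c ^ k = (1 + real (?N xs)) powr (- p)"
      using k by (simp add: c_def q_def powr_powr flip: powr_realpow)
    ultimately show "(1 + real (?N xs)) powr (- p) \<le> prod_list (map f xs)" by simp
  qed auto
  then obtain S where "((\<lambda>xs. (1 + real (?N xs)) powr (- p)) has_sum S) {xs. length xs = k}"
    by (auto simp: summable_on_def)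
  from sums_sum_squares_count[OF this] show ?thesis by (rule sums_summable)
qed

section \<open>The radial heat kernel\<close>

text \<open>
  For \<open>a = k/2\<close> this is \<open>\<pi>\<^sup>a/\<Gamma>(a)\<close> times the average of the Gaussian \<open>s\<^sup>a exp (- \<pi> s |X - Y|\<^sup>2)\<close> of total
  mass 1 over the sphere \<open>|Y|\<^sup>2 = t\<close>, where \<open>|X|\<^sup>2 = x\<close>. The factor is the one that turns Lebesgue
  measure on \<open>k\<close>-space into \<open>t\<^sup>a\<^sup>-\<^sup>1 dt\<close>. The parameter \<open>s\<close> is an inverse time, so that \<open>s \<rightarrow> \<infinity>\<close>
  concentrates the kernel at \<open>t = x\<close>.
\<close>
definition heat_kernel :: "real \<Rightarrow> real \<Rightarrow> real \<Rightarrow> real \<Rightarrow> real" where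
  "heat_kernel a s x t = pi powr a / Gamma a * s powr a * exp (- (pi * s * (x + t)))
     * hyp01 a ((pi * s)\<^sup>2 * x * t)"

lemma heat_kernel_measurable [measurable]:
  "a \<ge> 1 \<Longrightarrow> heat_kernel a s x \<in> borel_measurable borel"
  unfolding heat_kernel_def by measurable

lemma heat_kernel_nonneg:
  "a \<ge> 1 \<Longrightarrow> s > 0 \<Longrightarrow> x \<ge> 0 \<Longrightarrow> t \<ge> 0 \<Longrightarrow> heat_kernel a s x t \<ge> 0"
  unfolding heat_kernel_def
  by (intro mult_nonneg_nonneg divide_nonneg_nonneg hyp01_nonneg less_imp_le[OF Gamma_real_pos]) auto

lemma heat_kernel_le:
  assumes a: "a \<ge> 1" and s: "s > 0" and x: "x \<ge> 0" and t: "t \<ge> 0"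
  shows "heat_kernel a s x t \<le> pi powr a / Gamma a * s powr a * exp (- (pi * s * (sqrt x - sqrt t)\<^sup>2))"
proof -
  define y where "y = pi * s * (sqrt x * sqrt t)"
  have y: "y \<ge> 0" "y\<^sup>2 = (pi * s)\<^sup>2 * x * t"
    using s x t by (auto simp: y_def power_mult_distrib)
  have "exp (- (pi * s * (x + t))) * hyp01 a (y\<^sup>2) \<le> exp (- (pi * s * (x + t))) * exp (2 * y)"
    using hyp01_le_exp[OF a y(1)] by (intro mult_left_mono) auto
  also have "\<dots> = exp (- (pi * s * (sqrt x - sqrt t)\<^sup>2))"
    using x t by (simp add: y_def mult_exp_exp power2_diff algebra_simps)
  finally have 1: "exp (- (pi * s * (x + t))) * hyp01 a (y\<^sup>2) \<le> exp (- (pi * s * (sqrt x - sqrt t)\<^sup>2))" .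
  have "pi powr a / Gamma a * s powr a \<ge> 0"
    using a Gamma_real_pos[of a] by (intro mult_nonneg_nonneg divide_nonneg_nonneg) auto
  from mult_left_mono[OF 1 this] show ?thesis
    unfolding heat_kernel_def y(2) by (simp add: mult.assoc)
qed

text \<open>
  Convolving two Gaussians gives a Gaussian; \<open>p = 0\<close> says that the kernel is a probability density
  with respect to \<open>t\<^sup>a\<^sup>-\<^sup>1 dt\<close>.
\<close>
lemma heat_kernel_gaussian:
  assumes a: "a \<ge> 1" and s: "s > 0" and p: "p \<ge> 0"
  shows "has_bochner_integral hline (\<lambda>t. t powr (a - 1) * exp (- (pi * p * t)) * heat_kernel a s x t)
     ((s / (s + p)) powr a * exp (- (pi * x * (s * p / (s + p)))))"
proof -
  define C where "C = pi powr a / Gamma a * s powr a * exp (- (pi * s * x))"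
  have G: "Gamma a > 0" using a by (intro Gamma_real_pos) auto
  have "has_bochner_integral hline (\<lambda>t. C * (t powr (a - 1) * exp (- (pi * (s + p) * t)) * hyp01 a ((pi * s)\<^sup>2 * x * t)))
     (C * (Gamma a * (pi * (s + p)) powr (- a) * exp ((pi * s)\<^sup>2 * x / (pi * (s + p)))))"
    using a s p by (intro has_bochner_integral_mult_right laplace_hyp01) auto
  also have "(\<lambda>t. C * (t powr (a - 1) * exp (- (pi * (s + p) * t)) * hyp01 a ((pi * s)\<^sup>2 * x * t)))
    = (\<lambda>t. t powr (a - 1) * exp (- (pi * p * t)) * heat_kernel a s x t)"
  proof
    fix t
    have "exp (- (pi * s * x)) * exp (- (pi * (s + p) * t)) = exp (- (pi * p * t)) * exp (- (pi * s * (x + t)))"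
      by (simp add: mult_exp_exp algebra_simps)
    then show "C * (t powr (a - 1) * exp (- (pi * (s + p) * t)) * hyp01 a ((pi * s)\<^sup>2 * x * t))
       = t powr (a - 1) * exp (- (pi * p * t)) * heat_kernel a s x t"
      unfolding C_def heat_kernel_def by (simp add: mult_ac)
  qed
  also have "C * (Gamma a * (pi * (s + p)) powr (- a) * exp ((pi * s)\<^sup>2 * x / (pi * (s + p))))
    = (s / (s + p)) powr a * exp (- (pi * x * (s * p / (s + p))))"
  proof -
    have "- (pi * s * x) + (pi * s)\<^sup>2 * x / (pi * (s + p)) = - (pi * x * (s * p / (s + p)))"
    proof -
      define q where "q = s + p"
      have q: "q > 0" "p = q - s" using s p by (auto simp: q_def)
      show ?thesis unfolding q_def[symmetric] unfolding q(2)
        using q(1) by (simp add: field_simps power2_eq_square)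
    qed
    then have "exp (- (pi * s * x)) * exp ((pi * s)\<^sup>2 * x / (pi * (s + p))) = exp (- (pi * x * (s * p / (s + p))))"
      by (simp add: mult_exp_exp)
    moreover have "pi powr a * s powr a * (pi * (s + p)) powr (- a) = (s / (s + p)) powr a"
    proof -
      define q where "q = s + p"
      have q: "q > 0" using s p by (auto simp: q_def)
      show ?thesis unfolding q_def[symmetric] using q s
        by (simp add: powr_mult powr_divide powr_minus field_simps)
    qed
    ultimately show ?thesis unfolding C_def using G by (simp add: mult_ac)
  qed
  finally show ?thesis .
qed

lemma heat_kernel_mass:
  assumes a: "a \<ge> 1" and s: "s > 0"
  shows "has_bochner_integral hline (\<lambda>t. t powr (a - 1) * heat_kernel a s x t) 1"
  using heat_kernel_gaussian[OF a s order_refl, of x] s by simp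

text \<open>
  The left side is maximal at \<open>x = p/c\<close>; the bound drops the factor \<open>exp (- p)\<close> of the maximum.
\<close>
lemma powr_mult_exp_le:
  fixes p c x :: real assumes "p > 0" "c > 0" "x > 0"
  shows "x powr p * exp (- (c * x)) \<le> (p / c) powr p"
proof -
  have "ln (c * x / p) \<le> c * x / p - 1" using assms by (intro ln_le_minus_one) auto
  then have "p * ln (c * x / p) \<le> p * (c * x / p - 1)" using assms by (intro mult_left_mono) auto
  then have "p * ln x \<le> c * x + p * ln (p / c)"
    using assms by (simp add: ln_mult ln_div algebra_simps)
  then have "exp (p * ln x) \<le> exp (c * x + p * ln (p / c))" by simp
  then have "x powr p \<le> exp (c * x) * (p / c) powr p"
    using assms by (simp add: powr_def exp_add)
  then show ?thesis by (simp add: exp_minus field_simps)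
qed

lemma heat_kernel_integrable:
  fixes h :: "real \<Rightarrow> complex"
  assumes a: "a \<ge> 1" and s: "s > 0" and x: "x \<ge> 0"
    and [measurable]: "h \<in> borel_measurable borel" and h: "integrable hline h"
  shows "integrable hline (\<lambda>t. heat_kernel a s x t *\<^sub>R h t)"
proof (rule Bochner_Integration.integrable_bound)
  define C where "C = pi powr a / Gamma a * s powr a"
  have C: "C \<ge> 0" unfolding C_def
    using a Gamma_real_pos[of a] by (intro mult_nonneg_nonneg divide_nonneg_nonneg) auto
  show "integrable hline (\<lambda>t. C *\<^sub>R h t)" using h by auto
  show "AE t in hline. norm (heat_kernel a s x t *\<^sub>R h t) \<le> norm (C *\<^sub>R h t)"
    using AE_hline_pos
  proof eventually_elim
    case (elim t)
    have "heat_kernel a s x t \<le> C * exp (- (pi * s * (sqrt x - sqrt t)\<^sup>2))"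
      unfolding C_def using elim by (intro heat_kernel_le a s x) auto
    also have "\<dots> \<le> C * 1" using C s by (intro mult_left_mono) auto
    finally show ?case using C heat_kernel_nonneg[OF a s x, of t] elim
      by (simp add: mult_right_mono)
  qed
qed (use a in measurable)

text \<open>
  Close to \<open>x\<close> the function \<open>h\<close> is small compared with \<open>t\<^sup>a\<^sup>-\<^sup>1\<close>, and the kernel has mass 1 with respect
  to \<open>t\<^sup>a\<^sup>-\<^sup>1 dt\<close>. Away from \<open>x\<close> the kernel is uniformly \<open>O(s\<^sup>a exp (- \<pi> s \<eta>))\<close>, so integrability
  of \<open>h\<close> is enough there, even near \<open>t = 0\<close>.
\<close>
lemma heat_kernel_approx_zero:
  fixes h :: "real \<Rightarrow> complex"
  assumes a: "a \<ge> 1" and x: "x > 0"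
    and hm [measurable]: "h \<in> borel_measurable borel" and h: "integrable hline h"
    and cont: "isCont h x" and hx: "h x = 0"
  shows "((\<lambda>s. \<integral>t. heat_kernel a s x t *\<^sub>R h t \<partial>hline) \<longlongrightarrow> 0) at_top"
proof (rule tendstoI)
  fix e :: real assume e: "e > 0"
  define C where "C = pi powr a / Gamma a"
  have C: "C > 0" unfolding C_def
    using a Gamma_real_pos[of a] by (intro divide_pos_pos) auto
  have "isCont (\<lambda>t. t powr (1 - a) *\<^sub>R h t) x"
    using x by (intro continuous_intros cont) auto
  then have "\<exists>d>0. \<forall>t. dist t x < d \<longrightarrow> dist (t powr (1 - a) *\<^sub>R h t) (x powr (1 - a) *\<^sub>R h x) < e / 2"
    using e unfolding continuous_at_eps_delta by (meson half_gt_zero)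
  then obtain d0 where d0: "d0 > 0" "\<And>t. \<bar>t - x\<bar> < d0 \<Longrightarrow> norm (t powr (1 - a) *\<^sub>R h t) < e / 2"
    unfolding hx dist_norm scaleR_zero_right diff_zero real_norm_def by blast
  define d where "d = min d0 (x / 2)"
  have d: "d > 0" "d \<le> d0" "d < x" using d0 x by (auto simp: d_def)
  have near: "norm (h t) \<le> e / 2 * t powr (a - 1)" if "t > 0" "\<bar>t - x\<bar> < d" for t
  proof -
    have "t powr (1 - a) * norm (h t) < e / 2" using d0(2)[of t] that d by simp
    then have 1: "t powr (a - 1) * (t powr (1 - a) * norm (h t)) \<le> t powr (a - 1) * (e / 2)"
      by (intro mult_left_mono) auto
    have "t powr (a - 1) * t powr (1 - a) = 1" using that by (simp flip: powr_add)
    then have "norm (h t) = (t powr (a - 1) * t powr (1 - a)) * norm (h t)" by simp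
    also have "\<dots> = t powr (a - 1) * (t powr (1 - a) * norm (h t))" by (rule mult.assoc)
    also have "\<dots> \<le> e / 2 * t powr (a - 1)" using 1 by (simp only: mult.commute)
    finally show ?thesis .
  qed
  \<comment> \<open>the least value of \<open>(sqrt x - sqrt t)\<^sup>2\<close> outside the \<open>d\<close>-neighbourhood of \<open>x\<close>\<close>
  define \<eta> where "\<eta> = (min (sqrt x - sqrt (x - d)) (sqrt (x + d) - sqrt x))\<^sup>2"
  have \<eta>: "\<eta> > 0" unfolding \<eta>_def using d x by (simp add: min_def)
  have far: "(sqrt x - sqrt t)\<^sup>2 \<ge> \<eta>" if "t > 0" "\<bar>t - x\<bar> \<ge> d" for t
  proof -
    have "\<bar>sqrt x - sqrt t\<bar> \<ge> min (sqrt x - sqrt (x - d)) (sqrt (x + d) - sqrt x)"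
    proof (cases "t \<le> x - d")
      case True
      then have "sqrt t \<le> sqrt (x - d)" by simp
      then show ?thesis by linarith
    next
      case False
      with that have "sqrt t \<ge> sqrt (x + d)" by simp
      then show ?thesis by linarith
    qed
    then have "\<bar>sqrt x - sqrt t\<bar>\<^sup>2 \<ge> \<eta>"
      unfolding \<eta>_def using d x by (intro power_mono) (auto simp: min_def)
    then show ?thesis by simp
  qed
  define N where "N = (\<integral>t. norm (h t) \<partial>hline)"
  have N: "N \<ge> 0" unfolding N_def by (intro integral_nonneg_AE) auto
  have main: "norm (\<integral>t. heat_kernel a s x t *\<^sub>R h t \<partial>hline) \<le> e / 2 + C * s powr a * exp (- (pi * s * \<eta>)) * N"
    if s: "s > 0" for s
  proof -
    have "norm (\<integral>t. heat_kernel a s x t *\<^sub>R h t \<partial>hline)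
        \<le> (\<integral>t. e / 2 * (t powr (a - 1) * heat_kernel a s x t) + C * s powr a * exp (- (pi * s * \<eta>)) * norm (h t) \<partial>hline)"
    proof (rule integral_norm_le_AE)
      show "integrable hline (\<lambda>t. heat_kernel a s x t *\<^sub>R h t)"
        using x by (intro heat_kernel_integrable a s h) auto
      show "integrable hline (\<lambda>t. e / 2 * (t powr (a - 1) * heat_kernel a s x t) + C * s powr a * exp (- (pi * s * \<eta>)) * norm (h t))"
        using heat_kernel_mass[OF a s, of x] h
        by (intro Bochner_Integration.integrable_add integrable_mult_right integrable_norm)
           (auto simp: has_bochner_integral_iff)
      show "AE t in hline. norm (heat_kernel a s x t *\<^sub>R h t)
         \<le> e / 2 * (t powr (a - 1) * heat_kernel a s x t) + C * s powr a * exp (- (pi * s * \<eta>)) * norm (h t)"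
        using AE_hline_pos
      proof eventually_elim
        case (elim t)
        have K: "heat_kernel a s x t \<ge> 0" using elim x by (intro heat_kernel_nonneg a s) auto
        have nn: "0 \<le> C * s powr a * exp (- (pi * s * \<eta>)) * norm (h t)" "0 \<le> e / 2 * (t powr (a - 1) * heat_kernel a s x t)"
          using C e K by auto
        show ?case
        proof (cases "\<bar>t - x\<bar> < d")
          case True
          have "heat_kernel a s x t * norm (h t) \<le> heat_kernel a s x t * (e / 2 * t powr (a - 1))"
            using near[OF elim True] K by (intro mult_left_mono)
          with nn K show ?thesis by (simp add: mult_ac)
        next
          case False
          have "heat_kernel a s x t \<le> C * s powr a * exp (- (pi * s * (sqrt x - sqrt t)\<^sup>2))"
            unfolding C_def using elim x by (intro heat_kernel_le a s) auto
          also have "\<dots> \<le> C * s powr a * exp (- (pi * s * \<eta>))"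
            using far[OF elim] False s C by (intro mult_left_mono) auto
          finally have "heat_kernel a s x t * norm (h t) \<le> C * s powr a * exp (- (pi * s * \<eta>)) * norm (h t)"
            by (rule mult_right_mono) auto
          with nn K show ?thesis by simp
        qed
      qed
    qed
    also have "\<dots> = e / 2 + C * s powr a * exp (- (pi * s * \<eta>)) * N"
      using heat_kernel_mass[OF a s, of x] h
      by (subst Bochner_Integration.integral_add) (auto simp: has_bochner_integral_iff N_def)
    finally show ?thesis .
  qed
  have "((\<lambda>s. C * s powr a * exp (- (pi * s * \<eta>)) * N) \<longlongrightarrow> 0) at_top"
  proof -
    have "((\<lambda>s. s powr a * exp (- (pi * s * \<eta>))) \<longlongrightarrow> 0) at_top"
      using \<eta> a by real_asymp
    from tendsto_mult[OF tendsto_const[of "C * N"] this] show ?thesis by (simp add: mult_ac)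
  qed
  then have "\<forall>\<^sub>F s in at_top. C * s powr a * exp (- (pi * s * \<eta>)) * N < e / 2"
    using e by (intro order_tendstoD) auto
  then show "\<forall>\<^sub>F s in at_top. dist (\<integral>t. heat_kernel a s x t *\<^sub>R h t \<partial>hline) 0 < e"
    using eventually_gt_at_top[of 0]
  proof eventually_elim
    case (elim s)
    then show ?case using main[of s] by (simp add: dist_norm)
  qed
qed

text \<open>
  For \<open>t\<^sup>a\<^sup>-\<^sup>1\<close> times a Gaussian the integral is known exactly. Subtracting the multiple that agrees with
  \<open>h\<close> at \<open>x\<close> reduces the claim to the case \<open>h x = 0\<close>.
\<close>
lemma heat_kernel_approx_identity:
  fixes h :: "real \<Rightarrow> complex"
  assumes a: "a \<ge> 1" and x: "x > 0"
    and hm [measurable]: "h \<in> borel_measurable borel" and h: "integrable hline h"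
    and cont: "isCont h x"
  shows "((\<lambda>s. \<integral>t. heat_kernel a s x t *\<^sub>R h t \<partial>hline) \<longlongrightarrow> x powr (1 - a) *\<^sub>R h x) at_top"
proof -
  \<comment> \<open>chosen so that \<open>G x = h x\<close> below\<close>
  define v where "v = (x powr (1 - a) * exp (pi * x)) *\<^sub>R h x"
  define G where "G = (\<lambda>t. (t powr (a - 1) * exp (- (pi * t))) *\<^sub>R v)"
  have [measurable]: "G \<in> borel_measurable borel" unfolding G_def by measurable
  have G_int: "integrable hline G"
    using gamma_integral_hline[of a pi] a unfolding G_def has_bochner_integral_iff
    by (intro integrable_scaleR_left) auto
  have GK: "has_bochner_integral hline (\<lambda>t. heat_kernel a s x t *\<^sub>R G t)
      (((s / (s + 1)) powr a * exp (- (pi * x * (s * 1 / (s + 1))))) *\<^sub>R v)" if s: "s > 0" for s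
  proof -
    have "has_bochner_integral hline (\<lambda>t. (t powr (a - 1) * exp (- (pi * 1 * t)) * heat_kernel a s x t) *\<^sub>R v)
      (((s / (s + 1)) powr a * exp (- (pi * x * (s * 1 / (s + 1))))) *\<^sub>R v)"
      by (intro has_bochner_integral_scaleR_left heat_kernel_gaussian a s) auto
    then show ?thesis by (simp add: G_def mult_ac)
  qed
  have "((\<lambda>s. \<integral>t. heat_kernel a s x t *\<^sub>R (h t - G t) \<partial>hline) \<longlongrightarrow> 0) at_top"
  proof (rule heat_kernel_approx_zero[OF a x])
    show "integrable hline (\<lambda>t. h t - G t)" using h G_int by auto
    show "isCont (\<lambda>t. h t - G t) x"
      unfolding G_def using x by (intro continuous_intros cont) auto
    have "x powr (a - 1) * exp (- (pi * x)) * (x powr (1 - a) * exp (pi * x)) = x powr ((a - 1) + (1 - a)) * exp (- (pi * x) + pi * x)"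
      unfolding powr_add exp_add by simp
    also have "\<dots> = 1" using x by simp
    finally show "h x - G x = 0" by (simp add: G_def v_def)
  qed auto
  moreover have "((\<lambda>s. ((s / (s + 1)) powr a * exp (- (pi * x * (s * 1 / (s + 1))))) *\<^sub>R v) \<longlongrightarrow>
     (1 powr a * exp (- (pi * x * 1))) *\<^sub>R v) at_top"
  proof -
    have 1: "((\<lambda>s::real. s / (s + 1)) \<longlongrightarrow> 1) at_top" by real_asymp
    have 2: "((\<lambda>s::real. s * 1 / (s + 1)) \<longlongrightarrow> 1) at_top" by real_asymp
    show ?thesis by (intro tendsto_intros 1 2) auto
  qed
  ultimately have "((\<lambda>s. (\<integral>t. heat_kernel a s x t *\<^sub>R (h t - G t) \<partial>hline)
      + ((s / (s + 1)) powr a * exp (- (pi * x * (s * 1 / (s + 1))))) *\<^sub>R v) \<longlongrightarrow>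
     0 + (1 powr a * exp (- (pi * x * 1))) *\<^sub>R v) at_top"
    by (rule tendsto_add)
  also have "0 + (1 powr a * exp (- (pi * x * 1))) *\<^sub>R v = x powr (1 - a) *\<^sub>R h x"
    by (simp add: v_def mult_exp_exp mult.left_commute[of "exp _"])
  also have "((\<lambda>s. (\<integral>t. heat_kernel a s x t *\<^sub>R (h t - G t) \<partial>hline)
      + ((s / (s + 1)) powr a * exp (- (pi * x * (s * 1 / (s + 1))))) *\<^sub>R v) \<longlongrightarrow> x powr (1 - a) *\<^sub>R h x) at_top
    \<longleftrightarrow> ?thesis"
  proof (rule tendsto_cong)
    show "\<forall>\<^sub>F s in at_top. (\<integral>t. heat_kernel a s x t *\<^sub>R (h t - G t) \<partial>hline)
      + ((s / (s + 1)) powr a * exp (- (pi * x * (s * 1 / (s + 1))))) *\<^sub>R v = (\<integral>t. heat_kernel a s x t *\<^sub>R h t \<partial>hline)"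
      using eventually_gt_at_top[of 0]
    proof eventually_elim
      case (elim s)
      have "integrable hline (\<lambda>t. heat_kernel a s x t *\<^sub>R h t)"
        using x by (intro heat_kernel_integrable a elim h) auto
      then show ?case using GK[OF elim]
        by (simp add: scaleR_diff_right has_bochner_integral_iff)
    qed
  qed
  finally show ?thesis .
qed

text \<open>
  For \<open>t \<ge> x/4\<close> the decay of \<open>h\<close> is used and the kernel has mass 1. For \<open>t < x/4\<close> the kernel is at
  most a multiple of \<open>s\<^sup>a exp (- \<pi> s x/4)\<close>, which beats every power of \<open>x\<close> uniformly in \<open>s \<ge> 1\<close>.
  This uniform bound dominates the smoothed sums in the limit \<open>s \<rightarrow> \<infinity>\<close>.
\<close>
lemma heat_kernel_decay:
  fixes h :: "real \<Rightarrow> complex"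
  assumes a: "a \<ge> 1" and \<tau>: "\<tau> > 0"
    and hm [measurable]: "h \<in> borel_measurable borel" and h: "integrable hline h"
    and C: "C \<ge> 0" and dec: "\<And>t. t \<ge> 1 / 4 \<Longrightarrow> norm (h t) \<le> C * t powr (- 1 - \<tau>)"
  obtains D where "\<And>s x. s \<ge> 1 \<Longrightarrow> x \<ge> 1 \<Longrightarrow>
    norm (\<integral>t. heat_kernel a s x t *\<^sub>R h t \<partial>hline) \<le> D * x powr (- a - \<tau>)"
proof -
  define B where "B = pi powr a / Gamma a"
  have B: "B > 0" unfolding B_def
    using a Gamma_real_pos[of a] by (intro divide_pos_pos) auto
  define N where "N = (\<integral>t. norm (h t) \<partial>hline)"
  have N: "N \<ge> 0" unfolding N_def by (intro integral_nonneg_AE) auto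
  define E where "E = ((a + \<tau>) / (pi / 4)) powr (a + \<tau>)"
  show thesis
  proof (rule that[of "C * 4 powr (a + \<tau>) + B * E * N"])
    fix s x :: real assume s: "s \<ge> 1" and x: "x \<ge> 1"
    have s0: "s > 0" using s by simp
    define P Q where "P = C * (x / 4) powr (- a - \<tau>)" and "Q = B * s powr a * exp (- (pi / 4 * (s * x)))"
    have P: "P \<ge> 0" and Q: "Q \<ge> 0" using C B by (auto simp: P_def Q_def)
    have "norm (\<integral>t. heat_kernel a s x t *\<^sub>R h t \<partial>hline)
        \<le> (\<integral>t. P * (t powr (a - 1) * heat_kernel a s x t) + Q * norm (h t) \<partial>hline)"
    proof (rule integral_norm_le_AE)
      show "integrable hline (\<lambda>t. heat_kernel a s x t *\<^sub>R h t)"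
        using x by (intro heat_kernel_integrable a s0 h) auto
      show "integrable hline (\<lambda>t. P * (t powr (a - 1) * heat_kernel a s x t) + Q * norm (h t))"
        using heat_kernel_mass[OF a s0, of x] h
        by (intro Bochner_Integration.integrable_add integrable_mult_right integrable_norm)
           (auto simp: has_bochner_integral_iff)
      show "AE t in hline. norm (heat_kernel a s x t *\<^sub>R h t)
         \<le> P * (t powr (a - 1) * heat_kernel a s x t) + Q * norm (h t)"
        using AE_hline_pos
      proof eventually_elim
        case (elim t)
        have K: "heat_kernel a s x t \<ge> 0" using elim x by (intro heat_kernel_nonneg a s0) auto
        have nn: "0 \<le> Q * norm (h t)" "0 \<le> P * (t powr (a - 1) * heat_kernel a s x t)"
          using P Q K by auto
        show ?case
        proof (cases "t \<ge> x / 4")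
          case True
          have "norm (h t) \<le> C * t powr (- 1 - \<tau>)" using True x by (intro dec) auto
          also have "t powr (- 1 - \<tau>) = t powr (- a - \<tau>) * t powr (a - 1)"
            by (subst powr_add[symmetric]) (simp add: algebra_simps)
          also have "C * \<dots> = C * t powr (- a - \<tau>) * t powr (a - 1)" by simp
          also have "\<dots> \<le> P * t powr (a - 1)"
            unfolding P_def using True x a \<tau> C
            by (intro mult_right_mono mult_left_mono powr_mono2') auto
          finally have "heat_kernel a s x t * norm (h t) \<le> heat_kernel a s x t * (P * t powr (a - 1))"
            using K by (intro mult_left_mono)
          with nn K show ?thesis by (simp add: mult_ac)
        next
          case False
          have "sqrt t \<le> sqrt (x / 4)" using False by simp
          also have "\<dots> = sqrt x / 2" by (simp add: real_sqrt_divide)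
          finally have "sqrt x / 2 \<le> sqrt x - sqrt t" by simp
          then have "(sqrt x / 2)\<^sup>2 \<le> (sqrt x - sqrt t)\<^sup>2" using x by (intro power_mono) auto
          then have far: "x / 4 \<le> (sqrt x - sqrt t)\<^sup>2" using x by (simp add: power_divide)
          have "heat_kernel a s x t \<le> B * s powr a * exp (- (pi * s * (sqrt x - sqrt t)\<^sup>2))"
            unfolding B_def using elim x by (intro heat_kernel_le a s0) auto
          also have "\<dots> \<le> B * s powr a * exp (- (pi * s * (x / 4)))"
            using far s B by (intro mult_left_mono) auto
          also have "\<dots> = Q" by (simp add: Q_def mult_ac)
          finally have "heat_kernel a s x t * norm (h t) \<le> Q * norm (h t)"
            by (rule mult_right_mono) auto
          with nn K show ?thesis by simp
        qed
      qed
    qed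
    also have "\<dots> = P + Q * N"
      using heat_kernel_mass[OF a s0, of x] h
      by (subst Bochner_Integration.integral_add) (auto simp: has_bochner_integral_iff N_def)
    also have "P = C * 4 powr (a + \<tau>) * x powr (- a - \<tau>)"
    proof -
      have "(x / 4) powr (- a - \<tau>) = 4 powr (a + \<tau>) * x powr (- a - \<tau>)"
      proof -
        define m where "m = - a - \<tau>"
        have e: "a + \<tau> = - m" by (simp add: m_def)
        show ?thesis unfolding m_def[symmetric] unfolding e
          using x by (simp add: powr_divide powr_minus field_simps)
      qed
      then show ?thesis by (simp add: P_def)
    qed
    also have "Q \<le> B * (E * x powr (- a - \<tau>))"
    proof -
      have "s powr a \<le> s powr (a + \<tau>)" using s \<tau> by (intro powr_mono) auto
      also have "\<dots> = (s * x) powr (a + \<tau>) * x powr (- a - \<tau>)"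
        using s x by (simp add: powr_mult mult.assoc flip: powr_add)
      finally have "s powr a * exp (- (pi / 4 * (s * x)))
          \<le> ((s * x) powr (a + \<tau>) * x powr (- a - \<tau>)) * exp (- (pi / 4 * (s * x)))"
        by (intro mult_right_mono) auto
      also have "\<dots> = ((s * x) powr (a + \<tau>) * exp (- (pi / 4 * (s * x)))) * x powr (- a - \<tau>)"
        by (simp add: mult_ac)
      also have "\<dots> \<le> E * x powr (- a - \<tau>)"
        unfolding E_def using a \<tau> s x by (intro mult_right_mono powr_mult_exp_le) auto
      finally have "B * (s powr a * exp (- (pi / 4 * (s * x)))) \<le> B * (E * x powr (- a - \<tau>))"
        using B by (intro mult_left_mono) auto
      then show ?thesis by (simp add: Q_def mult_ac)
    qed
    then have "Q * N \<le> B * (E * x powr (- a - \<tau>)) * N" using N by (intro mult_right_mono)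
    finally show "norm (\<integral>t. heat_kernel a s x t *\<^sub>R h t \<partial>hline)
       \<le> (C * 4 powr (a + \<tau>) + B * E * N) * x powr (- a - \<tau>)"
      using \<open>Q * N \<le> _\<close> by (simp add: algebra_simps)
  qed
qed

section \<open>Heat kernels and Bessel functions over a theta sequence\<close>

text \<open>
  The model is \<open>r n = r\<^sub>k(n)\<close> with \<open>a = k/2\<close>, but the coefficients enter only through their sign,
  the convergence of their theta series and its modular relation.
\<close>
locale theta_sequence =
  fixes r :: "nat \<Rightarrow> real" and a :: real
  assumes a: "a \<ge> 1"
    and r_nonneg: "\<And>n. r n \<ge> 0"
    and summable_theta_series: "\<And>w. w > 0 \<Longrightarrow> summable (\<lambda>n. r n * exp (- (pi * real n * w)))"
    and theta_modular: "\<And>w. w > 0 \<Longrightarrow>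
      (\<Sum>n. r n * exp (- (pi * real n * w))) = w powr (- a) * (\<Sum>n. r n * exp (- (pi * real n * (1 / w))))"
begin

definition \<Theta> :: "real \<Rightarrow> real" where
  "\<Theta> w = (\<Sum>n. r n * exp (- (pi * real n * w)))"

definition hankel_const :: real where "hankel_const = pi powr a / Gamma a"

lemma hankel_const_pos: "hankel_const > 0"
  unfolding hankel_const_def using a Gamma_real_pos[of a] by (intro divide_pos_pos) auto

text \<open>
  The inequality \<open>(sqrt n - sqrt t)\<^sup>2 \<ge> n/2 - t\<close> reduces the Gaussian bound for the kernel to the theta
  series at \<open>s/2\<close>.
\<close>
lemma summable_heat_sum:
  assumes s: "s > 0" and t: "t \<ge> 0"
  shows "summable (\<lambda>n. r n * heat_kernel a s (real n) t)"
proof (rule summable_comparison_test')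
  define C where "C = pi powr a / Gamma a * s powr a"
  have C: "C \<ge> 0" unfolding C_def
    using a Gamma_real_pos[of a] by (intro mult_nonneg_nonneg divide_nonneg_nonneg) auto
  show "summable (\<lambda>n. C * exp (pi * s * t) * (r n * exp (- (pi * real n * (s / 2)))))"
    using s by (intro summable_mult summable_theta_series) auto
  fix n :: nat
  have "(sqrt (real n) - 2 * sqrt t)\<^sup>2 \<ge> 0" by simp
  then have "(sqrt (real n) - sqrt t)\<^sup>2 \<ge> real n / 2 - t"
    using t by (simp add: power2_diff)
  then have "pi * s * (sqrt (real n) - sqrt t)\<^sup>2 \<ge> pi * s * (real n / 2 - t)"
    using s by (intro mult_left_mono) auto
  then have "exp (- (pi * s * (sqrt (real n) - sqrt t)\<^sup>2)) \<le> exp (pi * s * t) * exp (- (pi * real n * (s / 2)))"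
    by (simp add: mult_exp_exp algebra_simps)
  then have "C * exp (- (pi * s * (sqrt (real n) - sqrt t)\<^sup>2)) \<le> C * (exp (pi * s * t) * exp (- (pi * real n * (s / 2))))"
    using C by (intro mult_left_mono)
  with heat_kernel_le[OF a s _ t, of "real n"]
  have "heat_kernel a s (real n) t \<le> C * (exp (pi * s * t) * exp (- (pi * real n * (s / 2))))"
    unfolding C_def by fastforce
  then have "r n * heat_kernel a s (real n) t \<le> r n * (C * (exp (pi * s * t) * exp (- (pi * real n * (s / 2)))))"
    using r_nonneg by (intro mult_left_mono)
  then show "norm (r n * heat_kernel a s (real n) t) \<le> C * exp (pi * s * t) * (r n * exp (- (pi * real n * (s / 2))))"
    using heat_kernel_nonneg[OF a s _ t, of "real n"] r_nonneg by (simp add: mult_ac)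
qed

lemma summable_bessel_sum:
  assumes s: "s > 0" and t: "t \<ge> 0"
  shows "summable (\<lambda>n. r n * exp (- (pi * real n / s)) * hyp01 a (- (pi\<^sup>2 * real n * t)))"
proof (rule summable_comparison_test')
  show "summable (\<lambda>n. r n * exp (- (pi * real n * (1 / s))))"
    using s by (intro summable_theta_series) auto
  fix n :: nat
  have "\<bar>hyp01 a (- (pi\<^sup>2 * real n * t))\<bar> \<le> 1" using t by (intro abs_hyp01_neg_le_1 a) auto
  then have "(r n * exp (- (pi * real n / s))) * \<bar>hyp01 a (- (pi\<^sup>2 * real n * t))\<bar> \<le> (r n * exp (- (pi * real n / s))) * 1"
    using r_nonneg by (intro mult_left_mono) auto
  then show "norm (r n * exp (- (pi * real n / s)) * hyp01 a (- (pi\<^sup>2 * real n * t))) \<le> r n * exp (- (pi * real n * (1 / s)))"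
    using r_nonneg[of n] by (simp add: abs_mult)
qed

text \<open>
  By \<open>heat_kernel_gaussian\<close> the transform is a multiple of the theta series at \<open>w = s p/(s + p)\<close>. Since
  \<open>1/w = 1/s + 1/p\<close>, the modular relation brings it to the form found for the Bessel sum in the
  next lemma.
\<close>
lemma laplace_heat_sum:
  assumes s: "s > 0" and p: "p > 0"
  shows "has_bochner_integral hline
    (\<lambda>t. t powr (a - 1) * exp (- (pi * p * t)) * (\<Sum>n. r n * heat_kernel a s (real n) t))
    (p powr (- a) * \<Theta> (1 / s + 1 / p))"
proof -
  define w where "w = s * p / (s + p)"
  have w: "w > 0" "1 / w = 1 / s + 1 / p" using s p by (auto simp: w_def field_simps)
  define f where "f = (\<lambda>n t. r n * (t powr (a - 1) * exp (- (pi * p * t)) * heat_kernel a s (real n) t))"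
  define I where "I = (\<lambda>n. r n * ((s / (s + p)) powr a * exp (- (pi * real n * w))))"
  have I_eq: "I n = (s / (s + p)) powr a * (r n * exp (- (pi * real n * w)))" for n
    by (simp add: I_def)
  have I: "I sums ((s / (s + p)) powr a * \<Theta> w)"
    unfolding I_eq \<Theta>_def by (intro sums_mult summable_sums summable_theta_series w)
  have "has_bochner_integral hline (\<lambda>t. \<Sum>n. f n t) (\<Sum>n. I n)"
  proof (rule has_bochner_integral_suminf_nonneg)
    show "has_bochner_integral hline (f n) (I n)" for n
      unfolding f_def I_def w_def
      using p by (intro has_bochner_integral_mult_right heat_kernel_gaussian a s) auto
    show "AE t in hline. \<forall>n. 0 \<le> f n t"
      using AE_hline_pos
      by eventually_elim (auto simp: f_def intro!: mult_nonneg_nonneg r_nonneg heat_kernel_nonneg a s)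
    show "AE t in hline. summable (\<lambda>n. f n t)"
      using AE_hline_pos
    proof eventually_elim
      case (elim t)
      have "summable (\<lambda>n. (t powr (a - 1) * exp (- (pi * p * t))) * (r n * heat_kernel a s (real n) t))"
        using elim by (intro summable_mult summable_heat_sum s) auto
      then show ?case by (simp add: f_def mult_ac)
    qed
    show "summable I" using I by (rule sums_summable)
  qed
  also have "(\<Sum>n. I n) = p powr (- a) * \<Theta> (1 / s + 1 / p)"
  proof -
    have "\<Theta> w = w powr (- a) * \<Theta> (1 / s + 1 / p)"
      unfolding \<Theta>_def w(2)[symmetric] by (rule theta_modular[OF w(1)])
    moreover have "(s / (s + p)) powr a * w powr (- a) = p powr (- a)"
    proof -
      have "w = (s / (s + p)) * p" by (simp add: w_def)
      then have "w powr (- a) = (s / (s + p)) powr (- a) * p powr (- a)"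
        using s p by (simp only: powr_mult)
      moreover have "(s / (s + p)) powr a * (s / (s + p)) powr (- a) = 1"
        using s p by (simp flip: powr_add)
      ultimately show ?thesis by (simp flip: mult.assoc)
    qed
    ultimately show ?thesis using I by (simp add: sums_iff flip: mult.assoc)
  qed
  finally have 1: "has_bochner_integral hline (\<lambda>t. \<Sum>n. f n t) (p powr (- a) * \<Theta> (1 / s + 1 / p))" .
  have [measurable]: "heat_kernel a s x \<in> borel_measurable borel" for x
    by (rule heat_kernel_measurable[OF a])
  show ?thesis
  proof (rule has_bochner_integral_cong_AE[THEN iffD1, OF _ _ _ 1])
    show "AE t in hline. (\<Sum>n. f n t) = t powr (a - 1) * exp (- (pi * p * t)) * (\<Sum>n. r n * heat_kernel a s (real n) t)"
      using AE_hline_pos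
    proof eventually_elim
      case (elim t)
      show ?case unfolding f_def
        using elim by (subst suminf_mult[symmetric]) (auto intro!: summable_heat_sum s simp: mult_ac)
    qed
  qed (unfold f_def, measurable)
qed

lemma laplace_bessel_sum:
  assumes s: "s > 0" and p: "p > 0"
  shows "has_bochner_integral hline
    (\<lambda>t. t powr (a - 1) * exp (- (pi * p * t)) *
       (\<Sum>n. r n * exp (- (pi * real n / s)) * hyp01 a (- (pi\<^sup>2 * real n * t))))
    (p powr (- a) / hankel_const * \<Theta> (1 / s + 1 / p))"
proof -
  define g where "g = (\<lambda>t. t powr (a - 1) * exp (- (pi * p * t)))"
  define f where "f = (\<lambda>n t. r n * exp (- (pi * real n / s)) * (g t * hyp01 a (- (pi\<^sup>2 * real n) * t)))"
  define I where "I = (\<lambda>n. r n * exp (- (pi * real n / s)) *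
      (Gamma a * (pi * p) powr (- a) * exp (- (pi\<^sup>2 * real n) / (pi * p))))"
  have gam: "Gamma a > 0" using a by (intro Gamma_real_pos) auto
  have I_eq: "I n = p powr (- a) / hankel_const * (r n * exp (- (pi * real n * (1 / s + 1 / p))))" for n
  proof -
    have "- (pi\<^sup>2 * real n) / (pi * p) = - (pi * real n / p)" by (simp add: power2_eq_square)
    moreover have "exp (- (pi * real n / s)) * exp (- (pi * real n / p)) = exp (- (pi * real n * (1 / s + 1 / p)))"
      by (simp add: mult_exp_exp algebra_simps)
    moreover have "Gamma a * (pi * p) powr (- a) = p powr (- a) / hankel_const"
      using p by (simp add: hankel_const_def powr_mult powr_minus field_simps)
    ultimately show ?thesis unfolding I_def by (simp add: mult_ac)
  qed
  have sp: "1 / s + 1 / p > 0" using s p by (intro add_pos_pos) auto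
  have I: "I sums (p powr (- a) / hankel_const * \<Theta> (1 / s + 1 / p))"
    unfolding I_eq \<Theta>_def by (intro sums_mult summable_sums summable_theta_series sp)
  have g_int: "integrable hline g"
    using gamma_integral_hline[of a "pi * p"] a p unfolding g_def has_bochner_integral_iff by auto
  have "has_bochner_integral hline (\<lambda>t. \<Sum>n. f n t) (\<Sum>n. I n)"
  proof (rule has_bochner_integral_suminf_dominated(1)[OF _ _ g_int])
    show "has_bochner_integral hline (f n) (I n)" for n
      unfolding f_def I_def g_def using p
      by (intro has_bochner_integral_mult_right laplace_hyp01 a) auto
    show "summable (\<lambda>n. r n * exp (- (pi * real n * (1 / s))))"
      using s by (intro summable_theta_series) auto
    show "AE t in hline. \<forall>n. norm (f n t) \<le> r n * exp (- (pi * real n * (1 / s))) * g t"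
      using AE_hline_pos
    proof eventually_elim
      case (elim t)
      show ?case
      proof
        fix n
        have "\<bar>hyp01 a (- (pi\<^sup>2 * real n * t))\<bar> \<le> 1" using elim by (intro abs_hyp01_neg_le_1 a) auto
        then have "(r n * exp (- (pi * real n / s)) * g t) * \<bar>hyp01 a (- (pi\<^sup>2 * real n * t))\<bar>
           \<le> (r n * exp (- (pi * real n / s)) * g t) * 1"
          using r_nonneg by (intro mult_left_mono) (auto simp: g_def)
        then show "norm (f n t) \<le> r n * exp (- (pi * real n * (1 / s))) * g t"
          using r_nonneg[of n] by (simp add: f_def g_def abs_mult mult_ac)
      qed
    qed
  qed
  then have 1: "has_bochner_integral hline (\<lambda>t. \<Sum>n. f n t) (p powr (- a) / hankel_const * \<Theta> (1 / s + 1 / p))"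
    using I by (simp add: sums_iff)
  show ?thesis
  proof (rule has_bochner_integral_cong_AE[THEN iffD1, OF _ _ _ 1])
    show "AE t in hline. (\<Sum>n. f n t) = t powr (a - 1) * exp (- (pi * p * t)) *
       (\<Sum>n. r n * exp (- (pi * real n / s)) * hyp01 a (- (pi\<^sup>2 * real n * t)))"
      using AE_hline_pos
    proof eventually_elim
      case (elim t)
      have "f n t = g t * (r n * exp (- (pi * real n / s)) * hyp01 a (- (pi\<^sup>2 * real n * t)))" for n
        by (simp add: f_def mult_ac)
      then show ?case
        using suminf_mult[OF summable_bessel_sum[OF s less_imp_le[OF elim]], of "g t"] by (simp add: g_def)
    qed
  qed (use a in \<open>unfold f_def g_def, measurable\<close>)
qed

text \<open>
  Poisson's formula for the lattice translates of a Gaussian, averaged over the sphere of squared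
  radius \<open>t\<close>. The left side has nonnegative terms and the right side is bounded in \<open>t\<close>; later this
  bound justifies interchanging sum and integral on the left.
\<close>
lemma heat_sum_eq_bessel_sum:
  assumes s: "s > 0"
  shows "AE t in hline. (\<Sum>n. r n * heat_kernel a s (real n) t)
    = hankel_const * (\<Sum>n. r n * exp (- (pi * real n / s)) * hyp01 a (- (pi\<^sup>2 * real n * t)))"
proof -
  define A where "A = (\<lambda>t. \<Sum>n. r n * heat_kernel a s (real n) t)"
  define B where "B = (\<lambda>t. \<Sum>n. r n * exp (- (pi * real n / s)) * hyp01 a (- (pi\<^sup>2 * real n * t)))"
  define g where "g = (\<lambda>t. t powr (a - 1) * (A t - hankel_const * B t))"
  have [measurable]: "heat_kernel a s x \<in> borel_measurable borel" for x
    by (rule heat_kernel_measurable[OF a])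
  have [measurable]: "A \<in> borel_measurable borel" "B \<in> borel_measurable borel"
    unfolding A_def B_def using a by measurable
  have g: "has_bochner_integral hline (\<lambda>t. g t * exp (- (pi * real j * t))) 0" if "j \<ge> 1" for j
  proof -
    have j: "real j > 0" using that by simp
    have "has_bochner_integral hline
      (\<lambda>t. t powr (a - 1) * exp (- (pi * real j * t)) * A t
         - hankel_const * (t powr (a - 1) * exp (- (pi * real j * t)) * B t))
      (real j powr (- a) * \<Theta> (1 / s + 1 / real j) - hankel_const * (real j powr (- a) / hankel_const * \<Theta> (1 / s + 1 / real j)))"
      unfolding A_def B_def
      by (intro has_bochner_integral_diff has_bochner_integral_mult_right laplace_heat_sum laplace_bessel_sum s j)
    then show ?thesis using hankel_const_pos by (simp add: g_def algebra_simps)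
  qed
  have "AE t in hline. g t = 0"
    by (rule laplace_transform_unique[of _ pi])
       (use g in \<open>auto simp: has_bochner_integral_iff g_def\<close>)
  then show ?thesis
    using AE_hline_pos by eventually_elim (auto simp: g_def A_def B_def)
qed

end

section \<open>The summation formula for a theta sequence\<close>

lemma summable_bounded_rate:
  fixes f :: "nat \<Rightarrow> 'b :: banach" 
  assumes "\<And>n. n \<ge> 1 \<Longrightarrow> norm (f n) \<le> q n" "summable q"
  shows "summable f"
  by (rule summable_comparison_test_ev[OF _ assms(2)])
     (use assms(1) in \<open>auto intro: eventually_mono[OF eventually_ge_at_top[of 1]]\<close>)

context theta_sequence
begin

text \<open>
  For \<open>a = k/2\<close> and \<open>h(t) = t\<^sup>a\<^sup>-\<^sup>1 \<phi>(t)\<close> this is the Fourier transform of the radial function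
  \<open>\<phi>(|x|\<^sup>2)\<close> on \<open>k\<close>-space at the points with \<open>|\<xi>|\<^sup>2 = y\<close>. The weight \<open>t\<^sup>a\<^sup>-\<^sup>1\<close> is kept inside \<open>h\<close> so that
  integrability of \<open>h\<close> is that of the radial function.
\<close>
definition hankel :: "(real \<Rightarrow> complex) \<Rightarrow> real \<Rightarrow> complex" where
  "hankel h y = hankel_const *\<^sub>R (\<integral>t. hyp01 a (- (pi\<^sup>2 * y * t)) *\<^sub>R h t \<partial>hline)"

lemma hankel_measurable:
  assumes [measurable]: "h \<in> borel_measurable borel"
  shows "hankel h \<in> borel_measurable borel"
  unfolding hankel_def using a by measurable

lemma integrable_hyp01_mult:
  fixes h :: "real \<Rightarrow> complex"
  assumes [measurable]: "h \<in> borel_measurable borel" and h: "integrable hline h" and y: "y \<ge> 0"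
  shows "integrable hline (\<lambda>t. hyp01 a (- (pi\<^sup>2 * y * t)) *\<^sub>R h t)"
proof (rule Bochner_Integration.integrable_bound[OF h])
  show "AE t in hline. norm (hyp01 a (- (pi\<^sup>2 * y * t)) *\<^sub>R h t) \<le> norm (h t)"
    using AE_hline_pos
  proof eventually_elim
    case (elim t)
    have "\<bar>hyp01 a (- (pi\<^sup>2 * y * t))\<bar> \<le> 1" using elim y by (intro abs_hyp01_neg_le_1 a) auto
    then show ?case by (simp add: mult_left_le_one_le)
  qed
qed (use a in measurable)

lemma norm_hankel_le:
  fixes h :: "real \<Rightarrow> complex"
  assumes [measurable]: "h \<in> borel_measurable borel" and h: "integrable hline h" and y: "y \<ge> 0"
  shows "norm (hankel h y) \<le> hankel_const * (\<integral>t. norm (h t) \<partial>hline)"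
proof -
  have "norm (\<integral>t. hyp01 a (- (pi\<^sup>2 * y * t)) *\<^sub>R h t \<partial>hline) \<le> (\<integral>t. norm (h t) \<partial>hline)"
  proof (rule integral_norm_le_AE[OF integrable_hyp01_mult[OF assms] integrable_norm[OF h]])
    show "AE t in hline. norm (hyp01 a (- (pi\<^sup>2 * y * t)) *\<^sub>R h t) \<le> norm (h t)"
      using AE_hline_pos
    proof eventually_elim
      case (elim t)
      have "\<bar>hyp01 a (- (pi\<^sup>2 * y * t))\<bar> \<le> 1" using elim y by (intro abs_hyp01_neg_le_1 a) auto
      then show ?case by (simp add: mult_left_le_one_le)
    qed
  qed
  then show ?thesis using hankel_const_pos unfolding hankel_def by simp
qed

text \<open>
  The identity \<open>heat_sum_eq_bessel_sum\<close> is integrated against \<open>h\<close>. On the Bessel side the terms are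
  dominated by the theta series. On the heat kernel side the absolute values of the terms add up to
  the kernel sum times \<open>|h|\<close>, and that sum is bounded because it equals the Bessel sum.
\<close>
lemma smoothed_summation:
  fixes h :: "real \<Rightarrow> complex"
  assumes [measurable]: "h \<in> borel_measurable borel" and h: "integrable hline h" and s: "s > 0"
  shows "(\<Sum>n. (r n * exp (- (pi * real n / s))) *\<^sub>R hankel h (real n))
       = (\<Sum>n. r n *\<^sub>R (\<integral>t. heat_kernel a s (real n) t *\<^sub>R h t \<partial>hline))"
proof -
  have [measurable]: "heat_kernel a s x \<in> borel_measurable borel" for x
    by (rule heat_kernel_measurable[OF a])
  define B where "B = (\<lambda>t. \<Sum>n. r n * exp (- (pi * real n / s)) * hyp01 a (- (pi\<^sup>2 * real n * t)))"
  define A where "A = (\<lambda>t. \<Sum>n. r n * heat_kernel a s (real n) t)"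
  have [measurable]: "A \<in> borel_measurable borel" "B \<in> borel_measurable borel"
    unfolding A_def B_def using a by measurable
  have AB: "AE t in hline. A t = hankel_const * B t"
    unfolding A_def B_def by (rule heat_sum_eq_bessel_sum[OF s])
  have nh: "integrable hline (\<lambda>t. norm (h t))" using h by simp
  define fB where "fB = (\<lambda>n t. (r n * exp (- (pi * real n / s)) * hyp01 a (- (pi\<^sup>2 * real n * t))) *\<^sub>R h t)"
  define IB where "IB = (\<lambda>n. (r n * exp (- (pi * real n / s))) *\<^sub>R (\<integral>t. hyp01 a (- (pi\<^sup>2 * real n * t)) *\<^sub>R h t \<partial>hline))"
  have fB: "has_bochner_integral hline (fB n) (IB n)" for n
  proof -
    have "has_bochner_integral hline (\<lambda>t. (r n * exp (- (pi * real n / s))) *\<^sub>R (hyp01 a (- (pi\<^sup>2 * real n * t)) *\<^sub>R h t)) (IB n)"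
      unfolding IB_def
      by (intro has_bochner_integral_scaleR_right has_bochner_integral_integrable integrable_hyp01_mult h) auto
    then show ?thesis by (simp add: fB_def)
  qed
  have qs: "summable (\<lambda>n. r n * exp (- (pi * real n * (1 / s))))"
    using s by (intro summable_theta_series) auto
  have bB: "AE t in hline. \<forall>n. norm (fB n t) \<le> r n * exp (- (pi * real n * (1 / s))) * norm (h t)"
    using AE_hline_pos
  proof eventually_elim
    case (elim t)
    show ?case
    proof
      fix n
      have "\<bar>hyp01 a (- (pi\<^sup>2 * real n * t))\<bar> \<le> 1" using elim by (intro abs_hyp01_neg_le_1 a) auto
      then have "(r n * exp (- (pi * real n / s)) * norm (h t)) * \<bar>hyp01 a (- (pi\<^sup>2 * real n * t))\<bar>
         \<le> (r n * exp (- (pi * real n / s)) * norm (h t)) * 1"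
        using r_nonneg by (intro mult_left_mono) auto
      then show "norm (fB n t) \<le> r n * exp (- (pi * real n * (1 / s))) * norm (h t)"
        using r_nonneg[of n] by (simp add: fB_def abs_mult mult_ac)
    qed
  qed
  note B1 = has_bochner_integral_suminf_dominated[OF fB bB nh qs]
  have sumB: "AE t in hline. (\<Sum>n. fB n t) = B t *\<^sub>R h t"
    using AE_hline_pos
  proof eventually_elim
    case (elim t)
    show ?case unfolding fB_def B_def
      using summable_bessel_sum[OF s less_imp_le[OF elim]]
      by (intro sums_unique[symmetric] sums_scaleR_left summable_sums)
  qed
  have "(\<Sum>n. (r n * exp (- (pi * real n / s))) *\<^sub>R hankel h (real n)) = (\<Sum>n. hankel_const *\<^sub>R IB n)"
    by (simp add: hankel_def IB_def mult_ac)
  also have "\<dots> = hankel_const *\<^sub>R (\<Sum>n. IB n)"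
    by (rule suminf_scaleR_right[OF B1(2), symmetric])
  also have "(\<Sum>n. IB n) = (\<integral>t. (\<Sum>n. fB n t) \<partial>hline)"
    using B1(1) by (simp add: has_bochner_integral_iff)
  also have "\<dots> = (\<integral>t. B t *\<^sub>R h t \<partial>hline)"
    by (intro integral_cong_AE sumB) (use a in \<open>unfold fB_def, measurable\<close>)
  also have "hankel_const *\<^sub>R \<dots> = (\<integral>t. A t *\<^sub>R h t \<partial>hline)"
    unfolding integral_scaleR_right[symmetric]
    by (intro integral_cong_AE) (use AB in \<open>auto elim: eventually_mono\<close>)
  also have "\<dots> = (\<Sum>n. r n *\<^sub>R (\<integral>t. heat_kernel a s (real n) t *\<^sub>R h t \<partial>hline))"
  proof -
    define f where "f = (\<lambda>n t. (r n * heat_kernel a s (real n) t) *\<^sub>R h t)"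
    have f_int: "integrable hline (f n)" for n
    proof -
      have "integrable hline (\<lambda>t. r n *\<^sub>R (heat_kernel a s (real n) t *\<^sub>R h t))"
        by (intro integrable_scaleR_right heat_kernel_integrable a s h) auto
      then show ?thesis by (simp add: f_def)
    qed
    have nf: "AE t in hline. \<forall>n. norm (f n t) = r n * heat_kernel a s (real n) t * norm (h t)"
      using AE_hline_pos
      by eventually_elim (use r_nonneg heat_kernel_nonneg[OF a s] in \<open>auto simp: f_def abs_mult\<close>)
    \<comment> \<open>the bound for the sum of the heat kernels obtained from the Bessel side\<close>
    define Q where "Q = hankel_const * (\<Sum>n. r n * exp (- (pi * real n * (1 / s))))"
    have A_le: "AE t in hline. A t \<le> Q"
      using AB AE_hline_pos
    proof eventually_elim
      case (elim t)
      have "B t \<le> (\<Sum>n. r n * exp (- (pi * real n * (1 / s))))"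
        unfolding B_def
      proof (rule suminf_le[OF _ summable_bessel_sum[OF s less_imp_le[OF elim(2)]] qs])
        fix n
        have "\<bar>hyp01 a (- (pi\<^sup>2 * real n * t))\<bar> \<le> 1" using elim by (intro abs_hyp01_neg_le_1 a) auto
        then have "(r n * exp (- (pi * real n / s))) * hyp01 a (- (pi\<^sup>2 * real n * t)) \<le> (r n * exp (- (pi * real n / s))) * 1"
          using r_nonneg by (intro mult_left_mono) auto
        then show "r n * exp (- (pi * real n / s)) * hyp01 a (- (pi\<^sup>2 * real n * t)) \<le> r n * exp (- (pi * real n * (1 / s)))"
          by simp
      qed
      then show ?case unfolding elim(1) Q_def using hankel_const_pos by (intro mult_left_mono) auto
    qed
    have s1: "AE t in hline. summable (\<lambda>n. norm (f n t))"
      using nf AE_hline_pos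
      by eventually_elim (auto intro!: summable_mult2 summable_heat_sum s)
    have s2: "summable (\<lambda>n. \<integral>t. norm (f n t) \<partial>hline)"
    proof (rule summableI_nonneg_bounded)
      fix N
      have "(\<Sum>n<N. \<integral>t. norm (f n t) \<partial>hline) = (\<integral>t. (\<Sum>n<N. norm (f n t)) \<partial>hline)"
        using f_int by (intro Bochner_Integration.integral_sum[symmetric]) auto
      also have "\<dots> \<le> (\<integral>t. Q * norm (h t) \<partial>hline)"
      proof (rule integral_mono_AE)
        show "integrable hline (\<lambda>t. \<Sum>n<N. norm (f n t))" using f_int by auto
        show "integrable hline (\<lambda>t. Q * norm (h t))" using nh by auto
        show "AE t in hline. (\<Sum>n<N. norm (f n t)) \<le> Q * norm (h t)"
          using nf A_le AE_hline_pos
        proof eventually_elim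
          case (elim t)
          have "(\<Sum>n<N. norm (f n t)) = (\<Sum>n<N. r n * heat_kernel a s (real n) t) * norm (h t)"
            using elim(1) by (simp add: sum_distrib_right)
          also have "\<dots> \<le> A t * norm (h t)"
            unfolding A_def using elim(3)
            by (intro mult_right_mono sum_le_suminf summable_heat_sum s)
               (auto intro!: mult_nonneg_nonneg r_nonneg heat_kernel_nonneg a s)
          also have "\<dots> \<le> Q * norm (h t)" using elim(2) by (intro mult_right_mono) auto
          finally show ?case .
        qed
      qed
      finally show "(\<Sum>n<N. \<integral>t. norm (f n t) \<partial>hline) \<le> (\<integral>t. Q * norm (h t) \<partial>hline)" .
    qed (auto intro!: integral_nonneg_AE)
    have sumA: "AE t in hline. (\<Sum>n. f n t) = A t *\<^sub>R h t"
      using AE_hline_pos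
    proof eventually_elim
      case (elim t)
      show ?case unfolding f_def A_def
        using summable_heat_sum[OF s less_imp_le[OF elim]]
        by (intro sums_unique[symmetric] sums_scaleR_left summable_sums)
    qed
    have "(\<integral>t. A t *\<^sub>R h t \<partial>hline) = (\<integral>t. (\<Sum>n. f n t) \<partial>hline)"
      using sumA by (intro integral_cong_AE) (unfold f_def, auto elim: eventually_mono)
    also have "\<dots> = (\<Sum>n. integral\<^sup>L hline (f n))" by (rule integral_suminf[OF f_int s1 s2])
    also have "\<dots> = (\<Sum>n. r n *\<^sub>R (\<integral>t. heat_kernel a s (real n) t *\<^sub>R h t \<partial>hline))"
      unfolding f_def scaleR_scaleR[symmetric] integral_scaleR_right ..
    finally show ?thesis .
  qed
  finally show ?thesis .
qed

text \<open>
  The term at the origin is moved to the transform side: \<open>heat_kernel a s 0\<close> is the transform of a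
  Gaussian, and Fubini shifts the transform to \<open>h\<close>. This is needed because \<open>t\<^sup>1\<^sup>-\<^sup>a h(t)\<close> need not
  have a limit at \<open>0\<close>.
\<close>
lemma heat_kernel_at_zero:
  fixes h :: "real \<Rightarrow> complex"
  assumes hm [measurable]: "h \<in> borel_measurable borel" and h: "integrable hline h" and s: "s > 0"
  shows "(\<integral>t. heat_kernel a s 0 t *\<^sub>R h t \<partial>hline)
       = hankel_const *\<^sub>R (\<integral>y. (y powr (a - 1) * exp (- (pi / s * y))) *\<^sub>R hankel h y \<partial>hline)"
proof -
  interpret P: pair_sigma_finite hline hline ..
  define k where "k = (\<lambda>y. y powr (a - 1) * exp (- (pi / s * y)))"
  have [measurable]: "k \<in> borel_measurable borel" unfolding k_def by measurable
  have k_int: "integrable hline k"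
    using gamma_integral_hline[of a "pi / s"] a s unfolding k_def has_bochner_integral_iff by auto
  have gam: "Gamma a > 0" using a by (intro Gamma_real_pos) auto
  have K: "heat_kernel a s 0 t = hankel_const * (hankel_const * (\<integral>y. k y * hyp01 a (- (pi\<^sup>2 * t) * y) \<partial>hline))" for t
  proof -
    have "(\<integral>y. k y * hyp01 a (- (pi\<^sup>2 * t) * y) \<partial>hline) = Gamma a * (pi / s) powr (- a) * exp (- (pi\<^sup>2 * t) / (pi / s))"
      unfolding k_def using s by (intro has_bochner_integral_integral_eq laplace_hyp01 a) auto
    moreover have "- (pi\<^sup>2 * t) / (pi / s) = - (pi * s * t)" by (simp add: power2_eq_square)
    moreover have "hankel_const * (Gamma a * (pi / s) powr (- a)) = s powr a"
      unfolding hankel_const_def using gam s by (simp add: powr_divide powr_minus field_simps)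
    ultimately have "hankel_const * (\<integral>y. k y * hyp01 a (- (pi\<^sup>2 * t) * y) \<partial>hline) = s powr a * exp (- (pi * s * t))"
      by (simp only: mult.assoc[symmetric])
    then show ?thesis by (simp add: heat_kernel_def hankel_const_def)
  qed
  define f where "f = (\<lambda>t y. (k y * hyp01 a (- (pi\<^sup>2 * t * y))) *\<^sub>R h t)"
  have [measurable]: "(\<lambda>(t, y). f t y) \<in> borel_measurable (hline \<Otimes>\<^sub>M hline)"
    unfolding f_def using a by measurable
  have f_le: "norm (f t y) \<le> k y * norm (h t)" if "t > 0" "y > 0" for t y
  proof -
    have "\<bar>hyp01 a (- (pi\<^sup>2 * t * y))\<bar> \<le> 1" using that by (intro abs_hyp01_neg_le_1 a) auto
    then have "(k y * norm (h t)) * \<bar>hyp01 a (- (pi\<^sup>2 * t * y))\<bar> \<le> (k y * norm (h t)) * 1"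
      by (intro mult_left_mono) (auto simp: k_def)
    then show ?thesis by (simp add: f_def k_def abs_mult mult_ac)
  qed
  have int_y: "integrable hline (f t)" if t: "t > 0" for t
  proof (rule Bochner_Integration.integrable_bound)
    show "integrable hline (\<lambda>y. k y * norm (h t))" using k_int by auto
    show "AE y in hline. norm (f t y) \<le> norm (k y * norm (h t))"
      using AE_hline_pos by eventually_elim (use f_le[OF t] in \<open>auto simp: k_def\<close>)
  qed (use a in \<open>unfold f_def, measurable\<close>)
  have int: "integrable (hline \<Otimes>\<^sub>M hline) (\<lambda>(t, y). f t y)"
  proof (rule P.Fubini_integrable)
    show "AE t in hline. integrable hline (\<lambda>y. (\<lambda>(t, y). f t y) (t, y))"
      using AE_hline_pos by eventually_elim (simp add: int_y)
    show "integrable hline (\<lambda>t. \<integral>y. norm ((\<lambda>(t, y). f t y) (t, y)) \<partial>hline)"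
    proof (rule Bochner_Integration.integrable_bound)
      show "integrable hline (\<lambda>t. (\<integral>y. k y \<partial>hline) * norm (h t))" using h by auto
      show "AE t in hline. norm (\<integral>y. norm ((\<lambda>(t, y). f t y) (t, y)) \<partial>hline) \<le> norm ((\<integral>y. k y \<partial>hline) * norm (h t))"
        using AE_hline_pos
      proof eventually_elim
        case (elim t)
        have "(\<integral>y. norm (f t y) \<partial>hline) \<le> (\<integral>y. k y * norm (h t) \<partial>hline)"
        proof (rule integral_mono_AE)
          show "AE y in hline. norm (f t y) \<le> k y * norm (h t)"
            using AE_hline_pos by eventually_elim (rule f_le[OF elim])
        qed (use k_int int_y[OF elim] in auto)
        moreover have "(\<integral>y. norm (f t y) \<partial>hline) \<ge> 0" by (intro integral_nonneg_AE) auto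
        ultimately show ?case by simp
      qed
    qed measurable
  qed measurable
  have "(\<integral>t. heat_kernel a s 0 t *\<^sub>R h t \<partial>hline) = (\<integral>t. (hankel_const * hankel_const) *\<^sub>R (\<integral>y. f t y \<partial>hline) \<partial>hline)"
  proof (intro Bochner_Integration.integral_cong refl)
    fix t
    have "integrable hline (\<lambda>y. k y * hyp01 a (- (pi\<^sup>2 * t) * y))"
      using laplace_hyp01[OF a, of "pi / s" "- (pi\<^sup>2 * t)"] s unfolding k_def has_bochner_integral_iff by auto
    then have "(\<integral>y. f t y \<partial>hline) = (\<integral>y. k y * hyp01 a (- (pi\<^sup>2 * t) * y) \<partial>hline) *\<^sub>R h t"
      unfolding f_def by (subst integral_scaleR_left) (simp_all add: mult_ac)
    then show "heat_kernel a s 0 t *\<^sub>R h t = (hankel_const * hankel_const) *\<^sub>R (\<integral>y. f t y \<partial>hline)"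
      unfolding K by (simp add: mult_ac)
  qed
  also have "\<dots> = (hankel_const * hankel_const) *\<^sub>R (\<integral>t. (\<integral>y. f t y \<partial>hline) \<partial>hline)"
    by (rule integral_scaleR_right)
  also have "(\<integral>t. (\<integral>y. f t y \<partial>hline) \<partial>hline) = (\<integral>y. (\<integral>t. f t y \<partial>hline) \<partial>hline)"
    by (rule P.Fubini_integral[OF int, symmetric])
  also have "(\<lambda>y. \<integral>t. f t y \<partial>hline) = (\<lambda>y. (1 / hankel_const) *\<^sub>R (k y *\<^sub>R hankel h y))"
    using hankel_const_pos unfolding f_def hankel_def scaleR_scaleR[symmetric] integral_scaleR_right
    by (simp add: mult_ac fun_eq_iff)
  also have "(\<integral>y. (1 / hankel_const) *\<^sub>R (k y *\<^sub>R hankel h y) \<partial>hline) = (1 / hankel_const) *\<^sub>R (\<integral>y. k y *\<^sub>R hankel h y \<partial>hline)"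
    by (rule integral_scaleR_right)
  finally show ?thesis using hankel_const_pos by (simp add: k_def)
qed

text \<open>
  The limit \<open>s \<rightarrow> \<infinity>\<close> of \<open>smoothed_summation\<close>, taken term by term with Tannery's theorem. The decay
  of \<open>hankel h\<close> dominates one side and \<open>heat_kernel_decay\<close> the other. The terms at \<open>0\<close> appear as
  integrals: \<open>hankel h 0\<close> is a multiple of the integral of \<open>h\<close>, and the heat kernel term at \<open>0\<close>
  converges by \<open>heat_kernel_at_zero\<close>.
\<close>
theorem voronoi_summation:
  fixes h :: "real \<Rightarrow> complex"
  assumes hm [measurable]: "h \<in> borel_measurable borel" and h: "integrable hline h"
    and cont: "\<And>x. x > 0 \<Longrightarrow> isCont h x"
    and \<tau>: "\<tau> > 0" and C: "C \<ge> 0"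
    and h_decay: "\<And>t. t \<ge> 1 / 4 \<Longrightarrow> norm (h t) \<le> C * t powr (- 1 - \<tau>)"
    and hankel_decay: "\<And>y. y \<ge> 1 \<Longrightarrow> norm (hankel h y) \<le> C * y powr (- a - \<tau>)"
    and r_growth: "summable (\<lambda>n. r n * real n powr (- a - \<tau>))"
  shows "summable (\<lambda>n. (r (Suc n) * real (Suc n) powr (1 - a)) *\<^sub>R h (real (Suc n)))"
    and "summable (\<lambda>n. r (Suc n) *\<^sub>R hankel h (real (Suc n)))"
    and "integrable hline (\<lambda>y. y powr (a - 1) *\<^sub>R hankel h y)"
    and "(\<Sum>n. (r (Suc n) * real (Suc n) powr (1 - a)) *\<^sub>R h (real (Suc n)))
         + (r 0 * hankel_const) *\<^sub>R (\<integral>y. y powr (a - 1) *\<^sub>R hankel h y \<partial>hline)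
       = (\<Sum>n. r (Suc n) *\<^sub>R hankel h (real (Suc n))) + (r 0 * hankel_const) *\<^sub>R (\<integral>t. h t \<partial>hline)"
proof -
  have [measurable]: "hankel h \<in> borel_measurable borel" by (rule hankel_measurable[OF hm])
  define N where "N = hankel_const * (\<integral>t. norm (h t) \<partial>hline)"
  have N: "norm (hankel h y) \<le> N" if "y \<ge> 0" for y
    unfolding N_def by (rule norm_hankel_le[OF hm h that])
  show int: "integrable hline (\<lambda>y. y powr (a - 1) *\<^sub>R hankel h y)"
  proof (rule integrable_hline_tail[OF _ \<tau>])
    show "set_integrable lborel {0<..1::real} (\<lambda>y. N)"
      unfolding set_integrable_def by (intro integrable_scaleR_left) (auto simp: integrable_real_indicator)
    show "norm (y powr (a - 1) *\<^sub>R hankel h y) \<le> N" if "0 < y" "y \<le> 1" for y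
    proof -
      have "y powr (a - 1) * norm (hankel h y) \<le> 1 * norm (hankel h y)"
        using that a by (intro mult_right_mono powr_le1) auto
      also have "\<dots> \<le> N" using N[of y] that by simp
      finally show ?thesis by simp
    qed
    show "norm (y powr (a - 1) *\<^sub>R hankel h y) \<le> C * y powr (- 1 - \<tau>)" if "1 < y" for y
    proof -
      have "y powr (a - 1) * norm (hankel h y) \<le> y powr (a - 1) * (C * y powr (- a - \<tau>))"
        using that by (intro mult_left_mono hankel_decay) auto
      also have "\<dots> = C * (y powr (a - 1) * y powr (- a - \<tau>))" by simp
      also have "y powr (a - 1) * y powr (- a - \<tau>) = y powr (- 1 - \<tau>)"
        by (subst powr_add[symmetric]) simp
      finally show ?thesis by simp
    qed
  qed measurable
  define M where "M = (\<lambda>n s. \<integral>t. heat_kernel a s (real n) t *\<^sub>R h t \<partial>hline)"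
  \<comment> \<open>the limits of the heat kernel integrals \<open>M n s\<close> as \<open>s\<close> tends to infinity\<close>
  define L where "L = (\<lambda>n. if n = 0 then hankel_const *\<^sub>R (\<integral>y. y powr (a - 1) *\<^sub>R hankel h y \<partial>hline)
     else real n powr (1 - a) *\<^sub>R h (real n))"
  have lim0: "((\<lambda>s. M 0 s) \<longlongrightarrow> L 0) at_top"
  proof -
    have "((\<lambda>s. \<integral>y. (y powr (a - 1) * exp (- (pi / s * y))) *\<^sub>R hankel h y \<partial>hline) \<longlongrightarrow>
      (\<integral>y. y powr (a - 1) *\<^sub>R hankel h y \<partial>hline)) at_top"
    proof (rule integral_dominated_convergence_at_top[where w = "\<lambda>y. norm (y powr (a - 1) *\<^sub>R hankel h y)"])
      show "AE y in hline. ((\<lambda>s. (y powr (a - 1) * exp (- (pi / s * y))) *\<^sub>R hankel h y) \<longlongrightarrow> y powr (a - 1) *\<^sub>R hankel h y) at_top"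
      proof (rule AE_I2)
        fix y
        have "((\<lambda>s. pi / s) \<longlongrightarrow> 0) at_top" by real_asymp
        then have "((\<lambda>s. (y powr (a - 1) * exp (- (pi / s * y))) *\<^sub>R hankel h y) \<longlongrightarrow> (y powr (a - 1) * exp (- (0 * y))) *\<^sub>R hankel h y) at_top"
          by (intro tendsto_intros)
        then show "((\<lambda>s. (y powr (a - 1) * exp (- (pi / s * y))) *\<^sub>R hankel h y) \<longlongrightarrow> y powr (a - 1) *\<^sub>R hankel h y) at_top"
          by simp
      qed
      show "\<forall>\<^sub>F s in at_top. AE y in hline. norm ((y powr (a - 1) * exp (- (pi / s * y))) *\<^sub>R hankel h y) \<le> norm (y powr (a - 1) *\<^sub>R hankel h y)"
        using eventually_gt_at_top[of 0]
      proof eventually_elim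
        case (elim s)
        show ?case using AE_hline_pos
        proof eventually_elim
          case (elim y)
          have "exp (- (pi / s * y)) \<le> 1" using elim \<open>s > 0\<close> by simp
          then have "(y powr (a - 1) * norm (hankel h y)) * exp (- (pi / s * y)) \<le> (y powr (a - 1) * norm (hankel h y)) * 1"
            by (intro mult_left_mono) auto
          then show ?case by (simp add: mult_ac)
        qed
      qed
    qed (use int integrable_norm[OF int] in auto)
    from tendsto_scaleR[OF tendsto_const[of hankel_const] this]
    have "((\<lambda>s. hankel_const *\<^sub>R (\<integral>y. (y powr (a - 1) * exp (- (pi / s * y))) *\<^sub>R hankel h y \<partial>hline)) \<longlongrightarrow> L 0) at_top"
      by (simp add: L_def)
    moreover have "\<forall>\<^sub>F s in at_top. hankel_const *\<^sub>R (\<integral>y. (y powr (a - 1) * exp (- (pi / s * y))) *\<^sub>R hankel h y \<partial>hline) = M 0 s"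
      using eventually_gt_at_top[of 0]
      by eventually_elim (simp add: M_def heat_kernel_at_zero[OF hm h])
    ultimately show ?thesis by (rule Lim_transform_eventually)
  qed
  have lim: "((\<lambda>s. r n *\<^sub>R M n s) \<longlongrightarrow> r n *\<^sub>R L n) at_top" for n
  proof (intro tendsto_intros)
    show "((\<lambda>s. M n s) \<longlongrightarrow> L n) at_top"
    proof (cases "n = 0")
      case False
      then show ?thesis unfolding M_def L_def
        using heat_kernel_approx_identity[OF a _ hm h cont, of "real n"] by simp
    qed (use lim0 in auto)
  qed
  obtain D where D: "\<And>s x. s \<ge> 1 \<Longrightarrow> x \<ge> 1 \<Longrightarrow>
    norm (\<integral>t. heat_kernel a s x t *\<^sub>R h t \<partial>hline) \<le> D * x powr (- a - \<tau>)"
    using heat_kernel_decay[OF a \<tau> hm h C h_decay] by blast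
  have T1: "summable (\<lambda>n. norm (r n *\<^sub>R L n))"
      "((\<lambda>s. \<Sum>n. r n *\<^sub>R M n s) \<longlongrightarrow> (\<Sum>n. r n *\<^sub>R L n)) at_top"
  proof -
    have "eventually (\<lambda>(n, s). norm (r n *\<^sub>R M n s) \<le> D * (r n * real n powr (- a - \<tau>))) (at_top \<times>\<^sub>F at_top)"
      using eventually_prodI[OF eventually_ge_at_top[of 1] eventually_ge_at_top[of 1]]
    proof (rule eventually_mono, safe)
      fix n s assume "fst (n, s) \<ge> (1::nat)" "snd (n, s) \<ge> (1::real)"
      then have "r n * norm (M n s) \<le> r n * (D * real n powr (- a - \<tau>))"
        unfolding M_def using r_nonneg by (intro mult_left_mono D) auto
      then show "norm (r n *\<^sub>R M n s) \<le> D * (r n * real n powr (- a - \<tau>))"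
        using r_nonneg[of n] by (simp add: mult_ac)
    qed
    from tannerys_theorem[OF lim this summable_mult[OF r_growth]]
    show "summable (\<lambda>n. norm (r n *\<^sub>R L n))"
      "((\<lambda>s. \<Sum>n. r n *\<^sub>R M n s) \<longlongrightarrow> (\<Sum>n. r n *\<^sub>R L n)) at_top"
      by auto
  qed
  have T2: "summable (\<lambda>n. norm (r n *\<^sub>R hankel h (real n)))"
      "((\<lambda>s. \<Sum>n. (r n * exp (- (pi * real n / s))) *\<^sub>R hankel h (real n)) \<longlongrightarrow> (\<Sum>n. r n *\<^sub>R hankel h (real n))) at_top"
  proof -
    have lim: "((\<lambda>s. (r n * exp (- (pi * real n / s))) *\<^sub>R hankel h (real n)) \<longlongrightarrow> r n *\<^sub>R hankel h (real n)) at_top" for n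
    proof -
      have "((\<lambda>s. pi * real n / s) \<longlongrightarrow> 0) at_top"
        by (rule tendsto_divide_0[OF tendsto_const]) (rule filterlim_at_top_imp_at_infinity, rule filterlim_ident)
      then have "((\<lambda>s. (r n * exp (- (pi * real n / s))) *\<^sub>R hankel h (real n)) \<longlongrightarrow> (r n * exp (- 0)) *\<^sub>R hankel h (real n)) at_top"
        by (intro tendsto_intros)
      then show ?thesis by simp
    qed
    have "eventually (\<lambda>(n, s). norm ((r n * exp (- (pi * real n / s))) *\<^sub>R hankel h (real n)) \<le> C * (r n * real n powr (- a - \<tau>))) (at_top \<times>\<^sub>F at_top)"
      using eventually_prodI[OF eventually_ge_at_top[of 1] eventually_ge_at_top[of 1]]
    proof (rule eventually_mono, safe)
      fix n s assume "fst (n, s) \<ge> (1::nat)" "snd (n, s) \<ge> (1::real)"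
      then have ns: "n \<ge> 1" "s \<ge> 1" by auto
      have "(r n * exp (- (pi * real n / s))) * norm (hankel h (real n)) \<le> (r n * 1) * (C * real n powr (- a - \<tau>))"
        using r_nonneg ns by (intro mult_mono hankel_decay) auto
      then show "norm ((r n * exp (- (pi * real n / s))) *\<^sub>R hankel h (real n)) \<le> C * (r n * real n powr (- a - \<tau>))"
        using r_nonneg[of n] by (simp add: abs_mult mult_ac)
    qed
    from tannerys_theorem[OF lim this summable_mult[OF r_growth]]
    show "summable (\<lambda>n. norm (r n *\<^sub>R hankel h (real n)))"
      "((\<lambda>s. \<Sum>n. (r n * exp (- (pi * real n / s))) *\<^sub>R hankel h (real n)) \<longlongrightarrow> (\<Sum>n. r n *\<^sub>R hankel h (real n))) at_top"
      by auto
  qed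
  have "\<forall>\<^sub>F s in at_top. (\<Sum>n. (r n * exp (- (pi * real n / s))) *\<^sub>R hankel h (real n)) = (\<Sum>n. r n *\<^sub>R M n s)"
    using eventually_gt_at_top[of 0]
    by eventually_elim (unfold M_def, rule smoothed_summation[OF hm h])
  from Lim_transform_eventually[OF T2(2) this]
  have eq: "(\<Sum>n. r n *\<^sub>R L n) = (\<Sum>n. r n *\<^sub>R hankel h (real n))"
    using T1(2) by (intro tendsto_unique[of at_top]) auto
  have S1: "summable (\<lambda>n. r n *\<^sub>R L n)" and S2: "summable (\<lambda>n. r n *\<^sub>R hankel h (real n))"
    using T1(1) T2(1) by (auto intro: summable_norm_cancel)
  have L_Suc: "r (Suc n) *\<^sub>R L (Suc n) = (r (Suc n) * real (Suc n) powr (1 - a)) *\<^sub>R h (real (Suc n))" for n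
    by (simp add: L_def)
  show "summable (\<lambda>n. (r (Suc n) * real (Suc n) powr (1 - a)) *\<^sub>R h (real (Suc n)))"
    unfolding L_Suc[symmetric] using S1 by (subst summable_Suc_iff)
  show "summable (\<lambda>n. r (Suc n) *\<^sub>R hankel h (real (Suc n)))"
    using S2 by (subst summable_Suc_iff)
  have "(\<Sum>n. r (Suc n) *\<^sub>R L (Suc n)) + r 0 *\<^sub>R L 0 = (\<Sum>n. r (Suc n) *\<^sub>R hankel h (real (Suc n))) + r 0 *\<^sub>R hankel h 0"
    using suminf_split_head[OF S1] suminf_split_head[OF S2] eq by simp
  then show "(\<Sum>n. (r (Suc n) * real (Suc n) powr (1 - a)) *\<^sub>R h (real (Suc n)))
         + (r 0 * hankel_const) *\<^sub>R (\<integral>y. y powr (a - 1) *\<^sub>R hankel h y \<partial>hline)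
       = (\<Sum>n. r (Suc n) *\<^sub>R hankel h (real (Suc n))) + (r 0 * hankel_const) *\<^sub>R (\<integral>t. h t \<partial>hline)"
    unfolding L_Suc by (simp add: L_def hankel_def)
qed

end

section \<open>Sums of squares\<close>

lemma is_integral_continuous_on:
  assumes "is_integral f"
  shows "continuous_on {0<..} f"
proof -
  have "isCont f x" if x: "x > 0" for x
  proof -
    define l where "l = x / 2"
    define f' where "f' = (\<lambda>x. vector_derivative f (at x))"
    have l: "0 < l" "l < x" using x by (auto simp: l_def)
    have si: "set_integrable lebesgue {l..u} f'" and eq: "f u - f l = (LINT y:{l..u}|lebesgue. f' y)" if "l \<le> u" for u
      using assms that l(1) unfolding is_integral_def f'_def by blast+
    have "continuous_on {l..x + 1} (\<lambda>u. integral {l..u} f')"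
      using l by (intro indefinite_integral_continuous_1 set_lebesgue_integral_eq_integral(1) si) auto
    then have "continuous_on {l..x + 1} (\<lambda>u. f l + integral {l..u} f')"
      by (intro continuous_intros)
    also have "?this \<longleftrightarrow> continuous_on {l..x + 1} f"
    proof (rule continuous_on_cong)
      fix u assume "u \<in> {l..x + 1}"
      then show "f l + integral {l..u} f' = f u"
        using eq[of u] set_lebesgue_integral_eq_integral(2)[OF si[of u]] by (simp add: algebra_simps)
    qed simp
    finally have "continuous_on {l<..<x + 1} f" by (rule continuous_on_subset) auto
    then show ?thesis using l by (simp add: continuous_on_eq_continuous_at)
  qed
  then show ?thesis by (auto intro: continuous_at_imp_continuous_on)
qed

lemma lebesgue_eq_hline:
  fixes f g :: "real \<Rightarrow> complex"
  assumes [measurable]: "g \<in> borel_measurable borel" and eq: "\<And>x. x > 0 \<Longrightarrow> f x = g x"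
  shows "set_integrable lebesgue {0<..} f \<longleftrightarrow> integrable hline g"
    and "(LINT x:{0<..}|lebesgue. f x) = integral\<^sup>L hline g"
proof -
  have e: "(\<lambda>x. indicator {0<..} x *\<^sub>R f x) = (\<lambda>x. indicator {0<..} x *\<^sub>R g x)"
  proof
    fix x show "indicator {0<..} x *\<^sub>R f x = indicator {0<..} x *\<^sub>R g x"
      using eq[of x] by (cases "0 < x") auto
  qed
  show "set_integrable lebesgue {0<..} f \<longleftrightarrow> integrable hline g"
    by (subst integrable_hline, simp)
       (simp only: set_integrable_def e, rule integrable_completion, measurable)
  show "(LINT x:{0<..}|lebesgue. f x) = integral\<^sup>L hline g"
    by (subst integral_hline, simp)
       (simp only: set_lebesgue_integral_def e, rule integral_completion, measurable)
qed

lemma bessel_J_hyp01: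
  assumes a: "a \<ge> 1" and y: "y > 0" and t: "t > 0"
  shows "bessel_J (a - 1) (2 * pi * sqrt (y * t))
    = pi powr (a - 1) / Gamma a * (y powr ((a - 1) / 2) * t powr ((a - 1) / 2)) * hyp01 a (- (pi\<^sup>2 * y * t))"
proof -
  define z where "z = pi * sqrt (y * t)"
  have z: "z > 0" "z\<^sup>2 = pi\<^sup>2 * y * t" using y t by (auto simp: z_def power_mult_distrib)
  have gam: "Gamma a > 0" using a by (intro Gamma_real_pos) auto
  have zp: "z powr (a - 1) = pi powr (a - 1) * (y powr ((a - 1) / 2) * t powr ((a - 1) / 2))"
    unfolding z_def using y t
    by (simp add: powr_mult real_sqrt_mult powr_powr flip: powr_half_sqrt)
  have "(-1) ^ j * (2 * pi * sqrt (y * t) / 2) powr (2 * real j + (a - 1)) / (fact j * Gamma (real j + 1 + (a - 1)))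
      = z powr (a - 1) / Gamma a * ((- (z\<^sup>2)) ^ j / (fact j * pochhammer a j))" for j
  proof -
    have "Gamma (real j + 1 + (a - 1)) = pochhammer a j * Gamma a"
      using a by (subst pochhammer_Gamma) (auto simp: Gamma_eq_zero_iff add.commute dest: nonpos_Ints_nonpos)
    moreover have "(2 * pi * sqrt (y * t) / 2) powr (2 * real j + (a - 1)) = z powr (a - 1) * (z\<^sup>2) ^ j"
    proof -
      have "z powr (2 * real j + (a - 1)) = z powr (a - 1) * z powr (real (2 * j))"
        by (simp flip: powr_add add: add.commute)
      also have "z powr (real (2 * j)) = (z\<^sup>2) ^ j"
        using z(1) by (subst powr_realpow) (auto simp: power_mult)
      finally show ?thesis by (simp add: z_def)
    qed
    ultimately show ?thesis by (simp add: power_minus[of "z\<^sup>2"] mult_ac)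
  qed
  then have "bessel_J (a - 1) (2 * pi * sqrt (y * t)) = (\<Sum>j. z powr (a - 1) / Gamma a * ((- (z\<^sup>2)) ^ j / (fact j * pochhammer a j)))"
    unfolding bessel_J_def by simp
  also have "\<dots> = z powr (a - 1) / Gamma a * hyp01 a (- (z\<^sup>2))"
    unfolding hyp01_def by (rule suminf_mult[OF summable_hyp01[OF a]])
  finally show ?thesis by (simp add: zp z(2))
qed

text \<open>
  On the compact interval between \<open>d\<close> and the point where the asymptotic bound takes over, \<open>x\<^sup>m\<close>
  is bounded below by a positive number.
\<close>
lemma decay_from_bigo:
  fixes f :: "real \<Rightarrow> complex"
  assumes bigo: "(\<lambda>x. norm (f x)) \<in> O[at_top](\<lambda>x. x powr m)" and m: "m \<le> 0" and d: "d > 0"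
    and bounded: "\<And>T. \<exists>B. \<forall>x\<in>{d..T}. norm (f x) \<le> B"
  obtains C where "C \<ge> 0" "\<And>x. x \<ge> d \<Longrightarrow> norm (f x) \<le> C * x powr m"
proof -
  obtain c where c: "c > 0" "\<forall>\<^sub>F x in at_top. norm (norm (f x)) \<le> c * norm (x powr m)"
    using bigo by (elim landau_o.bigE)
  then obtain T0 where T0: "\<And>x. x \<ge> T0 \<Longrightarrow> norm (f x) \<le> c * x powr m"
    by (auto simp: eventually_at_top_linorder)
  define T where "T = max T0 d"
  obtain B where B: "\<And>x. x \<in> {d..T} \<Longrightarrow> norm (f x) \<le> B" using bounded[of T] by blast
  have T: "T > 0" "T \<ge> d" using d by (auto simp: T_def)
  have B0: "B \<ge> 0" using order_trans[OF norm_ge_zero B[of d]] T by simp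
  show thesis
  proof (rule that[of "max c (B / T powr m)"])
    show "0 \<le> max c (B / T powr m)" using c by auto
    fix x assume x: "x \<ge> d"
    show "norm (f x) \<le> max c (B / T powr m) * x powr m"
    proof (cases "x \<le> T")
      case True
      have "norm (f x) \<le> B / T powr m * T powr m" using B[of x] True x T by simp
      also have "\<dots> \<le> B / T powr m * x powr m"
        using True x d m B0 by (intro mult_left_mono powr_mono2') auto
      also have "\<dots> \<le> max c (B / T powr m) * x powr m" by (intro mult_right_mono) auto
      finally show ?thesis .
    next
      case False
      then have "norm (f x) \<le> c * x powr m" by (intro T0) (auto simp: T_def)
      also have "\<dots> \<le> max c (B / T powr m) * x powr m" by (intro mult_right_mono) auto
      finally show ?thesis .
    qed
  qed
qed

lemma theta_sequence_sum_squares: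
  assumes k: "k \<ge> 2"
  shows "theta_sequence (\<lambda>n. real (sum_squares_count k (int n))) (real k / 2)"
proof
  show "1 \<le> real k / 2" using k by simp
  fix w :: real assume w: "w > 0"
  show "summable (\<lambda>n. real (sum_squares_count k (int n)) * exp (- (pi * real n * w)))"
    using theta_power_sums[OF w] by (rule sums_summable)
  have "(w powr (- 1 / 2)) ^ k = w powr (- (real k / 2))"
    using w by (simp add: powr_powr flip: powr_realpow)
  then show "(\<Sum>n. real (sum_squares_count k (int n)) * exp (- (pi * real n * w))) = w powr (- (real k / 2)) *
       (\<Sum>n. real (sum_squares_count k (int n)) * exp (- (pi * real n * (1 / w))))"
    using theta_power_sums[OF w, of k] theta_power_sums[of "1 / w" k] w theta_inversion[OF w]
    by (simp add: sums_iff power_mult_distrib)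
qed auto

text \<open>
  With \<open>h(t) = t\<^sup>b F(t)\<close> for \<open>t > 0\<close> one has \<open>G(y) = y\<^sup>b hankel h y\<close> by \<open>bessel_J_hyp01\<close>, and the claim
  becomes \<open>voronoi_summation\<close> for \<open>r\<^sub>k\<close>. Near \<open>0\<close> the function \<open>h\<close> is integrable because \<open>F\<close> is square
  integrable and \<open>b \<ge> 0\<close>.
\<close>
theorem theorem1p5:
  fixes k :: nat and \<tau> :: real and F G :: "real \<Rightarrow> complex"
  assumes hyp_F:
    "(k > 3 \<and>
      (let m = k div 2 - 1 in
        (\<forall>j \<le> 2 * m - 1. is_integral (nth_vderiv j F)) \<and>
        (\<forall>j \<le> 2 * m. L2_half_line (\<lambda>x. of_real (x ^ j) * nth_vderiv j F x))))
     \<or>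
     ((k = 2 \<or> k = 3) \<and>
      continuous_on {0..} F \<and>
      L2_half_line F \<and>
      (AE x in lebesgue. 0 < x \<longrightarrow> F differentiable (at x)) \<and>
      L2_half_line (\<lambda>x. of_real x * vector_derivative F (at x)))"
    and tau: "\<tau> > 0"
    and decay_F: "(\<lambda>x. norm (F x)) \<in> O[at_top](\<lambda>x. x powr (- real k / 4 - 1 / 2 - \<tau>))"
    and G_def: "\<And>y. y > 0 \<Longrightarrow>
      G y = of_real pi * (LINT t:{0<..}|lebesgue.
              F t * of_real (bessel_J (real k / 2 - 1) (2 * pi * sqrt (y * t))))"
    and decay_G: "(\<lambda>y. norm (G y)) \<in> O[at_top](\<lambda>y. y powr (- real k / 4 - 1 / 2 - \<tau>))"
  shows
    "summable (\<lambda>n. of_real (real (sum_squares_count k (int (Suc n)))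
         * real (Suc n) powr (1 / 2 - real k / 4)) * F (real (Suc n))) \<and>
     summable (\<lambda>n. of_real (real (sum_squares_count k (int (Suc n)))
         * real (Suc n) powr (1 / 2 - real k / 4)) * G (real (Suc n))) \<and>
     set_integrable lebesgue {0<..} (\<lambda>x. of_real (x powr (real k / 4 - 1 / 2)) * F x) \<and>
     set_integrable lebesgue {0<..} (\<lambda>x. of_real (x powr (real k / 4 - 1 / 2)) * G x) \<and>
     (\<Sum>n. of_real (real (sum_squares_count k (int (Suc n)))
         * real (Suc n) powr (1 / 2 - real k / 4)) * F (real (Suc n)))
       - of_real (pi powr (real k / 2) / Gamma (real k / 2))
         * (LINT x:{0<..}|lebesgue. of_real (x powr (real k / 4 - 1 / 2)) * F x)
     = (\<Sum>n. of_real (real (sum_squares_count k (int (Suc n)))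
         * real (Suc n) powr (1 / 2 - real k / 4)) * G (real (Suc n)))
       - of_real (pi powr (real k / 2) / Gamma (real k / 2))
         * (LINT x:{0<..}|lebesgue. of_real (x powr (real k / 4 - 1 / 2)) * G x)"
proof -
  define a b where "a = real k / 2" and "b = real k / 4 - 1 / 2"
  have k: "k \<ge> 2" using hyp_F by auto
  have a: "a \<ge> 1" and b0: "b \<ge> 0" and ab: "a - 1 = b + b" "(a - 1) / 2 = b"
    using k by (auto simp: a_def b_def field_simps)
  have F_cont: "continuous_on {0<..} F" and F_L2: "L2_half_line F"
  proof -
    have "continuous_on {0<..} F \<and> L2_half_line F"
      using hyp_F
    proof
      assume *: "k > 3 \<and>
      (let m = k div 2 - 1 in
        (\<forall>j \<le> 2 * m - 1. is_integral (nth_vderiv j F)) \<and>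
        (\<forall>j \<le> 2 * m. L2_half_line (\<lambda>x. of_real (x ^ j) * nth_vderiv j F x)))"
      then have "is_integral (nth_vderiv 0 F)" "L2_half_line (\<lambda>x. of_real (x ^ 0) * nth_vderiv 0 F x)"
        unfolding Let_def by blast+
      then show ?thesis using is_integral_continuous_on by (simp add: nth_vderiv_def)
    next
      assume "(k = 2 \<or> k = 3) \<and> continuous_on {0..} F \<and> L2_half_line F \<and>
        (AE x in lebesgue. 0 < x \<longrightarrow> F differentiable (at x)) \<and>
        L2_half_line (\<lambda>x. of_real x * vector_derivative F (at x))"
      then show ?thesis by (auto elim: continuous_on_subset)
    qed
    then show "continuous_on {0<..} F" "L2_half_line F" by auto
  qed
  define r where "r = (\<lambda>n. real (sum_squares_count k (int n)))"
  interpret theta_sequence r a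
    unfolding r_def a_def by (rule theta_sequence_sum_squares[OF k])
  \<comment> \<open>the indicator makes \<open>h\<close> Borel measurable on the whole line, whatever \<open>F\<close> is for \<open>t \<le> 0\<close>\<close>
  define h where "h = (\<lambda>t. indicator {0<..} t *\<^sub>R (t powr b *\<^sub>R F t))"
  have h_cont0: "continuous_on {0<..} (\<lambda>t. t powr b *\<^sub>R F t)"
    by (intro continuous_intros F_cont) auto
  then have hm [measurable]: "h \<in> borel_measurable borel"
    unfolding h_def by (intro borel_measurable_continuous_on_indicator) auto
  have h_eq: "h t = t powr b *\<^sub>R F t" if "t > 0" for t using that by (simp add: h_def)
  have h_contS: "continuous_on {0<..} h"
    using h_cont0 by (subst continuous_on_cong[OF refl h_eq]) auto
  then have h_cont: "isCont h x" if "x > 0" for x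
    using that by (simp add: continuous_on_eq_continuous_at)
  obtain C1 where C1: "C1 \<ge> 0" "\<And>t. t \<ge> 1 / 4 \<Longrightarrow> norm (F t) \<le> C1 * t powr (- real k / 4 - 1 / 2 - \<tau>)"
  proof (rule decay_from_bigo[OF decay_F, of "1 / 4"])
    show "- real k / 4 - 1 / 2 - \<tau> \<le> 0" using tau by simp
    fix T :: real
    have "continuous_on {1 / 4..T} F" by (rule continuous_on_subset[OF F_cont]) auto
    then have "bounded (F ` {1 / 4..T})"
      by (intro compact_imp_bounded compact_continuous_image) auto
    then obtain B where "\<forall>z\<in>F ` {1 / 4..T}. norm z \<le> B"
      unfolding bounded_iff by metis
    then show "\<exists>B. \<forall>x\<in>{1 / 4..T}. norm (F x) \<le> B" by auto
  qed auto
  have h_decay: "norm (h t) \<le> C1 * t powr (- 1 - \<tau>)" if t: "t \<ge> 1 / 4" for t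
  proof -
    have "norm (h t) = t powr b * norm (F t)" using t by (simp add: h_eq)
    also have "\<dots> \<le> t powr b * (C1 * t powr (- real k / 4 - 1 / 2 - \<tau>))"
      by (intro mult_left_mono C1(2) t) auto
    also have "\<dots> = C1 * (t powr b * t powr (- real k / 4 - 1 / 2 - \<tau>))" by simp
    also have "t powr b * t powr (- real k / 4 - 1 / 2 - \<tau>) = t powr (- 1 - \<tau>)"
      by (subst powr_add[symmetric]) (simp add: b_def)
    finally show ?thesis .
  qed
  have h_int: "integrable hline h"
  proof (rule integrable_hline_tail[OF hm tau])
    have "set_integrable lebesgue {0<..} (\<lambda>x. (norm (F x))\<^sup>2)"
      using F_L2 by (simp add: L2_half_line_def)
    moreover have "(\<lambda>x. indicator {0<..} x *\<^sub>R (norm (F x))\<^sup>2) = (\<lambda>x. (norm (indicator {0<..} x *\<^sub>R F x))\<^sup>2)"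
      by (auto simp: indicator_def)
    ultimately have L2: "integrable lebesgue (\<lambda>x. (norm (indicator {0<..} x *\<^sub>R F x))\<^sup>2)"
      by (simp only: set_integrable_def)
    have [measurable]: "(\<lambda>x. indicator {0<..} x *\<^sub>R F x) \<in> borel_measurable borel"
      by (intro borel_measurable_continuous_on_indicator F_cont) auto
    have "(\<lambda>x. (norm (indicator {0<..} x *\<^sub>R F x))\<^sup>2) \<in> borel_measurable lborel" by measurable
    then have "integrable lborel (\<lambda>x. (norm (indicator {0<..} x *\<^sub>R F x))\<^sup>2)"
      using L2 by (simp only: integrable_completion)
    then have "integrable lborel (\<lambda>x. indicator {0<..1} x *\<^sub>R 1 + (norm (indicator {0<..} x *\<^sub>R F x))\<^sup>2 :: real)"
      by (intro Bochner_Integration.integrable_add integrable_scaleR_left) (auto simp: integrable_real_indicator)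
    then show "set_integrable lborel {0<..1} (\<lambda>x. indicator {0<..1} x *\<^sub>R 1 + (norm (indicator {0<..} x *\<^sub>R F x))\<^sup>2 :: real)"
      unfolding set_integrable_def by (intro integrable_mult_indicator) auto
    fix t :: real assume t: "0 < t" "t \<le> 1"
    have "norm (h t) = t powr b * norm (F t)" using t by (simp add: h_eq)
    also have "\<dots> \<le> 1 * norm (F t)"
      using t b0 by (intro mult_right_mono powr_le1) auto
    also have "\<dots> \<le> 1 + (norm (F t))\<^sup>2"
      using zero_le_power2[of "norm (F t) - 1"] norm_ge_zero[of "F t"]
      unfolding power2_diff power_one mult_1_right by linarith
    finally show "norm (h t) \<le> indicator {0<..1} t *\<^sub>R 1 + (norm (indicator {0<..} t *\<^sub>R F t))\<^sup>2"
      using t by simp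
  next
    fix t :: real assume "1 < t"
    then show "norm (h t) \<le> C1 * t powr (- 1 - \<tau>)" by (intro h_decay) auto
  qed
  have [measurable]: "hankel h \<in> borel_measurable borel" by (rule hankel_measurable[OF hm])
  have G_eq: "G y = y powr b *\<^sub>R hankel h y" if y: "y > 0" for y
  proof -
    have "(LINT t:{0<..}|lebesgue. F t * of_real (bessel_J (real k / 2 - 1) (2 * pi * sqrt (y * t))))
       = (\<integral>t. (pi powr (a - 1) / Gamma a * y powr b) *\<^sub>R (hyp01 a (- (pi\<^sup>2 * y * t)) *\<^sub>R h t) \<partial>hline)"
    proof (rule lebesgue_eq_hline(2))
      show "(\<lambda>t. (pi powr (a - 1) / Gamma a * y powr b) *\<^sub>R (hyp01 a (- (pi\<^sup>2 * y * t)) *\<^sub>R h t)) \<in> borel_measurable borel"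
        using a by measurable
      show "F t * of_real (bessel_J (real k / 2 - 1) (2 * pi * sqrt (y * t)))
        = (pi powr (a - 1) / Gamma a * y powr b) *\<^sub>R (hyp01 a (- (pi\<^sup>2 * y * t)) *\<^sub>R h t)" if t: "t > 0" for t
        using bessel_J_hyp01[OF a y t] t unfolding ab(2)
        by (simp add: a_def h_eq scaleR_conv_of_real mult_ac)
    qed
    also have "\<dots> = (pi powr (a - 1) / Gamma a * y powr b) *\<^sub>R (\<integral>t. hyp01 a (- (pi\<^sup>2 * y * t)) *\<^sub>R h t \<partial>hline)"
      by (rule integral_scaleR_right)
    finally have "G y = (pi * (pi powr (a - 1) / Gamma a * y powr b)) *\<^sub>R (\<integral>t. hyp01 a (- (pi\<^sup>2 * y * t)) *\<^sub>R h t \<partial>hline)"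
      unfolding G_def[OF y] by (simp add: scaleR_conv_of_real)
    moreover have "pi * pi powr (a - 1) = pi powr a" by (simp add: powr_diff)
    ultimately show ?thesis
      by (simp add: hankel_def hankel_const_def mult_ac flip: mult.assoc)
  qed
  obtain C2 where C2: "C2 \<ge> 0" "\<And>y. y \<ge> 1 \<Longrightarrow> norm (G y) \<le> C2 * y powr (- real k / 4 - 1 / 2 - \<tau>)"
  proof (rule decay_from_bigo[OF decay_G, of 1])
    show "- real k / 4 - 1 / 2 - \<tau> \<le> 0" using tau by simp
    fix T :: real
    define N where "N = hankel_const * (\<integral>t. norm (h t) \<partial>hline)"
    have "norm (G y) \<le> T powr b * N" if "y \<in> {1..T}" for y
      using that b0 norm_hankel_le[OF hm h_int, of y]
      by (auto simp: G_eq N_def intro!: mult_mono powr_mono2)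
    then show "\<exists>B. \<forall>x\<in>{1..T}. norm (G x) \<le> B" by blast
  qed auto
  have hankel_decay: "norm (hankel h y) \<le> C2 * y powr (- a - \<tau>)" if y: "y \<ge> 1" for y
  proof -
    have "y powr (- b) * y powr b = 1" using y by (simp flip: powr_add)
    then have "norm (hankel h y) = y powr (- b) * norm (G y)"
      using y by (simp add: G_eq flip: mult.assoc)
    also have "\<dots> \<le> y powr (- b) * (C2 * y powr (- real k / 4 - 1 / 2 - \<tau>))"
      by (intro mult_left_mono C2(2) y) auto
    also have "\<dots> = C2 * (y powr (- b) * y powr (- real k / 4 - 1 / 2 - \<tau>))" by simp
    also have "y powr (- b) * y powr (- real k / 4 - 1 / 2 - \<tau>) = y powr (- a - \<tau>)"
      by (subst powr_add[symmetric]) (simp add: b_def a_def)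
    finally show ?thesis .
  qed
  have r_growth: "summable (\<lambda>n. r n * real n powr (- a - \<tau>))"
  proof (rule summable_bounded_rate)
    have "summable (\<lambda>n. r n * (1 + real n) powr (- (a + \<tau>)))"
      unfolding r_def using k tau by (intro summable_sum_squares_count) (auto simp: a_def)
    then show "summable (\<lambda>n. 2 powr (a + \<tau>) * (r n * (1 + real n) powr (- (a + \<tau>))))"
      by (rule summable_mult)
    fix n :: nat assume n: "n \<ge> 1"
    have "real n powr (- a - \<tau>) \<le> ((1 + real n) / 2) powr (- a - \<tau>)"
      using n a tau by (intro powr_mono2') auto
    also have "\<dots> = 2 powr (a + \<tau>) * (1 + real n) powr (- (a + \<tau>))"
    proof -
      define p where "p = a + \<tau>"
      have e: "- a - \<tau> = - p" by (simp add: p_def)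
      show ?thesis unfolding p_def[symmetric] e by (simp add: powr_divide powr_minus field_simps)
    qed
    finally have "r n * real n powr (- a - \<tau>) \<le> r n * (2 powr (a + \<tau>) * (1 + real n) powr (- (a + \<tau>)))"
      by (intro mult_left_mono r_nonneg)
    then show "norm (r n * real n powr (- a - \<tau>)) \<le> 2 powr (a + \<tau>) * (r n * (1 + real n) powr (- (a + \<tau>)))"
      using r_nonneg[of n] by (simp add: mult_ac)
  qed
  define C where "C = max C1 C2"
  have C: "C \<ge> 0" "C1 \<le> C" "C2 \<le> C" using C1(1) by (auto simp: C_def)
  have hd: "norm (h t) \<le> C * t powr (- 1 - \<tau>)" if "t \<ge> 1 / 4" for t
    using h_decay[OF that] C(2) by (rule order_trans[OF _ mult_right_mono]) auto
  have gd: "norm (hankel h y) \<le> C * y powr (- a - \<tau>)" if "y \<ge> 1" for y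
    using hankel_decay[OF that] C(3) by (rule order_trans[OF _ mult_right_mono]) auto
  note V = voronoi_summation[OF hm h_int h_cont tau C(1) hd gd r_growth]
  have bneg: "1 / 2 - real k / 4 = - b" by (simp add: b_def)
  have tF: "of_real (real (sum_squares_count k (int (Suc n))) * real (Suc n) powr (1 / 2 - real k / 4)) * F (real (Suc n))
      = (r (Suc n) * real (Suc n) powr (1 - a)) *\<^sub>R h (real (Suc n))" for n
  proof -
    have "1 - a + b = - b" using ab by simp
    then have "real (Suc n) powr (1 - a) * real (Suc n) powr b = real (Suc n) powr (- b)"
      by (simp only: powr_add[symmetric])
    then show ?thesis unfolding bneg r_def
      by (simp add: h_eq scaleR_conv_of_real mult.assoc flip: of_real_mult)
  qed
  have tG: "of_real (real (sum_squares_count k (int (Suc n))) * real (Suc n) powr (1 / 2 - real k / 4)) * G (real (Suc n))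
      = r (Suc n) *\<^sub>R hankel h (real (Suc n))" for n
  proof -
    have "real (Suc n) powr (- b) * real (Suc n) powr b = 1"
      by (simp only: powr_add[symmetric]) simp
    then show ?thesis unfolding bneg r_def
      by (simp add: G_eq scaleR_conv_of_real mult.assoc flip: of_real_mult)
  qed
  have iF: "of_real (x powr (real k / 4 - 1 / 2)) * F x = h x" if "x > 0" for x
    using that by (simp add: h_eq b_def scaleR_conv_of_real)
  have iG: "of_real (x powr (real k / 4 - 1 / 2)) * G x = x powr (a - 1) *\<^sub>R hankel h x" if "x > 0" for x
    using that unfolding ab(1) powr_add by (simp add: G_eq b_def[symmetric] scaleR_conv_of_real mult.assoc)
  have gm: "(\<lambda>x. x powr (a - 1) *\<^sub>R hankel h x) \<in> borel_measurable borel" by measurable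
  have LF: "set_integrable lebesgue {0<..} (\<lambda>x. of_real (x powr (real k / 4 - 1 / 2)) * F x) \<longleftrightarrow> integrable hline h"
      "(LINT x:{0<..}|lebesgue. of_real (x powr (real k / 4 - 1 / 2)) * F x) = integral\<^sup>L hline h"
    by (rule lebesgue_eq_hline[OF hm]; erule iF)+
  have LG: "set_integrable lebesgue {0<..} (\<lambda>x. of_real (x powr (real k / 4 - 1 / 2)) * G x)
        \<longleftrightarrow> integrable hline (\<lambda>x. x powr (a - 1) *\<^sub>R hankel h x)"
      "(LINT x:{0<..}|lebesgue. of_real (x powr (real k / 4 - 1 / 2)) * G x)
        = (\<integral>x. x powr (a - 1) *\<^sub>R hankel h x \<partial>hline)"
    by (rule lebesgue_eq_hline[OF gm]; erule iG)+
  have r0: "r 0 = 1" by (simp add: r_def sum_squares_count_0)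
  have const: "of_real (pi powr (real k / 2) / Gamma (real k / 2)) * z = hankel_const *\<^sub>R z" for z :: complex
    unfolding hankel_const_def scaleR_conv_of_real by (simp add: a_def)
  show ?thesis
    unfolding tF tG const LF LG
    using V h_int by (simp add: r0 algebra_simps)
qed

end
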